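(* Let $X$ be a compact Hausdorff topological space and let $m$ be a finite regular complex Borel measure on $X$. Let $i: C(X)\to L^\infty(m)$ be the canonical map. Let $\phi: L^\infty(m)^*\to L^1(m)$ be the map defined as follows: for $\lambda\in L^\infty(m)^*$, let $\mu$ be the complex regular Borel measure on $X$ representing the functional $\lambda\circ i\in C(X)^*$ via the Riesz representation theorem, let $\mu=\mu_a+\mu_s$ be its Lebesgue decomposition with respect to $m$, with $\mu_a$ absolutely continuous and $\mu_s$ singular, and put $\phi(\lambda)=\frac{d\mu_a}{dm}$. Let $K(\phi)=\ker\phi$. Then the short exact sequence $$0\longrightarrow K(\phi)\longrightarrow L^\infty(m)^*\xrightarrow{\ \phi\ }L^1(m)\longrightarrow 0,$$ whose first map is the inclusion, is split, and therefore $$L^\infty(m)^*\cong L^1(m)\oplus K(\phi).$$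
   Context: All spaces are complex Banach spaces, and $^*$ denotes the continuous (Banach) dual. $C(X)$ is the space of continuous complex-valued functions on $X$ with the sup norm. $L^1(m)$ and $L^\infty(m)$ are the usual Lebesgue spaces; for a complex measure $m$, null sets, integrability, essential suprema, absolute continuity and singularity with respect to $m$ are understood with respect to the total variation measure $|m|$, so $L^1(m)=L^1(|m|)$ and $L^\infty(m)=L^\infty(|m|)$. The canonical map $i:C(X)\to L^\infty(m)$ sends a continuous function to its class modulo $m$-a.e. equality; $\lambda\circ i$ is what is meant by the restriction $\lambda|_{C(X)}$. By the Riesz representation theorem, $C(X)^*$ is isometrically isomorphic to the Banach space $M(X)$ of complex regular Borel measures on $X$ (with the total variation norm). By the Lebesgue-Radon-Nikodym theorem, the measures $\mu_a$ absolutely continuous with respect to $m$ are identified with $L^1(m)$ via $d\mu_a=g\,dm$, and $g=\frac{d\mu_a}{dm}$ denotes the Radon-Nikodym derivative. "Split" means that the surjection $\phi$ admits a bounded linear right inverse $L^1(m)\to L^\infty(m)^*$, and $\cong$ denotes isomorphism of Banach spaces (linear homeomorphism). *)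

theory Defs
  imports "HOL-Probability.Essential_Supremum"
begin

section \<open>Complex normed spaces with explicit carriers\<close>

text \<open>The spaces \<open>L\<^sup>1(m)\<close> and \<open>L\<^sup>\<infinity>(m)\<close> depend on a term, so they cannot be types of a
  normed-space class; a normed space is a record of its carrier and its operations.\<close>

record 'v cspace =
  vcarrier :: "'v set"
  vzero :: 'v
  vadd :: "'v \<Rightarrow> 'v \<Rightarrow> 'v"
  vscale :: "complex \<Rightarrow> 'v \<Rightarrow> 'v"
  vnorm :: "'v \<Rightarrow> real"

definition complex_field_space :: "complex cspace" where
  "complex_field_space =
     \<lparr>vcarrier = UNIV, vzero = 0, vadd = (+), vscale = (*), vnorm = cmod\<rparr>"

definition bounded_linear_map :: "'v cspace \<Rightarrow> 'w cspace \<Rightarrow> ('v \<Rightarrow> 'w) \<Rightarrow> bool" where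
  "bounded_linear_map V W f \<longleftrightarrow>
     f \<in> vcarrier V \<rightarrow> vcarrier W \<and>
     (\<forall>x\<in>vcarrier V. \<forall>y\<in>vcarrier V. f (vadd V x y) = vadd W (f x) (f y)) \<and>
     (\<forall>c. \<forall>x\<in>vcarrier V. f (vscale V c x) = vscale W c (f x)) \<and>
     (\<exists>K. \<forall>x\<in>vcarrier V. vnorm W (f x) \<le> K * vnorm V x)"

definition dual :: "'v cspace \<Rightarrow> ('v \<Rightarrow> complex) cspace" where
  "dual V =
     \<lparr>vcarrier = {l \<in> extensional (vcarrier V). bounded_linear_map V complex_field_space l},
      vzero = (\<lambda>x\<in>vcarrier V. 0),
      vadd = (\<lambda>l k. \<lambda>x\<in>vcarrier V. l x + k x),
      vscale = (\<lambda>c l. \<lambda>x\<in>vcarrier V. c * l x),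
      vnorm = (\<lambda>l. Sup {cmod (l x) | x. x \<in> vcarrier V \<and> vnorm V x \<le> 1})\<rparr>"

definition kernel_space :: "'v cspace \<Rightarrow> 'w cspace \<Rightarrow> ('v \<Rightarrow> 'w) \<Rightarrow> 'v cspace" where
  "kernel_space V W f = V\<lparr>vcarrier := {x \<in> vcarrier V. f x = vzero W}\<rparr>"

definition direct_sum :: "'v cspace \<Rightarrow> 'w cspace \<Rightarrow> ('v \<times> 'w) cspace" where
  "direct_sum V W =
     \<lparr>vcarrier = vcarrier V \<times> vcarrier W,
      vzero = (vzero V, vzero W),
      vadd = (\<lambda>(x, y) (x', y'). (vadd V x x', vadd W y y')),
      vscale = (\<lambda>c (x, y). (vscale V c x, vscale W c y)),
      vnorm = (\<lambda>(x, y). vnorm V x + vnorm W y)\<rparr>"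

definition banach_isomorphic :: "'v cspace \<Rightarrow> 'w cspace \<Rightarrow> bool" where
  "banach_isomorphic V W \<longleftrightarrow>
     (\<exists>f. bij_betw f (vcarrier V) (vcarrier W) \<and>
          bounded_linear_map V W f \<and>
          bounded_linear_map W V (inv_into (vcarrier V) f))"

definition short_exact ::
    "'u cspace \<Rightarrow> 'v cspace \<Rightarrow> 'w cspace \<Rightarrow> ('u \<Rightarrow> 'v) \<Rightarrow> ('v \<Rightarrow> 'w) \<Rightarrow> bool" where
  "short_exact U V W j p \<longleftrightarrow>
     bounded_linear_map U V j \<and> bounded_linear_map V W p \<and>
     inj_on j (vcarrier U) \<and>
     j ` vcarrier U = {x \<in> vcarrier V. p x = vzero W} \<and>
     p ` vcarrier V = vcarrier W"

definition split_surjection :: "'v cspace \<Rightarrow> 'w cspace \<Rightarrow> ('v \<Rightarrow> 'w) \<Rightarrow> bool" where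
  "split_surjection V W p \<longleftrightarrow>
     (\<exists>s. bounded_linear_map W V s \<and> (\<forall>y\<in>vcarrier W. p (s y) = y))"


section \<open>\<open>L\<^sup>1\<close> and \<open>L\<^sup>\<infinity>\<close> of a positive measure, as spaces of classes modulo a.e. equality\<close>

definition ae_class :: "'a measure \<Rightarrow> ('a \<Rightarrow> complex) \<Rightarrow> ('a \<Rightarrow> complex) set" where
  "ae_class M f = {g \<in> borel_measurable M. AE x in M. g x = f x}"

definition rep :: "('a \<Rightarrow> complex) set \<Rightarrow> 'a \<Rightarrow> complex" where
  "rep F = (SOME f. f \<in> F)"

definition L1_space :: "'a measure \<Rightarrow> ('a \<Rightarrow> complex) set cspace" where
  "L1_space M =
     \<lparr>vcarrier = ae_class M ` {f. integrable M f},
      vzero = ae_class M (\<lambda>x. 0),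
      vadd = (\<lambda>F G. ae_class M (\<lambda>x. rep F x + rep G x)),
      vscale = (\<lambda>c F. ae_class M (\<lambda>x. c * rep F x)),
      vnorm = (\<lambda>F. \<integral>x. cmod (rep F x) \<partial>M)\<rparr>"

definition Linf_space :: "'a measure \<Rightarrow> ('a \<Rightarrow> complex) set cspace" where
  "Linf_space M =
     \<lparr>vcarrier = ae_class M `
        {f \<in> borel_measurable M. esssup M (\<lambda>x. ennreal (cmod (f x))) < \<infinity>},
      vzero = ae_class M (\<lambda>x. 0),
      vadd = (\<lambda>F G. ae_class M (\<lambda>x. rep F x + rep G x)),
      vscale = (\<lambda>c F. ae_class M (\<lambda>x. c * rep F x)),
      vnorm = (\<lambda>F. enn2real (esssup M (\<lambda>x. ennreal (cmod (rep F x)))))\<rparr>"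


section \<open>Complex measures\<close>

text \<open>A complex measure on the measurable space of \<open>B\<close> (whose own measure is irrelevant) is a set
  function; it is normalised to be 0 outside the \<open>\<sigma>\<close>-algebra, so that equal measures are equal
  functions.\<close>

definition complex_measure :: "'a measure \<Rightarrow> ('a set \<Rightarrow> complex) \<Rightarrow> bool" where
  "complex_measure B \<mu> \<longleftrightarrow>
     (\<forall>A::nat \<Rightarrow> 'a set. range A \<subseteq> sets B \<longrightarrow> disjoint_family A \<longrightarrow>
        (\<lambda>i. \<mu> (A i)) sums \<mu> (\<Union>i. A i)) \<and>
     (\<forall>E. E \<notin> sets B \<longrightarrow> \<mu> E = 0)"

definition total_variation :: "'a measure \<Rightarrow> ('a set \<Rightarrow> complex) \<Rightarrow> 'a measure" where
  "total_variation B \<mu> = measure_of (space B) (sets B)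
     (\<lambda>E. SUP A\<in>{A::nat \<Rightarrow> 'a set. range A \<subseteq> sets B \<and> disjoint_family A \<and> (\<Union>i. A i) = E}.
        \<Sum>i. ennreal (cmod (\<mu> (A i))))"

text \<open>A density \<open>h\<close> of modulus 1 in the polar decomposition \<open>d\<mu> = h d|\<mu>|\<close>; it is unique up to
  \<open>|\<mu>|\<close>-null sets, so that \<open>\<integral>f d\<mu> = \<integral>f h d|\<mu>|\<close> does not depend on the choice.\<close>

definition polar_density :: "'a measure \<Rightarrow> ('a set \<Rightarrow> complex) \<Rightarrow> 'a \<Rightarrow> complex" where
  "polar_density B \<mu> = (SOME h. h \<in> borel_measurable B \<and> (\<forall>x\<in>space B. cmod (h x) = 1) \<and>
     (\<forall>E\<in>sets B. \<mu> E = (\<integral>x\<in>E. h x \<partial>total_variation B \<mu>)))"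

definition complex_integral ::
    "'a measure \<Rightarrow> ('a set \<Rightarrow> complex) \<Rightarrow> ('a \<Rightarrow> complex) \<Rightarrow> complex" where
  "complex_integral B \<mu> f = (\<integral>x. f x * polar_density B \<mu> x \<partial>total_variation B \<mu>)"

definition abs_cont_wrt ::
    "'a measure \<Rightarrow> ('a set \<Rightarrow> complex) \<Rightarrow> ('a set \<Rightarrow> complex) \<Rightarrow> bool" where
  "abs_cont_wrt B m \<mu> \<longleftrightarrow> (\<forall>E\<in>null_sets (total_variation B m). \<mu> E = 0)"

definition singular_wrt ::
    "'a measure \<Rightarrow> ('a set \<Rightarrow> complex) \<Rightarrow> ('a set \<Rightarrow> complex) \<Rightarrow> bool" where
  "singular_wrt B m \<mu> \<longleftrightarrow>
     (\<exists>A\<in>null_sets (total_variation B m). \<forall>E\<in>sets B. \<mu> E = \<mu> (E \<inter> A))"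

definition lebesgue_ac_part ::
    "'a measure \<Rightarrow> ('a set \<Rightarrow> complex) \<Rightarrow> ('a set \<Rightarrow> complex) \<Rightarrow> 'a set \<Rightarrow> complex" where
  "lebesgue_ac_part B m \<mu> = (THE \<mu>a. complex_measure B \<mu>a \<and> abs_cont_wrt B m \<mu>a \<and>
     (\<exists>\<mu>s. complex_measure B \<mu>s \<and> singular_wrt B m \<mu>s \<and> \<mu> = (\<lambda>E. \<mu>a E + \<mu>s E)))"

definition radon_nikodym_class ::
    "'a measure \<Rightarrow> ('a set \<Rightarrow> complex) \<Rightarrow> ('a set \<Rightarrow> complex) \<Rightarrow> ('a \<Rightarrow> complex) set" where
  "radon_nikodym_class B m \<nu> = (THE G. G \<in> vcarrier (L1_space (total_variation B m)) \<and>
     (\<forall>E\<in>sets B. \<nu> E = complex_integral B m (\<lambda>x. indicator E x * rep G x)))"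


section \<open>Regular Borel measures and the map \<open>\<phi>\<close>\<close>

definition borel_of :: "'a topology \<Rightarrow> 'a measure" where
  "borel_of X = sigma (topspace X) {U. openin X U}"

abbreviation var_measure :: "'a topology \<Rightarrow> ('a set \<Rightarrow> complex) \<Rightarrow> 'a measure" where
  "var_measure X \<mu> \<equiv> total_variation (borel_of X) \<mu>"

definition regular_complex_borel_measure :: "'a topology \<Rightarrow> ('a set \<Rightarrow> complex) \<Rightarrow> bool" where
  "regular_complex_borel_measure X \<mu> \<longleftrightarrow>
     complex_measure (borel_of X) \<mu> \<and>
     (\<forall>E\<in>sets (borel_of X).
        emeasure (var_measure X \<mu>) E =
          (INF U\<in>{U. openin X U \<and> E \<subseteq> U}. emeasure (var_measure X \<mu>) U) \<and>
        emeasure (var_measure X \<mu>) E =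
          (SUP K\<in>{K. compactin X K \<and> K \<subseteq> E}. emeasure (var_measure X \<mu>) K))"

text \<open>Functionals on \<open>C(X)\<close> are given on all functions that are continuous on \<open>topspace X\<close>;
  the values of such functions outside \<open>topspace X\<close> play no role.\<close>

definition canonical_map ::
    "'a topology \<Rightarrow> ('a set \<Rightarrow> complex) \<Rightarrow> ('a \<Rightarrow> complex) \<Rightarrow> ('a \<Rightarrow> complex) set" where
  "canonical_map X m f = ae_class (var_measure X m) f"

definition riesz_measure ::
    "'a topology \<Rightarrow> (('a \<Rightarrow> complex) \<Rightarrow> complex) \<Rightarrow> 'a set \<Rightarrow> complex" where
  "riesz_measure X \<psi> = (THE \<mu>. regular_complex_borel_measure X \<mu> \<and>
     (\<forall>f. continuous_map X euclidean f \<longrightarrow> \<psi> f = complex_integral (borel_of X) \<mu> f))"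

definition phi ::
    "'a topology \<Rightarrow> ('a set \<Rightarrow> complex) \<Rightarrow> (('a \<Rightarrow> complex) set \<Rightarrow> complex) \<Rightarrow> ('a \<Rightarrow> complex) set"
  where
  "phi X m l = radon_nikodym_class (borel_of X) m
     (lebesgue_ac_part (borel_of X) m (riesz_measure X (l \<circ> canonical_map X m)))"

abbreviation L1 :: "'a topology \<Rightarrow> ('a set \<Rightarrow> complex) \<Rightarrow> ('a \<Rightarrow> complex) set cspace" where
  "L1 X m \<equiv> L1_space (var_measure X m)"

abbreviation Linf_dual ::
    "'a topology \<Rightarrow> ('a set \<Rightarrow> complex) \<Rightarrow> (('a \<Rightarrow> complex) set \<Rightarrow> complex) cspace" where
  "Linf_dual X m \<equiv> dual (Linf_space (var_measure X m))"

abbreviation K_phi ::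
    "'a topology \<Rightarrow> ('a set \<Rightarrow> complex) \<Rightarrow> (('a \<Rightarrow> complex) set \<Rightarrow> complex) cspace" where
  "K_phi X m \<equiv> kernel_space (Linf_dual X m) (L1 X m) (phi X m)"

end

theory Submission
  imports Defs
begin

text \<open>
  The right inverse of \<open>\<phi>\<close> is \<open>s(G)(F) = \<integral> F G dm\<close>: the measure representing \<open>s(G) \<circ> i\<close> is \<open>G dm\<close>, which is
  regular because it is absolutely continuous with respect to the regular measure \<open>|m|\<close>, and its own
  absolutely continuous part, so \<open>\<phi> (s(G)) = G\<close>. Linearity of \<open>\<phi>\<close> is uniqueness in the Riesz and Lebesgue
  theorems.

  Both a complex measure and a functional on \<open>C(X)\<close> split into four positive pieces by the same
  supremum (over subsets, respectively minorants). For measures this yields a density with respect to a finite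
  positive measure \<open>R\<close>, hence \<open>|\<mu>| = |f| R\<close> if \<open>\<mu> = f R\<close>; for functionals it reduces the Riesz
  theorem to the positive case, where the measure is the outer measure of
  \<open>U \<mapsto> sup {L f | 0 \<le> f \<le> 1\<^sub>U}\<close>, and it bounds the total variation by \<open>4 \<parallel>\<lambda>\<parallel>\<close>, whence \<open>\<phi>\<close> is bounded.
\<close>

text \<open>\<open>phi\<close> is stacked on three definite descriptions (Riesz measure, absolutely
  continuous part, Radon-Nikodym class), and the integral on a choice of polar density. None of them
  yields anything before existence and uniqueness are known, so the classical theorems come first.
  \<open>phi_eqI\<close> then collapses the stack: to compute \<open>phi X m l\<close> it is enough
  to exhibit a regular measure that represents \<open>l\<close> on continuous functions, together
  with its decomposition. The obstacle for complex measures is that |\<mu>| is a supremum over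
  partitions whose additivity is not visible, and that variations of sums are not sums of
  variations. Densities over a freely chosen finite \<open>R\<close> avoid this: two measures share
  a dominating \<open>R\<close>, and linearity, the triangle inequality and uniqueness become
  pointwise or a.e. statements about functions. The 4 is one unit of norm for each of the positive
  and negative parts of the real and imaginary parts; the splitting asks only for boundedness, so no
  sharper constant is sought.\<close>

section \<open>Real Radon-Nikodym derivatives and sums of finite measures\<close>

lemma finite_Radon_Nikodym_real:
  fixes M N :: "'a measure"
  assumes "finite_measure M" "finite_measure N" "absolutely_continuous M N" "sets N = sets M"
  obtains k :: "'a \<Rightarrow> real" where "k \<in> borel_measurable M" "\<And>x. 0 \<le> k x"
    "N = density M (\<lambda>x. ennreal (k x))" "integrable M k"
proof -
  interpret M: finite_measure M by fact
  interpret N: finite_measure N by fact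
  obtain f where f [measurable]: "f \<in> borel_measurable M" and N: "density M f = N"
    using M.Radon_Nikodym[OF assms(3,4)] by blast
  have "(\<integral>\<^sup>+x. f x \<partial>M) = emeasure N (space M)"
    unfolding N[symmetric] by (subst emeasure_density) (auto intro!: nn_integral_cong)
  then have "(\<integral>\<^sup>+x. f x \<partial>M) \<noteq> \<infinity>"
    using N.emeasure_finite by simp
  then have fin: "AE x in M. f x \<noteq> \<infinity>"
    by (intro nn_integral_PInf_AE) auto
  \<comment> \<open>A derivative of a finite measure is finite a.e., so \<open>enn2real\<close>
    alters it on a null set only. A real nonnegative \<open>k\<close> can later be multiplied with
    complex densities.\<close>
  have N': "N = density M (\<lambda>x. ennreal (enn2real (f x)))"
    unfolding N[symmetric] using fin
    by (intro density_cong) (auto simp: top.not_eq_extremum less_top)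
  have "integrable M (\<lambda>x. enn2real (f x))"
  proof (rule integrableI_nonneg)
    have "(\<integral>\<^sup>+x. ennreal (enn2real (f x)) \<partial>M) = (\<integral>\<^sup>+x. f x \<partial>M)"
      using fin by (intro nn_integral_cong_AE) (auto simp: less_top)
    also have "\<dots> < \<infinity>"
      using \<open>(\<integral>\<^sup>+x. f x \<partial>M) \<noteq> \<infinity>\<close> by (simp add: less_top)
    finally show "(\<integral>\<^sup>+x. ennreal (enn2real (f x)) \<partial>M) < \<infinity>" .
  qed auto
  then show ?thesis
    using that[of "\<lambda>x. enn2real (f x)"] N' by auto
qed

text \<open>Serves as a common dominating measure for two given ones.\<close>

definition add_measure :: "'a measure \<Rightarrow> 'a measure \<Rightarrow> 'a measure" where
  "add_measure M N = measure_of (space M) (sets M) (\<lambda>E. emeasure M E + emeasure N E)"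

lemma space_add_measure [simp]: "space (add_measure M N) = space M"
  and sets_add_measure [simp]: "sets (add_measure M N) = sets M"
  by (simp_all add: add_measure_def)

lemma emeasure_add_measure:
  assumes "sets N = sets M" "E \<in> sets M"
  shows "emeasure (add_measure M N) E = emeasure M E + emeasure N E"
proof (rule emeasure_measure_of[OF add_measure_def])
  show "countably_additive (sets (add_measure M N)) (\<lambda>E. emeasure M E + emeasure N E)"
    using assms(1) by (auto simp: countably_additive_def suminf_add[symmetric] suminf_emeasure)
qed (use assms in \<open>auto simp: positive_def sets.space_closed dest: sets.sets_into_space\<close>)

lemma finite_measure_add_measure:
  assumes "sets N = sets M" "finite_measure M" "finite_measure N"
  shows "finite_measure (add_measure M N)"
proof
  interpret M: finite_measure M by fact
  interpret N: finite_measure N by fact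
  show "emeasure (add_measure M N) (space (add_measure M N)) \<noteq> \<infinity>"
    by (simp add: emeasure_add_measure assms(1))
qed

section \<open>Complex measures\<close>

lemma complex_measure_outside: "complex_measure B \<mu> \<Longrightarrow> E \<notin> sets B \<Longrightarrow> \<mu> E = 0"
  by (simp add: complex_measure_def)

lemma complex_measure_sums:
  "complex_measure B \<mu> \<Longrightarrow> range A \<subseteq> sets B \<Longrightarrow> disjoint_family (A::nat \<Rightarrow> _) \<Longrightarrow>
    (\<lambda>i. \<mu> (A i)) sums \<mu> (\<Union>i. A i)"
  by (simp add: complex_measure_def)

lemma complex_measure_empty:
  assumes "complex_measure B \<mu>" shows "\<mu> {} = 0"
proof -
  have "(\<lambda>i::nat. \<mu> {}) sums \<mu> (\<Union>i::nat. {})"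
    by (rule complex_measure_sums[OF assms]) (auto simp: disjoint_family_on_def)
  then have "summable (\<lambda>i::nat. \<mu> {})" by (rule sums_summable)
  then show ?thesis by (simp add: summable_const_iff)
qed

lemma complex_measure_Un:
  assumes "complex_measure B \<mu>" "E \<in> sets B" "F \<in> sets B" "E \<inter> F = {}"
  shows "\<mu> (E \<union> F) = \<mu> E + \<mu> F"
proof -
  have "(\<lambda>i. \<mu> (binaryset E F i)) sums \<mu> (\<Union>i. binaryset E F i)"
    using assms by (intro complex_measure_sums)
      (auto simp: range_binaryset_eq disjoint_family_on_def binaryset_def)
  moreover have "(\<lambda>i. \<mu> (binaryset E F i)) sums (\<mu> E + \<mu> F)"
    using complex_measure_empty[OF assms(1)] by (rule binaryset_sums)
  ultimately show ?thesis
    by (simp add: sums_unique2 UN_binaryset_eq)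
qed

lemma complex_measure_Diff:
  assumes "complex_measure B \<mu>" "E \<in> sets B" "F \<in> sets B" "F \<subseteq> E"
  shows "\<mu> (E - F) = \<mu> E - \<mu> F"
proof -
  have "\<mu> (F \<union> (E - F)) = \<mu> F + \<mu> (E - F)"
    using assms by (intro complex_measure_Un) auto
  then show ?thesis using assms(4) by (simp add: Un_absorb1)
qed

lemma complex_measure_lincomb:
  assumes "complex_measure B \<mu>" "complex_measure B \<nu>"
  shows "complex_measure B (\<lambda>E. \<mu> E + c * \<nu> E)"
  using assms unfolding complex_measure_def by (auto intro!: sums_add sums_mult)

lemma complex_measure_cmult:
  assumes "complex_measure B \<mu>" shows "complex_measure B (\<lambda>E. c * \<mu> E)"
  using assms unfolding complex_measure_def by (auto intro!: sums_mult)

text \<open>If \<open>\<mu>\<close> were unbounded on the subsets of \<open>E\<close>, one could cut off a piece of modulus at least 1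
  so that the rest has the same defect; the pieces would violate countable additivity.\<close>

lemma complex_measure_bounded:
  assumes \<mu>: "complex_measure B \<mu>"
  obtains C where "\<And>E. cmod (\<mu> E) \<le> C"
proof -
  define bad where "bad E \<longleftrightarrow> E \<in> sets B \<and> (\<forall>C. \<exists>F\<in>sets B. F \<subseteq> E \<and> cmod (\<mu> F) > C)" for E
  have cut: "\<exists>E'. bad E' \<and> E' \<subseteq> E \<and> cmod (\<mu> (E - E')) \<ge> 1" if "bad E" for E
  proof -
    have E: "E \<in> sets B" using that by (simp add: bad_def)
    \<comment> \<open>The margin \<open>cmod (\<mu> E)\<close> makes \<mu> of modulus at least 1 on
      both \<open>F\<close> and \<open>E - F\<close>, so either of them may be kept and the other
      one cut off.\<close>
    obtain F where F: "F \<in> sets B" "F \<subseteq> E" "cmod (\<mu> F) > 1 + cmod (\<mu> E)"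
      using \<open>bad E\<close> unfolding bad_def by blast
    have EF: "\<mu> (E - F) = \<mu> E - \<mu> F" using complex_measure_Diff \<mu> E F by blast
    have "cmod (\<mu> F) \<le> cmod (\<mu> E) + cmod (\<mu> E - \<mu> F)"
      using norm_triangle_sub[of "\<mu> F" "\<mu> E"] by (simp add: norm_minus_commute)
    then have large: "cmod (\<mu> (E - F)) \<ge> 1" unfolding EF using F(3) by linarith
    have "bad F \<or> bad (E - F)"
    proof (rule ccontr)
      assume "\<not> ?thesis"
      then obtain C D where C: "\<And>G. G \<in> sets B \<Longrightarrow> G \<subseteq> F \<Longrightarrow> cmod (\<mu> G) \<le> C"
        and D: "\<And>G. G \<in> sets B \<Longrightarrow> G \<subseteq> E - F \<Longrightarrow> cmod (\<mu> G) \<le> D"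
        unfolding bad_def using E F by (metis not_le sets.Diff)
      obtain G where G: "G \<in> sets B" "G \<subseteq> E" "cmod (\<mu> G) > C + D"
        using \<open>bad E\<close> unfolding bad_def by blast
      have "\<mu> ((G \<inter> F) \<union> (G - F)) = \<mu> (G \<inter> F) + \<mu> (G - F)"
        using \<mu> G F by (intro complex_measure_Un) auto
      moreover have "(G \<inter> F) \<union> (G - F) = G" by auto
      ultimately have "cmod (\<mu> G) \<le> cmod (\<mu> (G \<inter> F)) + cmod (\<mu> (G - F))"
        by (metis norm_triangle_ineq)
      also have "\<dots> \<le> C + D"
        using G F by (intro add_mono C D) auto
      finally show False using G(3) by simp
    qed
    then show ?thesis
    proof
      assume "bad F" then show ?thesis using F large by blast
    next
      assume "bad (E - F)"
      moreover have "E - (E - F) = F" using F by auto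
      moreover have "cmod (\<mu> F) \<ge> 1" using F(3) norm_ge_zero[of "\<mu> E"] by linarith
      ultimately show ?thesis by (intro exI[of _ "E - F"]) auto
    qed
  qed
  have "\<not> bad (space B)"
  proof
    assume "bad (space B)"
    then have "\<exists>f. \<forall>n::nat. bad (f n) \<and> (f (Suc n) \<subseteq> f n \<and> cmod (\<mu> (f n - f (Suc n))) \<ge> 1)"
      using cut by (intro dependent_nat_choice) auto
    then obtain f where f: "\<And>n::nat. bad (f n)" "\<And>n. f (Suc n) \<subseteq> f n"
        "\<And>n. cmod (\<mu> (f n - f (Suc n))) \<ge> 1" by blast
    define A where "A n = f n - f (Suc n)" for n
    have anti: "f j \<subseteq> f i" if "i \<le> j" for i j
      using f(2) that by (rule lift_Suc_antimono_le)
    have "A i \<inter> A j = {}" if "i < j" for i j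
      using anti[of "Suc i" j] that by (auto simp: A_def)
    then have "disjoint_family A"
      unfolding disjoint_family_on_def by (metis Int_commute linorder_neqE_nat)
    moreover have "range A \<subseteq> sets B"
      using f(1) by (auto simp: A_def bad_def)
    ultimately have "summable (\<lambda>i. \<mu> (A i))"
      using complex_measure_sums[OF \<mu>] sums_summable by blast
    then have "(\<lambda>i. \<mu> (A i)) \<longlonglongrightarrow> 0" by (rule summable_LIMSEQ_zero)
    then have "(\<lambda>i. cmod (\<mu> (A i))) \<longlonglongrightarrow> 0" using tendsto_norm_zero by blast
    then have "1 \<le> (0::real)"
      by (rule LIMSEQ_le_const) (use f(3) in \<open>auto simp: A_def\<close>)
    then show False by simp
  qed
  then obtain C where C: "\<And>F. F \<in> sets B \<Longrightarrow> F \<subseteq> space B \<Longrightarrow> cmod (\<mu> F) \<le> C"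
    unfolding bad_def by (metis not_le sets.top)
  have "cmod (\<mu> E) \<le> max C 0" for E
    using C[of E] complex_measure_outside[OF \<mu>, of E] sets.sets_into_space[of E B]
    by (cases "E \<in> sets B") auto
  then show ?thesis by (rule that)
qed

lemma complex_measure_of_positive:
  assumes "finite_measure \<nu>" "sets \<nu> = sets B"
  shows "complex_measure B (\<lambda>E. of_real (measure \<nu> E))"
proof -
  interpret finite_measure \<nu> by fact
  show ?thesis unfolding complex_measure_def
    using assms(2) by (auto intro!: sums_of_real finite_measure_UNION simp: measure_notin_sets)
qed

section \<open>Positive variation and Jordan decomposition\<close>

text \<open>The positive variation of the real part of \<mu>. With \<open>Re\<close> built in, the
  same construction applied to \<open>- \<mu>\<close>, \<open>- \<i> * \<mu>\<close> and
  \<open>\<i> * \<mu>\<close> supplies the other three pieces.\<close>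

definition pos_part :: "'a measure \<Rightarrow> ('a set \<Rightarrow> complex) \<Rightarrow> 'a measure" where
  "pos_part B \<mu> = measure_of (space B) (sets B)
     (\<lambda>E. SUP F\<in>{F\<in>sets B. F \<subseteq> E}. ennreal (Re (\<mu> F)))"

lemma space_pos_part [simp]: "space (pos_part B \<mu>) = space B"
  and sets_pos_part [simp]: "sets (pos_part B \<mu>) = sets B"
  by (simp_all add: pos_part_def)

text \<open>Joining subsets of disjoint sets makes the supremum superadditive, hence countably
  superadditive. Conversely a subset \<open>F\<close> of the union is sliced along the
  \<open>A i\<close>, and each slice competes in its own supremum.\<close>

lemma emeasure_pos_part:
  assumes \<mu>: "complex_measure B \<mu>" and "E \<in> sets B"
  shows "emeasure (pos_part B \<mu>) E = (SUP F\<in>{F\<in>sets B. F \<subseteq> E}. ennreal (Re (\<mu> F)))"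
    (is "_ = ?p E")
proof (rule emeasure_measure_of[OF pos_part_def])
  have sup: "?p E + ?p F \<le> ?p (E \<union> F)" if "E \<in> sets B" "F \<in> sets B" "E \<inter> F = {}" for E F
  proof -
    have ne: "{G\<in>sets B. G \<subseteq> D} \<noteq> {}" for D by blast
    have "?p E + ?p F = (SUP G\<in>{G\<in>sets B. G \<subseteq> E}. ennreal (Re (\<mu> G)) + ?p F)"
      by (rule ennreal_SUP_add_left[symmetric, OF ne])
    also have "\<dots> = (SUP G\<in>{G\<in>sets B. G \<subseteq> E}. SUP H\<in>{G\<in>sets B. G \<subseteq> F}.
        ennreal (Re (\<mu> G)) + ennreal (Re (\<mu> H)))"
      by (intro SUP_cong refl ennreal_SUP_add_right ne)
    also have "\<dots> \<le> ?p (E \<union> F)"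
    proof (intro SUP_least)
      fix G H assume GH: "G \<in> {G\<in>sets B. G \<subseteq> E}" "H \<in> {G\<in>sets B. G \<subseteq> F}"
      have e: "\<mu> (G \<union> H) = \<mu> G + \<mu> H"
        using GH that by (intro complex_measure_Un[OF \<mu>]) auto
      \<comment> \<open>\<open>ennreal\<close> sends negative values to 0, so it is additive on the
        pair only if both values are nonnegative. Otherwise the piece with negative value is dropped
        and the other one competes alone.\<close>
      consider "Re (\<mu> G) \<le> 0" | "Re (\<mu> H) \<le> 0" | "Re (\<mu> G) \<ge> 0" "Re (\<mu> H) \<ge> 0" by linarith
      then show "ennreal (Re (\<mu> G)) + ennreal (Re (\<mu> H)) \<le> ?p (E \<union> F)"
      proof cases
        case 1
        then show ?thesis using GH by (auto simp: ennreal_neg intro!: SUP_upper2[of H])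
      next
        case 2
        then show ?thesis using GH by (auto simp: ennreal_neg intro!: SUP_upper2[of G])
      next
        case 3
        then have "ennreal (Re (\<mu> G)) + ennreal (Re (\<mu> H)) = ennreal (Re (\<mu> (G \<union> H)))"
          by (simp add: e)
        also have "\<dots> \<le> ?p (E \<union> F)"
          using GH by (intro SUP_upper) auto
        finally show ?thesis .
      qed
    qed
    finally show ?thesis .
  qed
  show "positive (sets (pos_part B \<mu>)) ?p"
  proof -
    have "{F\<in>sets B. F \<subseteq> {}} = {{}}" by auto
    then show ?thesis
      by (simp add: positive_def complex_measure_empty[OF \<mu>])
  qed
  show "countably_additive (sets (pos_part B \<mu>)) ?p"
    unfolding countably_additive_def
  proof (intro allI impI)
    fix A :: "nat \<Rightarrow> 'a set"
    assume A: "range A \<subseteq> sets (pos_part B \<mu>)" "disjoint_family A" "\<Union> (range A) \<in> sets (pos_part B \<mu>)"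
    have A': "A i \<in> sets B" for i using A by auto
    show "(\<Sum>i. ?p (A i)) = ?p (\<Union>i. A i)"
    proof (rule antisym)
      have mono: "?p E \<le> ?p F" if "E \<subseteq> F" for E F
        using that by (intro SUP_subset_mono) auto
      have "(\<Sum>i<n. ?p (A i)) \<le> ?p (\<Union>i<n. A i)" for n
      proof (induction n)
        case (Suc n)
        have "(\<Sum>i<Suc n. ?p (A i)) \<le> ?p (\<Union>i<n. A i) + ?p (A n)"
          using Suc by (simp add: add_mono)
        also have "\<dots> \<le> ?p ((\<Union>i<n. A i) \<union> A n)"
        proof (rule sup)
          show "(\<Union>i<n. A i) \<inter> A n = {}"
            using disjoint_family_onD[OF A(2)] by (metis UNIV_I disjoint_iff UN_E lessThan_iff less_irrefl)
        qed (use A' in auto)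
        also have "(\<Union>i<n. A i) \<union> A n = (\<Union>i<Suc n. A i)"
          by (auto simp: less_Suc_eq)
        finally show ?case .
      qed auto
      then have "(\<Sum>i<n. ?p (A i)) \<le> ?p (\<Union>i. A i)" for n
        by (rule order_trans) (auto intro!: mono)
      then show "(\<Sum>i. ?p (A i)) \<le> ?p (\<Union>i. A i)"
        by (intro suminf_le_const) auto
    next
      show "?p (\<Union>i. A i) \<le> (\<Sum>i. ?p (A i))"
      proof (intro SUP_least)
        fix F assume F: "F \<in> {F\<in>sets B. F \<subseteq> (\<Union>i. A i)}"
        have "(\<lambda>i. \<mu> (F \<inter> A i)) sums \<mu> (\<Union>i. F \<inter> A i)"
          using F A A' by (intro complex_measure_sums[OF \<mu>]) (auto simp: disjoint_family_on_def)
        moreover have "(\<Union>i. F \<inter> A i) = F" using F by auto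
        ultimately have "(\<lambda>i. Re (\<mu> (F \<inter> A i))) sums Re (\<mu> F)" by (simp add: sums_Re)
        then have lim: "(\<lambda>n. ennreal (\<Sum>i<n. Re (\<mu> (F \<inter> A i)))) \<longlonglongrightarrow> ennreal (Re (\<mu> F))"
          by (auto simp: sums_def)
        have le: "ennreal (\<Sum>i<n. Re (\<mu> (F \<inter> A i))) \<le> (\<Sum>i. ?p (A i))" for n
        proof -
          \<comment> \<open>Negative terms are raised to 0 before \<open>ennreal\<close> is moved
            inside the sum, where it would truncate them anyway.\<close>
          have "ennreal (\<Sum>i<n. Re (\<mu> (F \<inter> A i))) \<le> ennreal (\<Sum>i<n. max 0 (Re (\<mu> (F \<inter> A i))))"
            by (intro ennreal_leI sum_mono) auto
          also have "\<dots> = (\<Sum>i<n. ennreal (Re (\<mu> (F \<inter> A i))))"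
            by (subst sum_ennreal[symmetric]) (auto simp: ennreal_max_0)
          also have "\<dots> \<le> (\<Sum>i<n. ?p (A i))"
            using F A' by (intro sum_mono SUP_upper) auto
          also have "\<dots> \<le> (\<Sum>i. ?p (A i))"
            by (intro sum_le_suminf) auto
          finally show ?thesis .
        qed
        show "ennreal (Re (\<mu> F)) \<le> (\<Sum>i. ?p (A i))"
          by (rule LIMSEQ_le_const2[OF lim]) (use le in auto)
      qed
    qed
  qed
qed (use assms sets.sets_into_space in auto)

lemma finite_measure_pos_part:
  assumes \<mu>: "complex_measure B \<mu>"
  shows "finite_measure (pos_part B \<mu>)"
proof
  obtain C where C: "\<And>E. cmod (\<mu> E) \<le> C" using complex_measure_bounded[OF \<mu>] by metis
  have "emeasure (pos_part B \<mu>) (space B) \<le> ennreal C"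
  proof (subst emeasure_pos_part[OF \<mu> sets.top], rule SUP_least)
    show "ennreal (Re (\<mu> F)) \<le> ennreal C" for F
      using C[of F] complex_Re_le_cmod[of "\<mu> F"] by (intro ennreal_leI) linarith
  qed
  then show "emeasure (pos_part B \<mu>) (space (pos_part B \<mu>)) \<noteq> \<infinity>"
    by (auto simp: top_unique)
qed

text \<open>Complementation \<open>F\<close> to \<open>E - F\<close> permutes the measurable subsets
  of \<open>E\<close> and sends \<open>Re (\<mu> F)\<close> to
  \<open>Re (\<mu> E) - Re (\<mu> F)\<close>. Thus the supremum of \<open>Re \<mu>\<close> is
  \<open>Re (\<mu> E)\<close> plus the supremum of \<open>- Re \<mu>\<close>.\<close>

lemma Jordan_decomposition:
  assumes \<mu>: "complex_measure B \<mu>" and E: "E \<in> sets B"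
  shows "Re (\<mu> E) = measure (pos_part B \<mu>) E - measure (pos_part B (\<lambda>E. - \<mu> E)) E"
proof -
  have \<mu>': "complex_measure B (\<lambda>E. - \<mu> E)"
    using complex_measure_cmult[OF \<mu>, of "-1"] by simp
  interpret P: finite_measure "pos_part B \<mu>" by (rule finite_measure_pos_part) fact
  interpret N: finite_measure "pos_part B (\<lambda>E. - \<mu> E)" by (rule finite_measure_pos_part) fact
  have lower: "Re (\<nu> F) \<le> measure (pos_part B \<nu>) E"
    if "complex_measure B \<nu>" "F \<in> sets B" "F \<subseteq> E" for \<nu> F
  proof -
    interpret P: finite_measure "pos_part B \<nu>" by (rule finite_measure_pos_part) fact
    have "ennreal (Re (\<nu> F)) \<le> emeasure (pos_part B \<nu>) E"
      using that by (subst emeasure_pos_part[OF _ E]) (auto intro!: SUP_upper)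
    then show ?thesis by (simp add: P.emeasure_eq_measure)
  qed
  have upper: "measure (pos_part B \<nu>) E \<le> c"
    if "complex_measure B \<nu>" "\<And>F. F \<in> sets B \<Longrightarrow> F \<subseteq> E \<Longrightarrow> Re (\<nu> F) \<le> c" for \<nu> c
  proof -
    interpret P: finite_measure "pos_part B \<nu>" by (rule finite_measure_pos_part) fact
    have "0 \<le> c" using that(2)[of "{}"] complex_measure_empty[OF that(1)] by simp
    have "emeasure (pos_part B \<nu>) E \<le> ennreal c"
      using that by (subst emeasure_pos_part[OF _ E]) (auto intro!: SUP_least ennreal_leI)
    then show ?thesis using \<open>0 \<le> c\<close> by (simp add: P.emeasure_eq_measure)
  qed
  have d: "\<mu> F = \<mu> E - \<mu> (E - F)" if "F \<in> sets B" "F \<subseteq> E" for F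
    using complex_measure_Diff[OF \<mu> E that] by simp
  have "measure (pos_part B \<mu>) E \<le> Re (\<mu> E) + measure (pos_part B (\<lambda>E. - \<mu> E)) E"
  proof (rule upper[OF \<mu>])
    fix F assume F: "F \<in> sets B" "F \<subseteq> E"
    have "Re (- \<mu> (E - F)) \<le> measure (pos_part B (\<lambda>E. - \<mu> E)) E"
      using F E by (intro lower[OF \<mu>']) auto
    then show "Re (\<mu> F) \<le> Re (\<mu> E) + measure (pos_part B (\<lambda>E. - \<mu> E)) E"
      using d[OF F] by simp
  qed
  moreover have "measure (pos_part B (\<lambda>E. - \<mu> E)) E \<le> measure (pos_part B \<mu>) E - Re (\<mu> E)"
  proof (rule upper[OF \<mu>'])
    fix F assume F: "F \<in> sets B" "F \<subseteq> E"
    have "Re (\<mu> (E - F)) \<le> measure (pos_part B \<mu>) E"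
      using F E by (intro lower[OF \<mu>]) auto
    then show "Re (- \<mu> F) \<le> measure (pos_part B \<mu>) E - Re (\<mu> E)"
      using d[OF F] by simp
  qed
  ultimately show ?thesis by linarith
qed

subsection \<open>Densities with respect to a dominating finite measure\<close>

text \<open>\<open>R\<close> is a parameter rather than |\<mu>|, so that several measures can be
  moved to one \<open>R\<close>. Only the values on \<open>sets B\<close> are prescribed; vanishing
  elsewhere is the separate normalisation in \<open>complex_measure\<close>.\<close>

definition has_density ::
    "'a measure \<Rightarrow> ('a set \<Rightarrow> complex) \<Rightarrow> 'a measure \<Rightarrow> ('a \<Rightarrow> complex) \<Rightarrow> bool" where
  "has_density B \<mu> R f \<longleftrightarrow> finite_measure R \<and> sets R = sets B \<and> integrable R f \<and>
     (\<forall>E\<in>sets B. \<mu> E = (\<integral>x. indicator E x * f x \<partial>R))"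

lemma indicator_times_eq_scaleR: "indicator E x * (z::complex) = indicator E x *\<^sub>R z"
  by (simp split: split_indicator)

lemma integrable_indicator_times:
  fixes f :: "'a \<Rightarrow> complex"
  assumes "integrable R f" "E \<in> sets R"
  shows "integrable R (\<lambda>x. indicator E x * f x)"
  using integrable_mult_indicator[OF assms(2,1)] by (simp add: indicator_times_eq_scaleR)

text \<open>Countable additivity is dominated convergence along the finite unions, with |f| as
  majorant.\<close>

lemma complex_measure_if_has_density:
  assumes "has_density B \<mu> R f" "\<And>E. E \<notin> sets B \<Longrightarrow> \<mu> E = 0"
  shows "complex_measure B \<mu>"
  unfolding complex_measure_def
proof (intro conjI allI impI)
  fix A :: "nat \<Rightarrow> 'a set" assume A: "range A \<subseteq> sets B" "disjoint_family A"
  have R: "finite_measure R" "sets R = sets B" and f: "integrable R f"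
    and \<mu>: "\<And>E. E \<in> sets B \<Longrightarrow> \<mu> E = (\<integral>x. indicator E x * f x \<partial>R)"
    using assms(1) by (auto simp: has_density_def)
  have A': "A i \<in> sets B" "A i \<in> sets R" "(\<Union>i. A i) \<in> sets B" for i using A R by auto
  have "(\<lambda>n. \<integral>x. indicator (\<Union>i<n. A i) x * f x \<partial>R) \<longlonglongrightarrow> (\<integral>x. indicator (\<Union>i. A i) x * f x \<partial>R)"
  proof (rule integral_dominated_convergence[where w="\<lambda>x. cmod (f x)"])
    show "AE x in R. (\<lambda>n. indicator (\<Union>i<n. A i) x * f x) \<longlonglongrightarrow> indicator (\<Union>i. A i) x * f x"
      by (auto intro!: tendsto_mult LIMSEQ_indicator_UN)
    show "(\<lambda>x. indicator (\<Union>i. A i) x * f x) \<in> borel_measurable R"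
      using integrable_indicator_times[OF f] A' R(2) by (metis borel_measurable_integrable)
    show "(\<lambda>x. indicator (\<Union>i<n. A i) x * f x) \<in> borel_measurable R" for n
      using integrable_indicator_times[OF f, of "\<Union>i<n. A i"] A'(2)
      by (auto intro: borel_measurable_integrable)
  qed (use f in \<open>auto split: split_indicator\<close>)
  moreover have "(\<integral>x. indicator (\<Union>i<n. A i) x * f x \<partial>R) = (\<Sum>i<n. \<mu> (A i))" for n
  proof -
    have "indicator (\<Union>i<n. A i) x * f x = (\<Sum>i<n. indicator (A i) x * f x)" for x
      using A(2) by (subst indicator_UN_disjoint)
        (auto simp: sum_distrib_right disjoint_family_on_def)
    then have "(\<integral>x. indicator (\<Union>i<n. A i) x * f x \<partial>R) = (\<integral>x. (\<Sum>i<n. indicator (A i) x * f x) \<partial>R)"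
      by presburger
    also have "\<dots> = (\<Sum>i<n. \<integral>x. indicator (A i) x * f x \<partial>R)"
      by (intro Bochner_Integration.integral_sum integrable_indicator_times f A')
    finally show ?thesis using \<mu>[OF A'(1)] by simp
  qed
  ultimately show "(\<lambda>i. \<mu> (A i)) sums \<mu> (\<Union>i. A i)"
    by (simp add: sums_def \<mu>[OF A'(3)])
qed (use assms in auto)

lemma has_density_positive:
  assumes "finite_measure \<nu>" "sets \<nu> = sets B"
  shows "has_density B (\<lambda>E. of_real (measure \<nu> E)) \<nu> (\<lambda>x. 1)"
proof -
  interpret finite_measure \<nu> by fact
  have "(\<integral>x. indicator E x * 1 \<partial>\<nu>) = complex_of_real (measure \<nu> E)" if "E \<in> sets B" for E
  proof -
    have "(\<integral>x. indicator E x * 1 \<partial>\<nu>) = (\<integral>x. indicator E x *\<^sub>R (1::complex) \<partial>\<nu>)"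
      by (simp only: indicator_times_eq_scaleR)
    also have "\<dots> = measure \<nu> E *\<^sub>R 1"
      using that assms(2)
      by (intro has_bochner_integral_integral_eq has_bochner_integral_indicator)
        (auto simp: less_top[symmetric])
    finally show ?thesis by (simp add: scaleR_conv_of_real)
  qed
  then show ?thesis
    using assms by (auto simp: has_density_def)
qed

text \<open>The chain rule for densities: \<open>R = k T\<close> and \<open>\<mu> = f R\<close> give
  \<open>\<mu> = (k f) T\<close>.\<close>

lemma has_density_change:
  assumes f: "has_density B \<mu> R f" and R: "R = density T (\<lambda>x. ennreal (k x))"
    and T: "finite_measure T" "sets T = sets B"
    and k: "k \<in> borel_measurable T" "\<And>x. 0 \<le> k x"
  shows "has_density B \<mu> T (\<lambda>x. k x *\<^sub>R f x)"
proof -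
  have [measurable]: "f \<in> borel_measurable T"
    using f by (auto simp: has_density_def R dest!: borel_measurable_integrable)
  note k(1) [measurable]
  have "integrable T (\<lambda>x. k x *\<^sub>R f x)"
    using f k by (auto simp: has_density_def R integrable_density)
  moreover have "\<mu> E = (\<integral>x. indicator E x * k x *\<^sub>R f x \<partial>T)" if "E \<in> sets B" for E
  proof -
    have [measurable]: "E \<in> sets T" using that T by simp
    have "\<mu> E = (\<integral>x. indicator E x * f x \<partial>R)" using that f by (auto simp: has_density_def)
    also have "\<dots> = (\<integral>x. k x *\<^sub>R (indicator E x * f x) \<partial>T)"
      unfolding R by (rule integral_density) (use k in auto)
    finally show ?thesis by simp
  qed
  ultimately show ?thesis using T by (auto simp: has_density_def)
qed

text \<open>Both \<open>R\<close> and \<open>S\<close> are absolutely continuous with respect to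
  their sum. Statements about two complex measures thereby become statements about two functions
  over one measure.\<close>

lemma has_density_common:
  assumes "has_density B \<mu> R f" "has_density B \<nu> S g"
  obtains T F G where "has_density B \<mu> T F" "has_density B \<nu> T G"
proof -
  have fin: "finite_measure R" "finite_measure S" and s: "sets R = sets B" "sets S = sets B"
    using assms by (auto simp: has_density_def)
  define T where "T = add_measure R S"
  have T: "finite_measure T" "sets T = sets B"
    using fin s by (auto simp: T_def intro!: finite_measure_add_measure)
  have e: "emeasure T E = emeasure R E + emeasure S E" if "E \<in> sets B" for E
    using s that unfolding T_def by (subst emeasure_add_measure) auto
  have "absolutely_continuous T R" "absolutely_continuous T S"
    using s T e by (auto simp: absolutely_continuous_def null_sets_def)
  then obtain k l where "k \<in> borel_measurable T" "\<And>x. 0 \<le> k x" "R = density T (\<lambda>x. ennreal (k x))"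
      "l \<in> borel_measurable T" "\<And>x. 0 \<le> l x" "S = density T (\<lambda>x. ennreal (l x))"
    using finite_Radon_Nikodym_real[of T R] finite_Radon_Nikodym_real[of T S] fin s T by metis
  then show ?thesis
    using has_density_change assms T that by blast
qed

lemma has_density_lincomb:
  assumes "has_density B \<mu> T F" "has_density B \<nu> T G"
  shows "has_density B (\<lambda>E. \<mu> E + c * \<nu> E) T (\<lambda>x. F x + c * G x)"
proof -
  have "(\<integral>x. indicator E x * F x \<partial>T) + c * (\<integral>x. indicator E x * G x \<partial>T) =
      (\<integral>x. indicator E x * (F x + c * G x) \<partial>T)" if "E \<in> sets B" for E
  proof -
    have i: "integrable T (\<lambda>x. indicator E x * F x)" "integrable T (\<lambda>x. indicator E x * G x)"
      using assms that by (auto intro!: integrable_indicator_times simp: has_density_def)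
    have "(\<integral>x. indicator E x * F x \<partial>T) + c * (\<integral>x. indicator E x * G x \<partial>T) =
       (\<integral>x. indicator E x * F x + c * (indicator E x * G x) \<partial>T)"
      using i by simp
    then show ?thesis by (simp add: algebra_simps)
  qed
  then show ?thesis using assms by (auto simp: has_density_def)
qed

lemma complex_measure_has_density:
  assumes \<mu>: "complex_measure B \<mu>"
  obtains R f where "has_density B \<mu> R f"
proof -
  have real_case: "\<exists>R f. has_density B (\<lambda>E. of_real (Re (\<nu> E))) R f" if \<nu>: "complex_measure B \<nu>" for \<nu>
  proof -
    have \<nu>': "complex_measure B (\<lambda>E. - \<nu> E)"
      using complex_measure_cmult[OF \<nu>, of "-1"] by simp
    obtain T F G where "has_density B (\<lambda>E. of_real (measure (pos_part B \<nu>) E)) T F"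
      "has_density B (\<lambda>E. of_real (measure (pos_part B (\<lambda>E. - \<nu> E)) E)) T G"
      using has_density_common[OF has_density_positive[OF finite_measure_pos_part[OF \<nu>] sets_pos_part]
          has_density_positive[OF finite_measure_pos_part[OF \<nu>'] sets_pos_part]] by blast
    then have "has_density B (\<lambda>E. of_real (measure (pos_part B \<nu>) E)
        + (-1) * of_real (measure (pos_part B (\<lambda>E. - \<nu> E)) E)) T (\<lambda>x. F x + (-1) * G x)"
      by (rule has_density_lincomb)
    then show ?thesis
      by (auto simp: has_density_def Jordan_decomposition[OF \<nu>] intro!: exI[of _ T])
  qed
  \<comment> \<open>Since \<open>Re (- \<i> * z) = Im z\<close>, the real case applied to this
    measure treats the imaginary part of \<mu>.\<close>
  have \<mu>i: "complex_measure B (\<lambda>E. - \<i> * \<mu> E)"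
    using complex_measure_cmult[OF \<mu>] .
  obtain R1 f1 where d1: "has_density B (\<lambda>E. of_real (Re (\<mu> E))) R1 f1"
    using real_case[OF \<mu>] by blast
  obtain R2 f2 where d2: "has_density B (\<lambda>E. of_real (Re (- \<i> * \<mu> E))) R2 f2"
    using real_case[OF \<mu>i] by blast
  obtain T F G where "has_density B (\<lambda>E. of_real (Re (\<mu> E))) T F"
      "has_density B (\<lambda>E. of_real (Re (- \<i> * \<mu> E))) T G"
    using has_density_common[OF d1 d2] .
  then have *: "has_density B (\<lambda>E. of_real (Re (\<mu> E)) + \<i> * of_real (Re (- \<i> * \<mu> E))) T
      (\<lambda>x. F x + \<i> * G x)"
    by (rule has_density_lincomb)
  have "(\<lambda>E. of_real (Re (\<mu> E)) + \<i> * of_real (Re (- \<i> * \<mu> E))) = \<mu>"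
    by (auto simp: complex_eq_iff)
  then show ?thesis using * that by simp
qed

section \<open>Total variation of a measure with a density\<close>

lemma has_density_norm_le:
  assumes d: "has_density B \<mu> R f" and E: "E \<in> sets B"
  shows "ennreal (cmod (\<mu> E)) \<le> emeasure (density R (\<lambda>x. ennreal (cmod (f x)))) E"
proof -
  have [measurable]: "f \<in> borel_measurable R" "E \<in> sets R" and i: "integrable R f"
    using d E by (auto simp: has_density_def)
  have "ennreal (cmod (\<mu> E)) = ennreal (cmod (\<integral>x. indicator E x * f x \<partial>R))"
    using d E by (simp add: has_density_def)
  also have "\<dots> \<le> (\<integral>\<^sup>+x. ennreal (cmod (indicator E x * f x)) \<partial>R)"
    by (intro integral_norm_bound_ennreal integrable_indicator_times i) simp
  also have "\<dots> = (\<integral>\<^sup>+x. ennreal (cmod (f x)) * indicator E x \<partial>R)"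
    by (intro nn_integral_cong) (auto split: split_indicator)
  finally show ?thesis by (simp add: emeasure_density)
qed

text \<open>The pieces \<open>E \<inter> f -` ball c\<^sub>i \<epsilon>\<close> witness the total variation up to \<open>2 \<epsilon> R(E)\<close>.\<close>

lemma emeasure_density_le_variation:
  assumes d: "has_density B \<mu> R f" and E: "E \<in> sets B" and "0 < e"
  obtains A :: "nat \<Rightarrow> 'a set" where "range A \<subseteq> sets B" "disjoint_family A" "(\<Union>i. A i) = E"
    "emeasure (density R (\<lambda>x. ennreal (cmod (f x)))) E \<le>
      (\<Sum>i. ennreal (cmod (\<mu> (A i)))) + ennreal (2 * e) * emeasure R E"
proof -
  have R: "finite_measure R" and s: "sets R = sets B" and i: "integrable R f"
    using d by (auto simp: has_density_def)
  interpret finite_measure R by fact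
  have [measurable]: "f \<in> borel_measurable R" using i by auto
  obtain D :: "complex set" where D: "countable D" "\<And>X. open X \<Longrightarrow> X \<noteq> {} \<Longrightarrow> \<exists>d\<in>D. d \<in> X"
    using countable_dense_exists by blast
  have "D \<noteq> {}" using D(2)[of UNIV] by auto
  define c where "c = from_nat_into D"
  define A where "A i = E \<inter> (f -` disjointed (\<lambda>i. ball (c i) e) i \<inter> space R)" for i
  have "disjointed (\<lambda>i. ball (c i) e) i \<in> sets borel" for i
    using sets.range_disjointed_sets[of "\<lambda>i. ball (c i) e" borel] by (auto simp: image_subset_iff)
  then have AR [measurable]: "A i \<in> sets R" for i
    unfolding A_def using E s by (intro sets.Int measurable_sets[of f R borel]) auto
  have AB: "A i \<in> sets B" for i using AR s by simp
  have dj: "disjoint_family A"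
    using disjoint_family_disjointed[of "\<lambda>i. ball (c i) e"]
    by (fastforce simp: A_def disjoint_family_on_def)
  have un: "(\<Union>i. A i) = E"
  proof -
    have "z \<in> (\<Union>i. disjointed (\<lambda>i. ball (c i) e) i)" for z
    proof -
      obtain w where "w \<in> D" "w \<in> ball z e" using D(2)[of "ball z e"] \<open>0 < e\<close> by auto
      then obtain n where "c n = w"
        using D(1) \<open>D \<noteq> {}\<close> unfolding c_def by (metis from_nat_into_surj)
      then have "z \<in> ball (c n) e" using \<open>w \<in> ball z e\<close> by (simp add: dist_commute)
      then show ?thesis unfolding UN_disjointed_eq by blast
    qed
    moreover have "E \<subseteq> space R" using E s sets.sets_into_space by blast
    ultimately show ?thesis by (fastforce simp: A_def)
  qed
  let ?N = "density R (\<lambda>x. ennreal (cmod (f x)))"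
  have le: "emeasure ?N (A i) \<le> ennreal (cmod (\<mu> (A i))) + ennreal (2 * e) * emeasure R (A i)" for i
  proof -
    have near: "cmod (f x - c i) \<le> e" if "x \<in> A i" for x
      using that disjointed_subset[of "\<lambda>i. ball (c i) e" i]
      by (auto simp: A_def dist_norm norm_minus_commute dest!: subsetD)
    have I: "integrable R (\<lambda>x. indicator (A i) x * f x)"
      by (intro integrable_indicator_times i) simp
    have J: "integrable R (\<lambda>x. indicator (A i) x * c i)"
      by (intro integrable_indicator_times) auto
    have c: "(\<integral>x. indicator (A i) x * c i \<partial>R) = of_real (measure R (A i)) * c i"
    proof -
      have "(\<integral>x. indicator (A i) x *\<^sub>R c i \<partial>R) = measure R (A i) *\<^sub>R c i"
        by (intro has_bochner_integral_integral_eq has_bochner_integral_indicator)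
          (auto simp: less_top[symmetric])
      then show ?thesis by (simp add: indicator_times_eq_scaleR scaleR_conv_of_real)
    qed
    have "cmod ((\<integral>x. indicator (A i) x * c i \<partial>R) - \<mu> (A i)) =
       cmod (\<integral>x. indicator (A i) x * c i - indicator (A i) x * f x \<partial>R)"
      using d AB I J by (simp add: has_density_def)
    also have "\<dots> \<le> (\<integral>x. cmod (indicator (A i) x * c i - indicator (A i) x * f x) \<partial>R)"
      by (rule integral_norm_bound)
    also have "\<dots> \<le> (\<integral>x. e * indicator (A i) x \<partial>R)"
    proof (rule integral_mono)
      show "cmod (indicator (A i) x * c i - indicator (A i) x * f x) \<le> e * indicator (A i) x" for x
        using near[of x] by (auto split: split_indicator simp: norm_minus_commute)
    qed (use I J in \<open>auto simp: less_top[symmetric]\<close>)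
    also have "\<dots> = e * measure R (A i)" by simp
    finally have "cmod (of_real (measure R (A i)) * c i) \<le> cmod (\<mu> (A i)) + e * measure R (A i)"
      unfolding c using norm_triangle_sub[of "of_real (measure R (A i)) * c i" "\<mu> (A i)"] by linarith
    then have 1: "measure R (A i) * cmod (c i) \<le> cmod (\<mu> (A i)) + e * measure R (A i)"
      by (simp add: norm_mult)
    have "emeasure ?N (A i) = (\<integral>\<^sup>+x. ennreal (cmod (f x)) * indicator (A i) x \<partial>R)"
      by (simp add: emeasure_density)
    also have "\<dots> \<le> (\<integral>\<^sup>+x. ennreal (cmod (c i) + e) * indicator (A i) x \<partial>R)"
    proof (intro nn_integral_mono)
      fix x
      show "ennreal (cmod (f x)) * indicator (A i) x \<le> ennreal (cmod (c i) + e) * indicator (A i) x"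
        using near[of x] norm_triangle_sub[of "f x" "c i"]
        by (auto split: split_indicator intro!: ennreal_leI)
    qed
    also have "\<dots> = ennreal ((cmod (c i) + e) * measure R (A i))"
      using \<open>0 < e\<close> by (simp add: nn_integral_cmult_indicator emeasure_eq_measure ennreal_mult'')
    \<comment> \<open>One \<open>e\<close> comes from |f| \<le> |c i| + e on \<open>A i\<close>, the
      other from comparing the integral of the constant \<open>c i\<close> with
      \<open>\<mu> (A i)\<close>.\<close>
    also have "\<dots> \<le> ennreal (cmod (\<mu> (A i)) + 2 * e * measure R (A i))"
      using 1 by (intro ennreal_leI) (simp add: algebra_simps)
    also have "\<dots> = ennreal (cmod (\<mu> (A i))) + ennreal (2 * e) * emeasure R (A i)"
      using \<open>0 < e\<close> by (simp add: emeasure_eq_measure ennreal_mult'' ennreal_plus)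
    finally show ?thesis .
  qed
  have "emeasure ?N E = (\<Sum>i. emeasure ?N (A i))"
    using dj un by (subst suminf_emeasure) auto
  also have "\<dots> \<le> (\<Sum>i. ennreal (cmod (\<mu> (A i))) + ennreal (2 * e) * emeasure R (A i))"
    using le by (intro suminf_le) auto
  also have "\<dots> = (\<Sum>i. ennreal (cmod (\<mu> (A i)))) + ennreal (2 * e) * (\<Sum>i. emeasure R (A i))"
    by (subst suminf_add[symmetric]) auto
  also have "(\<Sum>i. emeasure R (A i)) = emeasure R E"
    using dj un by (subst suminf_emeasure) auto
  finally show ?thesis
    using AB by (intro that[OF _ dj un]) auto
qed

text \<open>Every partition sum is at most the integral of |f|, piece by piece. Partitions on which
  \<open>f\<close> is nearly constant come arbitrarily close to it, because then almost nothing
  cancels inside a piece.\<close>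

lemma variation_eq_emeasure_density:
  assumes d: "has_density B \<mu> R f" and E: "E \<in> sets B"
  shows "(SUP A\<in>{A::nat \<Rightarrow> 'a set. range A \<subseteq> sets B \<and> disjoint_family A \<and> (\<Union>i. A i) = E}.
      \<Sum>i. ennreal (cmod (\<mu> (A i)))) = emeasure (density R (\<lambda>x. ennreal (cmod (f x)))) E"
    (is "?V = emeasure ?N E")
proof -
  have R: "finite_measure R" and s: "sets R = sets B" using d by (auto simp: has_density_def)
  interpret finite_measure R by fact
  have sN: "sets ?N = sets B" "space ?N = space B" using s sets_eq_imp_space_eq[OF s] by auto
  show ?thesis
  proof (rule antisym)
    show "?V \<le> emeasure ?N E"
    proof (intro SUP_least)
      fix A :: "nat \<Rightarrow> 'a set"
      assume A: "A \<in> {A. range A \<subseteq> sets B \<and> disjoint_family A \<and> (\<Union>i. A i) = E}"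
      have "(\<Sum>i. ennreal (cmod (\<mu> (A i)))) \<le> (\<Sum>i. emeasure ?N (A i))"
        using A by (intro suminf_le has_density_norm_le[OF d]) auto
      also have "\<dots> = emeasure ?N E"
        using A sN by (subst suminf_emeasure) auto
      finally show "(\<Sum>i. ennreal (cmod (\<mu> (A i)))) \<le> emeasure ?N E" .
    qed
  next
    show "emeasure ?N E \<le> ?V"
    proof (rule ennreal_le_epsilon)
      fix e :: real assume "0 < e"
      \<comment> \<open>Chosen so that the total error \<open>2 * e' * measure R E\<close> is at
        most \<open>e\<close>; the \<open>+ 1\<close> guards against
        \<open>measure R E = 0\<close>.\<close>
      define e' where "e' = e / (2 * (measure R E + 1))"
      have m: "0 < measure R E + 1" by (simp add: add_nonneg_pos)
      then have "0 < e'" using \<open>0 < e\<close> by (simp add: e'_def)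
      have "2 * e' * measure R E \<le> 2 * e' * (measure R E + 1)"
        using \<open>0 < e'\<close> by simp
      also have "\<dots> = e" using m unfolding e'_def by (simp add: nonzero_divide_eq_eq algebra_simps)
      finally have "ennreal (2 * e') * emeasure R E \<le> ennreal e"
        using \<open>0 < e'\<close> ennreal_leI[of _ e]
        by (simp add: emeasure_eq_measure ennreal_mult''[symmetric])
      obtain A :: "nat \<Rightarrow> 'a set" where A: "range A \<subseteq> sets B" "disjoint_family A" "(\<Union>i. A i) = E"
        and le: "emeasure ?N E \<le> (\<Sum>i. ennreal (cmod (\<mu> (A i)))) + ennreal (2 * e') * emeasure R E"
        using emeasure_density_le_variation[OF d E \<open>0 < e'\<close>] by blast
      note le
      also have "(\<Sum>i. ennreal (cmod (\<mu> (A i)))) + ennreal (2 * e') * emeasure R E \<le> ?V + ennreal e"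
        using A \<open>ennreal (2 * e') * emeasure R E \<le> ennreal e\<close>
        by (intro add_mono SUP_upper) auto
      finally show "emeasure ?N E \<le> ?V + ennreal e" .
    qed
  qed
qed

text \<open>The supremum that defines the variation agrees on \<open>sets B\<close> with a set
  function already known to be a measure, and this is where its countable additivity comes
  from.\<close>

lemma total_variation_eq:
  assumes d: "has_density B \<mu> R f"
  shows "total_variation B \<mu> = density R (\<lambda>x. ennreal (cmod (f x)))" (is "_ = ?N")
proof -
  have s: "sets R = sets B" using d by (simp add: has_density_def)
  have sN: "sets ?N = sets B" "space ?N = space B" using s sets_eq_imp_space_eq[OF s] by auto
  have "total_variation B \<mu> = measure_of (space B) (sets B) (emeasure ?N)"
    unfolding total_variation_def
    by (rule measure_of_eq[OF sets.space_closed], rule variation_eq_emeasure_density[OF d])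
      (simp add: sets.sigma_sets_eq)
  also have "\<dots> = ?N"
    unfolding sN[symmetric] by (rule measure_of_of_measure)
  finally show ?thesis .
qed

lemma emeasure_total_variation:
  assumes "complex_measure B \<mu>" "E \<in> sets B"
  shows "emeasure (total_variation B \<mu>) E =
    (SUP A\<in>{A::nat \<Rightarrow> 'a set. range A \<subseteq> sets B \<and> disjoint_family A \<and> (\<Union>i. A i) = E}.
      \<Sum>i. ennreal (cmod (\<mu> (A i))))"
proof -
  obtain R f where d: "has_density B \<mu> R f" using complex_measure_has_density[OF assms(1)] .
  show ?thesis
    unfolding total_variation_eq[OF d] variation_eq_emeasure_density[OF d assms(2)] ..
qed

lemma sets_total_variation [simp]: "sets (total_variation B \<mu>) = sets B"
  and space_total_variation [simp]: "space (total_variation B \<mu>) = space B"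
  by (simp_all add: total_variation_def)

lemma finite_measure_total_variation:
  assumes "complex_measure B \<mu>"
  shows "finite_measure (total_variation B \<mu>)"
proof -
  obtain R f where d: "has_density B \<mu> R f" using complex_measure_has_density[OF assms] .
  then have i: "integrable R f" by (simp add: has_density_def)
  have "emeasure (total_variation B \<mu>) (space R) = (\<integral>\<^sup>+x. ennreal (cmod (f x)) \<partial>R)"
    unfolding total_variation_eq[OF d] using i
    by (subst emeasure_density) (auto intro!: nn_integral_cong)
  also have "\<dots> < \<infinity>" using i by (simp add: integrable_iff_bounded)
  finally show ?thesis
    by (intro finite_measureI) (simp add: total_variation_eq[OF d] less_top)
qed

lemma norm_le_total_variation:
  assumes "complex_measure B \<mu>"
  shows "cmod (\<mu> E) \<le> measure (total_variation B \<mu>) E"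
proof (cases "E \<in> sets B")
  case True
  obtain R f where d: "has_density B \<mu> R f" using complex_measure_has_density[OF assms] .
  interpret finite_measure "total_variation B \<mu>" by (rule finite_measure_total_variation[OF assms])
  show ?thesis
    using has_density_norm_le[OF d True] unfolding total_variation_eq[OF d, symmetric]
    by (simp add: emeasure_eq_measure)
qed (use assms in \<open>simp add: complex_measure_outside\<close>)

section \<open>Polar decomposition and integration against a complex measure\<close>

text \<open>The witness behind \<open>SOME\<close> is f / |f| for any density \<open>f\<close> of
  \<mu>, as |\<mu>| = |f| R.\<close>

lemma polar_density:
  assumes \<mu>: "complex_measure B \<mu>"
  shows "polar_density B \<mu> \<in> borel_measurable B"
    and "\<And>x. x \<in> space B \<Longrightarrow> cmod (polar_density B \<mu> x) = 1"
    and "has_density B \<mu> (total_variation B \<mu>) (polar_density B \<mu>)"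
proof -
  interpret finite_measure "total_variation B \<mu>"
    by (rule finite_measure_total_variation[OF \<mu>])
  obtain R f where d: "has_density B \<mu> R f" using complex_measure_has_density[OF \<mu>] .
  then have [measurable_cong]: "sets R = sets B" and i: "integrable R f"
    and m: "\<And>E. E \<in> sets B \<Longrightarrow> \<mu> E = (\<integral>x. indicator E x * f x \<partial>R)"
    by (auto simp: has_density_def)
  note tv = total_variation_eq[OF d]
  \<comment> \<open>The value 1 where \<open>f\<close> vanishes keeps the modulus 1 everywhere; that
    set is |\<mu>|-null.\<close>
  define h where "h x = (if f x = 0 then 1 else f x / of_real (cmod (f x)))" for x
  have [measurable]: "f \<in> borel_measurable R" using i by simp
  then have [measurable]: "h \<in> borel_measurable R" unfolding h_def by measurable
  have hB: "h \<in> borel_measurable B" by measurable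
  have eq: "cmod (f x) *\<^sub>R h x = f x" for x
    by (simp add: h_def scaleR_conv_of_real)
  have "\<mu> E = (\<integral>x\<in>E. h x \<partial>total_variation B \<mu>)" if E: "E \<in> sets B" for E
  proof -
    have [measurable]: "E \<in> sets R" using E \<open>sets R = sets B\<close> by simp
    have "(\<integral>x\<in>E. h x \<partial>total_variation B \<mu>) = (\<integral>x. cmod (f x) *\<^sub>R (indicator E x *\<^sub>R h x) \<partial>R)"
      unfolding tv set_lebesgue_integral_def by (subst integral_density) auto
    also have "\<dots> = (\<integral>x. indicator E x * f x \<partial>R)"
      by (intro Bochner_Integration.integral_cong refl) (simp add: eq split: split_indicator)
    finally show ?thesis using m[OF E] by simp
  qed
  moreover have "cmod (h x) = 1" for x by (simp add: h_def norm_divide)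
  ultimately have "\<exists>h. h \<in> borel_measurable B \<and> (\<forall>x\<in>space B. cmod (h x) = 1) \<and>
     (\<forall>E\<in>sets B. \<mu> E = (\<integral>x\<in>E. h x \<partial>total_variation B \<mu>))"
    using hB by blast
  from someI_ex[OF this, folded polar_density_def]
  have p: "polar_density B \<mu> \<in> borel_measurable B" "\<And>x. x \<in> space B \<Longrightarrow> cmod (polar_density B \<mu> x) = 1"
    and pE: "\<And>E. E \<in> sets B \<Longrightarrow> \<mu> E = (\<integral>x\<in>E. polar_density B \<mu> x \<partial>total_variation B \<mu>)" by auto
  show "polar_density B \<mu> \<in> borel_measurable B"
    and "\<And>x. x \<in> space B \<Longrightarrow> cmod (polar_density B \<mu> x) = 1" by fact+
  have pm: "polar_density B \<mu> \<in> borel_measurable (total_variation B \<mu>)"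
    using p(1) by (simp cong: measurable_cong_sets)
  have "integrable (total_variation B \<mu>) (polar_density B \<mu>)"
    using p(2) by (intro integrable_const_bound[where B=1] pm) auto
  then show "has_density B \<mu> (total_variation B \<mu>) (polar_density B \<mu>)"
    using pE finite_measure_axioms
    by (auto simp: has_density_def set_lebesgue_integral_def indicator_times_eq_scaleR)
qed

text \<open>Makes the integral independent of the chosen polar density and computable from any
  density. The functions |f| p and \<open>f\<close> have the same integral over every measurable
  set, hence agree \<open>R\<close>-a.e.\<close>

lemma complex_integral_eq:
  assumes \<mu>: "complex_measure B \<mu>" and d: "has_density B \<mu> R f" and g: "g \<in> borel_measurable B"
  shows "complex_integral B \<mu> g = (\<integral>x. g x * f x \<partial>R)"
proof -
  have [measurable_cong]: "sets R = sets B" and i: "integrable R f" using d by (auto simp: has_density_def)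
  interpret finite_measure R using d by (simp add: has_density_def)
  let ?p = "polar_density B \<mu>"
  note p = polar_density[OF \<mu>]
  note [measurable] = p(1) g
  have [measurable]: "f \<in> borel_measurable R" using i by simp
  note tv = total_variation_eq[OF d]
  have dp: "has_density B \<mu> R (\<lambda>x. cmod (f x) *\<^sub>R ?p x)"
    using d by (intro has_density_change[OF p(3) tv]) (auto simp: has_density_def)
  have ae: "AE x in R. cmod (f x) *\<^sub>R ?p x = f x"
  proof (rule density_unique_banach)
    show "integrable R (\<lambda>x. cmod (f x) *\<^sub>R ?p x)" "integrable R f"
      using dp i by (simp_all add: has_density_def)
    fix A assume "A \<in> sets R"
    then have "A \<in> sets B" using \<open>sets R = sets B\<close> by simp
    then have "\<mu> A = (\<integral>x. indicator A x * (cmod (f x) *\<^sub>R ?p x) \<partial>R)"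
      using dp by (simp only: has_density_def)
    moreover have "\<mu> A = (\<integral>x. indicator A x * f x \<partial>R)"
      using d \<open>A \<in> sets B\<close> by (simp only: has_density_def)
    ultimately show "(\<integral>x\<in>A. cmod (f x) *\<^sub>R ?p x \<partial>R) = (\<integral>x\<in>A. f x \<partial>R)"
      unfolding set_lebesgue_integral_def indicator_times_eq_scaleR by simp
  qed
  have "complex_integral B \<mu> g = (\<integral>x. cmod (f x) *\<^sub>R (g x * ?p x) \<partial>R)"
    unfolding complex_integral_def tv by (rule integral_density) auto
  also have "\<dots> = (\<integral>x. g x * f x \<partial>R)"
  proof (rule integral_cong_AE)
    show "AE x in R. cmod (f x) *\<^sub>R (g x * ?p x) = g x * f x"
      using ae by eventually_elim (metis mult_scaleR_right)
  qed measurable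
  finally show ?thesis .
qed

lemma integrable_bounded_times:
  fixes f g :: "'a \<Rightarrow> complex"
  assumes "integrable R f" "g \<in> borel_measurable R" "\<And>x. x \<in> space R \<Longrightarrow> cmod (g x) \<le> C"
  shows "integrable R (\<lambda>x. g x * f x)"
proof (rule Bochner_Integration.integrable_bound)
  show "integrable R (\<lambda>x. of_real C * f x)" using assms(1) by simp
  show "(\<lambda>x. g x * f x) \<in> borel_measurable R" using assms by auto
  show "AE x in R. cmod (g x * f x) \<le> cmod (of_real C * f x)"
    using assms(3) by (intro AE_I2) (fastforce simp: norm_mult intro!: mult_right_mono)
qed

lemma complex_integral_lincomb:
  assumes \<mu>: "complex_measure B \<mu>" and \<nu>: "complex_measure B \<nu>"
    and g: "g \<in> borel_measurable B" "\<And>x. x \<in> space B \<Longrightarrow> cmod (g x) \<le> C"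
  shows "complex_integral B (\<lambda>E. \<mu> E + c * \<nu> E) g = complex_integral B \<mu> g + c * complex_integral B \<nu> g"
proof -
  obtain R1 f1 where d1: "has_density B \<mu> R1 f1" using complex_measure_has_density[OF \<mu>] .
  obtain R2 f2 where d2: "has_density B \<nu> R2 f2" using complex_measure_has_density[OF \<nu>] .
  obtain T F G where d: "has_density B \<mu> T F" "has_density B \<nu> T G"
    using has_density_common[OF d1 d2] .
  have s: "sets T = sets B" and i: "integrable T F" "integrable T G" using d by (auto simp: has_density_def)
  have gT: "g \<in> borel_measurable T" using g(1) s by (simp cong: measurable_cong_sets)
  have [simp]: "integrable T (\<lambda>x. g x * F x)" "integrable T (\<lambda>x. g x * G x)"
    using i gT g(2) sets_eq_imp_space_eq[OF s] by (auto intro!: integrable_bounded_times)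
  have "complex_integral B (\<lambda>E. \<mu> E + c * \<nu> E) g = (\<integral>x. g x * (F x + c * G x) \<partial>T)"
    by (rule complex_integral_eq[OF complex_measure_lincomb[OF \<mu> \<nu>] has_density_lincomb[OF d] g(1)])
  also have "\<dots> = (\<integral>x. g x * F x + c * (g x * G x) \<partial>T)" by (simp add: algebra_simps)
  also have "\<dots> = complex_integral B \<mu> g + c * complex_integral B \<nu> g"
    by (simp add: complex_integral_eq[OF \<mu> d(1) g(1)] complex_integral_eq[OF \<nu> d(2) g(1)])
  finally show ?thesis .
qed

text \<open>Over a common dominating measure this is |F + c G| \<le> |F| + |c| |G| under the
  integral.\<close>

lemma total_variation_lincomb_le:
  assumes \<mu>: "complex_measure B \<mu>" and \<nu>: "complex_measure B \<nu>"
  shows "measure (total_variation B (\<lambda>E. \<mu> E + c * \<nu> E)) E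
    \<le> measure (total_variation B \<mu>) E + cmod c * measure (total_variation B \<nu>) E"
proof (cases "E \<in> sets B")
  case True
  obtain R1 f1 where d1: "has_density B \<mu> R1 f1" using complex_measure_has_density[OF \<mu>] .
  obtain R2 f2 where d2: "has_density B \<nu> R2 f2" using complex_measure_has_density[OF \<nu>] .
  obtain T F G where d: "has_density B \<mu> T F" "has_density B \<nu> T G"
    using has_density_common[OF d1 d2] .
  have s: "sets T = sets B" and i: "integrable T F" "integrable T G" using d by (auto simp: has_density_def)
  have [measurable]: "F \<in> borel_measurable T" "G \<in> borel_measurable T" "E \<in> sets T" using i s True by auto
  interpret L: finite_measure "total_variation B (\<lambda>E. \<mu> E + c * \<nu> E)"
    by (rule finite_measure_total_variation[OF complex_measure_lincomb[OF \<mu> \<nu>]])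
  interpret M: finite_measure "total_variation B \<mu>" by (rule finite_measure_total_variation[OF \<mu>])
  interpret N: finite_measure "total_variation B \<nu>" by (rule finite_measure_total_variation[OF \<nu>])
  have "emeasure (total_variation B (\<lambda>E. \<mu> E + c * \<nu> E)) E
     = (\<integral>\<^sup>+x. ennreal (cmod (F x + c * G x)) * indicator E x \<partial>T)"
    unfolding total_variation_eq[OF has_density_lincomb[OF d]] by (rule emeasure_density) auto
  also have "\<dots> \<le> (\<integral>\<^sup>+x. ennreal (cmod (F x)) * indicator E x
      + ennreal (cmod c) * (ennreal (cmod (G x)) * indicator E x) \<partial>T)"
  proof (intro nn_integral_mono)
    fix x
    have "cmod (F x + c * G x) \<le> cmod (F x) + cmod c * cmod (G x)"
      by (metis norm_mult norm_triangle_ineq)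
    then have "ennreal (cmod (F x + c * G x)) \<le> ennreal (cmod (F x)) + ennreal (cmod c) * ennreal (cmod (G x))"
      by (simp add: ennreal_mult[symmetric] ennreal_plus[symmetric] del: ennreal_plus)
    then show "ennreal (cmod (F x + c * G x)) * indicator E x \<le> ennreal (cmod (F x)) * indicator E x
        + ennreal (cmod c) * (ennreal (cmod (G x)) * indicator E x)"
      by (auto split: split_indicator)
  qed
  also have "\<dots> = emeasure (total_variation B \<mu>) E + ennreal (cmod c) * emeasure (total_variation B \<nu>) E"
    unfolding total_variation_eq[OF d(1)] total_variation_eq[OF d(2)]
    by (simp add: nn_integral_add nn_integral_cmult emeasure_density)
  finally show ?thesis
    by (simp add: L.emeasure_eq_measure M.emeasure_eq_measure N.emeasure_eq_measure
        ennreal_mult[symmetric] ennreal_plus[symmetric] del: ennreal_plus)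
qed (auto simp: measure_notin_sets)

lemma total_variation_least:
  assumes \<mu>: "complex_measure B \<mu>" and N: "sets N = sets B"
    and le: "\<And>E. E \<in> sets B \<Longrightarrow> ennreal (cmod (\<mu> E)) \<le> emeasure N E" and E: "E \<in> sets B"
  shows "emeasure (total_variation B \<mu>) E \<le> emeasure N E"
  unfolding emeasure_total_variation[OF \<mu> E]
proof (intro SUP_least)
  fix A :: "nat \<Rightarrow> 'a set"
  assume A: "A \<in> {A. range A \<subseteq> sets B \<and> disjoint_family A \<and> (\<Union>i. A i) = E}"
  have "(\<Sum>i. ennreal (cmod (\<mu> (A i)))) \<le> (\<Sum>i. emeasure N (A i))"
    using A by (intro suminf_le le) auto
  also have "\<dots> = emeasure N E"
    using A N by (subst suminf_emeasure) auto
  finally show "(\<Sum>i. ennreal (cmod (\<mu> (A i)))) \<le> emeasure N E" .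
qed

lemma total_variation_positive:
  assumes "finite_measure \<nu>" "sets \<nu> = sets B"
  shows "total_variation B (\<lambda>E. of_real (measure \<nu> E)) = \<nu>"
  unfolding total_variation_eq[OF has_density_positive[OF assms]] by (simp add: density_1)

section \<open>Lebesgue decomposition and Radon-Nikodym derivatives of complex measures\<close>

text \<open>The supremum of \<open>N\<close> over the \<open>M\<close>-null sets is attained by the
  union \<open>A\<close> of a maximising sequence. A null set with \<open>N\<close>-mass outside
  \<open>A\<close> would push its union with \<open>A\<close> above the maximum, as \<open>N\<close>
  is finite.\<close>

lemma maximal_null_set:
  assumes N: "finite_measure N" and s: "sets M = sets N"
  obtains A where "A \<in> null_sets M" "\<And>E. E \<in> null_sets M \<Longrightarrow> E - A \<in> null_sets N"
proof -
  interpret finite_measure N by fact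
  have "null_sets M \<noteq> {}" by auto
  then obtain f :: "nat \<Rightarrow> ennreal" where f: "range f \<subseteq> emeasure N ` null_sets M"
      "(SUP E\<in>null_sets M. emeasure N E) = (SUP i. f i)"
    using ennreal_SUP_countable_SUP by metis
  then have "\<forall>i. \<exists>E\<in>null_sets M. f i = emeasure N E" by blast
  then obtain D where D: "\<And>i. D i \<in> null_sets M" "\<And>i. f i = emeasure N (D i)" by metis
  define A where "A = (\<Union>i. D i)"
  have A: "A \<in> null_sets M" unfolding A_def using D by auto
  then have AN: "A \<in> sets N" using s by auto
  have "f i \<le> emeasure N A" for i
    unfolding D(2) using AN D(1)[of i] by (intro emeasure_mono) (auto simp: A_def)
  then have max: "emeasure N E \<le> emeasure N A" if "E \<in> null_sets M" for E
    using that f(2) by (metis SUP_least SUP_upper order_trans)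
  have "E - A \<in> null_sets N" if E: "E \<in> null_sets M" for E
  proof -
    have EN: "E \<in> sets N" using E s by auto
    have "emeasure N A + emeasure N (E - A) = emeasure N (A \<union> E)"
      using AN EN by (subst plus_emeasure) auto
    also have "\<dots> \<le> emeasure N A" using A E by (intro max) auto
    finally have "emeasure N (E - A) = 0"
      by (simp add: emeasure_eq_measure ennreal_plus[symmetric] measure_le_0_iff del: ennreal_plus)
    then show ?thesis using AN EN by auto
  qed
  then show ?thesis using that A by blast
qed

text \<open>The \<open>if\<close> restores the normalisation: \<open>E \<inter> D\<close> can be
  measurable although \<open>E\<close> is not.\<close>

lemma complex_measure_Int:
  assumes \<mu>: "complex_measure B \<mu>" and D: "D \<in> sets B"
  shows "complex_measure B (\<lambda>E. if E \<in> sets B then \<mu> (E \<inter> D) else 0)"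
  unfolding complex_measure_def
proof (intro conjI allI impI)
  fix A :: "nat \<Rightarrow> 'a set" assume A: "range A \<subseteq> sets B" "disjoint_family A"
  have "(\<lambda>i. \<mu> (A i \<inter> D)) sums \<mu> (\<Union>i. A i \<inter> D)"
    using A D by (intro complex_measure_sums[OF \<mu>]) (auto simp: disjoint_family_on_def)
  then show "(\<lambda>i. if A i \<in> sets B then \<mu> (A i \<inter> D) else 0) sums
      (if (\<Union>i. A i) \<in> sets B then \<mu> ((\<Union>i. A i) \<inter> D) else 0)"
    using A by (simp add: range_subsetD)
qed simp

text \<open>Let \<open>A\<close> be an |m|-null set of largest |\<mu>|-mass. Then |\<mu>| charges no
  |m|-null set outside \<open>A\<close>, so restricting \<mu> to the complement of \<open>A\<close>
  and to \<open>A\<close> gives the two parts. The bound on the variation is kept for the norm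
  estimate of \<open>phi\<close>.\<close>

lemma Lebesgue_decomposition_complex:
  assumes m: "complex_measure B m" and \<mu>: "complex_measure B \<mu>"
  obtains \<mu>a \<mu>s where "complex_measure B \<mu>a" "abs_cont_wrt B m \<mu>a"
    "complex_measure B \<mu>s" "singular_wrt B m \<mu>s" "\<mu> = (\<lambda>E. \<mu>a E + \<mu>s E)"
    "emeasure (total_variation B \<mu>a) (space B) \<le> emeasure (total_variation B \<mu>) (space B)"
proof -
  interpret T: finite_measure "total_variation B \<mu>" by (rule finite_measure_total_variation[OF \<mu>])
  obtain A where A: "A \<in> null_sets (total_variation B m)"
    "\<And>E. E \<in> null_sets (total_variation B m) \<Longrightarrow> E - A \<in> null_sets (total_variation B \<mu>)"
    using maximal_null_set[OF T.finite_measure_axioms, of "total_variation B m"] by auto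
  have AB: "A \<in> sets B" using A(1) by auto
  define \<mu>a where "\<mu>a E = (if E \<in> sets B then \<mu> (E \<inter> (space B - A)) else 0)" for E
  define \<mu>s where "\<mu>s E = (if E \<in> sets B then \<mu> (E \<inter> A) else 0)" for E
  have a: "complex_measure B \<mu>a" and s: "complex_measure B \<mu>s"
    unfolding \<mu>a_def \<mu>s_def using AB by (auto intro!: complex_measure_Int[OF \<mu>])
  have "abs_cont_wrt B m \<mu>a"
    unfolding abs_cont_wrt_def
  proof
    fix E assume E: "E \<in> null_sets (total_variation B m)"
    have "E \<inter> (space B - A) = E - A" using null_setsD2[OF E] sets.sets_into_space[of E B] by auto
    moreover have "cmod (\<mu> (E - A)) \<le> 0"
      using norm_le_total_variation[OF \<mu>, of "E - A"] A(2)[OF E] by (simp add: null_sets_def measure_def)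
    ultimately show "\<mu>a E = 0" by (simp add: \<mu>a_def)
  qed
  moreover have "singular_wrt B m \<mu>s"
    unfolding singular_wrt_def using A(1) AB by (intro bexI[of _ A]) (auto simp: \<mu>s_def Int_assoc)
  moreover have "\<mu> = (\<lambda>E. \<mu>a E + \<mu>s E)"
  proof
    fix E
    show "\<mu> E = \<mu>a E + \<mu>s E"
    proof (cases "E \<in> sets B")
      case True
      have "(E \<inter> (space B - A)) \<union> (E \<inter> A) = E" using sets.sets_into_space[OF True] by auto
      then have "\<mu> E = \<mu> (E \<inter> (space B - A)) + \<mu> (E \<inter> A)"
        using complex_measure_Un[OF \<mu>, of "E \<inter> (space B - A)" "E \<inter> A"] True AB by auto
      then show ?thesis using True by (simp add: \<mu>a_def \<mu>s_def)
    qed (simp add: \<mu>a_def \<mu>s_def complex_measure_outside[OF \<mu>])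
  qed
  moreover have "emeasure (total_variation B \<mu>a) (space B) \<le> emeasure (total_variation B \<mu>) (space B)"
  proof (rule total_variation_least[OF a])
    fix E assume E: "E \<in> sets B"
    have "cmod (\<mu> (E \<inter> (space B - A))) \<le> measure (total_variation B \<mu>) (E \<inter> (space B - A))"
      by (rule norm_le_total_variation[OF \<mu>])
    also have "\<dots> \<le> measure (total_variation B \<mu>) E"
      using E by (intro T.finite_measure_mono) auto
    finally show "ennreal (cmod (\<mu>a E)) \<le> emeasure (total_variation B \<mu>) E"
      using E by (simp add: \<mu>a_def T.emeasure_eq_measure ennreal_leI)
  qed auto
  ultimately show ?thesis using that a s by blast
qed

lemma abs_cont_singular_imp_zero:
  assumes "complex_measure B \<mu>" "abs_cont_wrt B m \<mu>" "singular_wrt B m \<mu>"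
  shows "\<mu> E = 0"
proof (cases "E \<in> sets B")
  case True
  obtain A where A: "A \<in> null_sets (total_variation B m)" "\<forall>E\<in>sets B. \<mu> E = \<mu> (E \<inter> A)"
    using assms(3) by (auto simp: singular_wrt_def)
  have "E \<inter> A \<in> null_sets (total_variation B m)"
    using null_set_Int1[OF A(1), of E] True by simp
  then show ?thesis using A(2) assms(2) True by (simp add: abs_cont_wrt_def)
qed (use assms in \<open>simp add: complex_measure_outside\<close>)

lemma abs_cont_wrt_lincomb:
  "abs_cont_wrt B m \<mu> \<Longrightarrow> abs_cont_wrt B m \<nu> \<Longrightarrow> abs_cont_wrt B m (\<lambda>E. \<mu> E + c * \<nu> E)"
  by (simp add: abs_cont_wrt_def)

lemma singular_wrt_lincomb:
  assumes "singular_wrt B m \<mu>" "singular_wrt B m \<nu>"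
  shows "singular_wrt B m (\<lambda>E. \<mu> E + c * \<nu> E)"
proof -
  obtain A1 A2 where A: "A1 \<in> null_sets (total_variation B m)" "\<forall>E\<in>sets B. \<mu> E = \<mu> (E \<inter> A1)"
    "A2 \<in> null_sets (total_variation B m)" "\<forall>E\<in>sets B. \<nu> E = \<nu> (E \<inter> A2)"
    using assms by (auto simp: singular_wrt_def)
  have "\<mu> E = \<mu> (E \<inter> (A1 \<union> A2)) \<and> \<nu> E = \<nu> (E \<inter> (A1 \<union> A2))" if "E \<in> sets B" for E
  proof -
    have "E \<inter> (A1 \<union> A2) \<in> sets B" using that null_setsD2[OF A(1)] null_setsD2[OF A(3)] by auto
    moreover have "E \<inter> (A1 \<union> A2) \<inter> A1 = E \<inter> A1" "E \<inter> (A1 \<union> A2) \<inter> A2 = E \<inter> A2" by auto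
    ultimately show ?thesis using A(2,4) that by metis
  qed
  moreover have "A1 \<union> A2 \<in> null_sets (total_variation B m)" using A by auto
  ultimately show ?thesis unfolding singular_wrt_def by (intro bexI[of _ "A1 \<union> A2"] ballI) metis+
qed

text \<open>Two candidates differ by a measure that is also a difference of singular parts. It is
  absolutely continuous and singular at once, hence 0.\<close>

lemma lebesgue_ac_part_eqI:
  assumes a: "complex_measure B \<mu>a" "abs_cont_wrt B m \<mu>a"
    and s: "complex_measure B \<mu>s" "singular_wrt B m \<mu>s" and \<mu>: "\<mu> = (\<lambda>E. \<mu>a E + \<mu>s E)"
  shows "lebesgue_ac_part B m \<mu> = \<mu>a"
  unfolding lebesgue_ac_part_def
proof (rule the_equality)
  show "complex_measure B \<mu>a \<and> abs_cont_wrt B m \<mu>a \<and>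
     (\<exists>\<mu>s. complex_measure B \<mu>s \<and> singular_wrt B m \<mu>s \<and> \<mu> = (\<lambda>E. \<mu>a E + \<mu>s E))"
    using assms by blast
next
  fix \<nu> assume "complex_measure B \<nu> \<and> abs_cont_wrt B m \<nu> \<and>
     (\<exists>\<mu>s. complex_measure B \<mu>s \<and> singular_wrt B m \<mu>s \<and> \<mu> = (\<lambda>E. \<nu> E + \<mu>s E))"
  then obtain \<nu>s where n: "complex_measure B \<nu>" "abs_cont_wrt B m \<nu>"
    "complex_measure B \<nu>s" "singular_wrt B m \<nu>s" "\<mu> = (\<lambda>E. \<nu> E + \<nu>s E)" by blast
  have sum: "\<mu>a E + \<mu>s E = \<nu> E + \<nu>s E" for E
    using \<mu> n(5) by metis
  have eq: "(\<lambda>E. \<nu> E + (-1) * \<mu>a E) = (\<lambda>E. \<mu>s E + (-1) * \<nu>s E)"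
  proof
    show "\<nu> E + (-1) * \<mu>a E = \<mu>s E + (-1) * \<nu>s E" for E
      using sum[of E] by (simp add: algebra_simps)
  qed
  have "\<nu> E + (-1) * \<mu>a E = 0" for E
  proof (rule abs_cont_singular_imp_zero)
    show "complex_measure B (\<lambda>E. \<nu> E + (-1) * \<mu>a E)" by (intro complex_measure_lincomb n a)
    show "abs_cont_wrt B m (\<lambda>E. \<nu> E + (-1) * \<mu>a E)" by (intro abs_cont_wrt_lincomb n a)
    show "singular_wrt B m (\<lambda>E. \<nu> E + (-1) * \<mu>a E)"
      unfolding eq by (intro singular_wrt_lincomb n s)
  qed
  then show "\<nu> = \<mu>a" by auto
qed

section \<open>Classes modulo a.e. equality and Radon-Nikodym derivatives\<close>

lemma ae_class_eqI:
  assumes "AE x in M. f x = g x"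
  shows "ae_class M f = ae_class M g"
  unfolding ae_class_def
proof (intro Collect_cong conj_cong refl)
  fix h
  show "(AE x in M. h x = f x) \<longleftrightarrow> (AE x in M. h x = g x)"
  proof
    assume "AE x in M. h x = f x" then show "AE x in M. h x = g x"
      using assms by eventually_elim simp
  next
    assume "AE x in M. h x = g x" then show "AE x in M. h x = f x"
      using assms by eventually_elim simp
  qed
qed

lemma rep_ae_class:
  assumes "f \<in> borel_measurable M"
  shows "rep (ae_class M f) \<in> borel_measurable M" "AE x in M. rep (ae_class M f) x = f x"
proof -
  have "f \<in> ae_class M f" using assms by (simp add: ae_class_def)
  then have "rep (ae_class M f) \<in> ae_class M f" unfolding rep_def by (rule someI[of "\<lambda>g. g \<in> ae_class M f"])
  then show "rep (ae_class M f) \<in> borel_measurable M" "AE x in M. rep (ae_class M f) x = f x"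
    by (auto simp: ae_class_def)
qed

lemma ae_class_rep:
  assumes "f \<in> borel_measurable M" shows "ae_class M (rep (ae_class M f)) = ae_class M f"
  by (rule ae_class_eqI) (rule rep_ae_class(2)[OF assms])

lemma L1_carrier:
  assumes "G \<in> vcarrier (L1_space M)"
  shows "integrable M (rep G)" "ae_class M (rep G) = G" "rep G \<in> borel_measurable M"
proof -
  obtain f where f: "integrable M f" "G = ae_class M f" using assms by (auto simp: L1_space_def)
  then have m: "f \<in> borel_measurable M" by auto
  note r = rep_ae_class[OF m]
  have "integrable M (rep (ae_class M f)) \<longleftrightarrow> integrable M f"
    using r m by (intro integrable_cong_AE)
  then show "integrable M (rep G)" "ae_class M (rep G) = G" "rep G \<in> borel_measurable M"
    using f r ae_class_rep[OF m] by simp_all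
qed

lemma L1_carrierI: "integrable M f \<Longrightarrow> ae_class M f \<in> vcarrier (L1_space M)"
  by (auto simp: L1_space_def)

lemma has_density_L1:
  assumes m: "complex_measure B m" and G: "G \<in> vcarrier (L1_space (total_variation B m))"
    and \<nu>: "\<And>E. E \<in> sets B \<Longrightarrow> \<nu> E = complex_integral B m (\<lambda>x. indicator E x * rep G x)"
  shows "has_density B \<nu> (total_variation B m) (\<lambda>x. rep G x * polar_density B m x)"
proof -
  note p = polar_density[OF m] and G' = L1_carrier[OF G]
  have "integrable (total_variation B m) (\<lambda>x. polar_density B m x * rep G x)"
    using p(1,2) by (intro integrable_bounded_times[where C=1] G'(1)) (auto cong: measurable_cong_sets)
  then show ?thesis
    using \<nu> finite_measure_total_variation[OF m]
    by (auto simp: has_density_def complex_integral_def mult_ac)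
qed

lemma total_variation_L1:
  assumes m: "complex_measure B m" and G: "G \<in> vcarrier (L1_space (total_variation B m))"
    and \<nu>: "\<And>E. E \<in> sets B \<Longrightarrow> \<nu> E = complex_integral B m (\<lambda>x. indicator E x * rep G x)"
  shows "total_variation B \<nu> = density (total_variation B m) (\<lambda>x. ennreal (cmod (rep G x)))"
proof -
  have "has_density B \<nu> (total_variation B m) (\<lambda>x. rep G x * polar_density B m x)"
    using has_density_L1[OF m G] \<nu> by blast
  note total_variation_eq[OF this]
  also have "density (total_variation B m) (\<lambda>x. ennreal (cmod (rep G x * polar_density B m x)))
      = density (total_variation B m) (\<lambda>x. ennreal (cmod (rep G x)))"
    using L1_carrier(3)[OF G] polar_density(1,2)[OF m]
    by (intro density_cong) (auto simp: norm_mult cong: measurable_cong_sets)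
  finally show ?thesis .
qed

text \<open>The isometry between L1 classes and their measures \<open>G dm\<close>: it turns bounds
  on variations into bounds on \<open>phi\<close>.\<close>

lemma emeasure_total_variation_L1:
  assumes m: "complex_measure B m" and G: "G \<in> vcarrier (L1_space (total_variation B m))"
    and \<nu>: "\<And>E. E \<in> sets B \<Longrightarrow> \<nu> E = complex_integral B m (\<lambda>x. indicator E x * rep G x)"
  shows "emeasure (total_variation B \<nu>) (space B) = ennreal (vnorm (L1_space (total_variation B m)) G)"
proof -
  let ?M = "total_variation B m"
  have i: "integrable ?M (rep G)" by (rule L1_carrier[OF G])
  have tv: "total_variation B \<nu> = density ?M (\<lambda>x. ennreal (cmod (rep G x)))"
    using total_variation_L1[OF m G] \<nu> by blast
  have "emeasure (total_variation B \<nu>) (space B) = (\<integral>\<^sup>+x. ennreal (cmod (rep G x)) * indicator (space ?M) x \<partial>?M)"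
    unfolding tv
    using L1_carrier(3)[OF G] by (subst emeasure_density) (auto cong: measurable_cong_sets)
  also have "\<dots> = (\<integral>\<^sup>+x. ennreal (cmod (rep G x)) \<partial>?M)"
    by (intro nn_integral_cong) simp
  also have "\<dots> = ennreal (\<integral>x. cmod (rep G x) \<partial>?M)"
    using i by (intro nn_integral_eq_integral) auto
  finally show ?thesis by (simp add: L1_space_def)
qed

text \<open>For two candidates the products with the polar density have equal integrals over all
  measurable sets, so they agree a.e. The polar density has modulus 1 and cancels.\<close>

lemma radon_nikodym_class_eqI:
  assumes m: "complex_measure B m" and G: "G \<in> vcarrier (L1_space (total_variation B m))"
    and \<nu>: "\<And>E. E \<in> sets B \<Longrightarrow> \<nu> E = complex_integral B m (\<lambda>x. indicator E x * rep G x)"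
  shows "radon_nikodym_class B m \<nu> = G"
  unfolding radon_nikodym_class_def
proof (rule the_equality)
  let ?M = "total_variation B m"
  interpret finite_measure ?M by (rule finite_measure_total_variation[OF m])
  fix H assume H: "H \<in> vcarrier (L1_space ?M) \<and>
     (\<forall>E\<in>sets B. \<nu> E = complex_integral B m (\<lambda>x. indicator E x * rep H x))"
  then have d: "has_density B \<nu> ?M (\<lambda>x. rep H x * polar_density B m x)"
    by (intro has_density_L1[OF m]) auto
  have d': "has_density B \<nu> ?M (\<lambda>x. rep G x * polar_density B m x)"
    using has_density_L1[OF m G] \<nu> by blast
  have "AE x in ?M. rep H x * polar_density B m x = rep G x * polar_density B m x"
  proof (rule density_unique_banach)
    show "integrable ?M (\<lambda>x. rep H x * polar_density B m x)" "integrable ?M (\<lambda>x. rep G x * polar_density B m x)"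
      using d d' by (simp_all add: has_density_def)
    fix A assume "A \<in> sets ?M"
    then have A: "A \<in> sets B" by simp
    have "(\<integral>x. indicator A x * (rep H x * polar_density B m x) \<partial>?M)
        = (\<integral>x. indicator A x * (rep G x * polar_density B m x) \<partial>?M)"
      using d d' A unfolding has_density_def by metis
    then show "(\<integral>x\<in>A. rep H x * polar_density B m x \<partial>?M) = (\<integral>x\<in>A. rep G x * polar_density B m x \<partial>?M)"
      by (simp add: set_lebesgue_integral_def indicator_times_eq_scaleR)
  qed
  moreover have "AE x in ?M. polar_density B m x \<noteq> 0"
    using polar_density(2)[OF m] by (intro AE_I2) fastforce
  ultimately have "AE x in ?M. rep H x = rep G x"
    by eventually_elim simp
  then have "ae_class ?M (rep H) = ae_class ?M (rep G)" by (rule ae_class_eqI)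
  then show "H = G" using L1_carrier(2) H G by metis
qed (use G \<nu> in auto)

text \<open>Measurable subsets of null sets are null, so absolute continuity of \<nu> passes to
  |\<nu>| through partitions. This gives a density of \<nu> with respect to |m|; dividing it by the
  polar density of \<open>m\<close> makes it a derivative with respect to \<open>m\<close>.\<close>

lemma radon_nikodym_complex:
  assumes m: "complex_measure B m" and \<nu>: "complex_measure B \<nu>" and ac: "abs_cont_wrt B m \<nu>"
  obtains G where "G \<in> vcarrier (L1_space (total_variation B m))"
    "\<And>E. E \<in> sets B \<Longrightarrow> \<nu> E = complex_integral B m (\<lambda>x. indicator E x * rep G x)"
proof -
  let ?M = "total_variation B m" and ?p = "polar_density B m"
  have "E \<in> null_sets (total_variation B \<nu>)" if E: "E \<in> null_sets ?M" for E
  proof -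
    have EB: "E \<in> sets B" using E by auto
    have "emeasure (total_variation B \<nu>) E \<le> 0"
      unfolding emeasure_total_variation[OF \<nu> EB]
    proof (intro SUP_least)
      fix A :: "nat \<Rightarrow> 'a set"
      assume A: "A \<in> {A. range A \<subseteq> sets B \<and> disjoint_family A \<and> (\<Union>i. A i) = E}"
      have "\<nu> (A i) = 0" for i
      proof -
        have "A i \<in> null_sets ?M"
          using A by (intro null_sets_subset[OF E]) auto
        then show ?thesis using ac by (simp add: abs_cont_wrt_def)
      qed
      then show "(\<Sum>i. ennreal (cmod (\<nu> (A i)))) \<le> 0" by simp
    qed
    then show ?thesis using EB by auto
  qed
  then have "absolutely_continuous ?M (total_variation B \<nu>)"
    by (auto simp: absolutely_continuous_def)
  from finite_Radon_Nikodym_real[OF finite_measure_total_variation[OF m]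
      finite_measure_total_variation[OF \<nu>] this]
  obtain k where k: "k \<in> borel_measurable ?M" "\<And>x. 0 \<le> k x"
      "total_variation B \<nu> = density ?M (\<lambda>x. ennreal (k x))"
    by (metis sets_total_variation)
  define q where "q x = k x *\<^sub>R polar_density B \<nu> x" for x
  have d: "has_density B \<nu> ?M q"
    unfolding q_def
    by (rule has_density_change[OF polar_density(3)[OF \<nu>] k(3) finite_measure_total_variation[OF m]])
      (use k in auto)
  then have i: "integrable ?M q" by (simp add: has_density_def)
  have pM: "?p \<in> borel_measurable ?M"
    using polar_density(1)[OF m] by (simp cong: measurable_cong_sets)
  have "integrable ?M (\<lambda>x. (1 / ?p x) * q x)"
    using polar_density(2)[OF m] pM
    by (intro integrable_bounded_times[where C=1] i) (auto simp: norm_divide)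
  then have iq: "integrable ?M (\<lambda>x. q x / ?p x)" by simp
  define G where "G = ae_class ?M (\<lambda>x. q x / ?p x)"
  have G: "G \<in> vcarrier (L1_space ?M)" unfolding G_def by (rule L1_carrierI[OF iq])
  have ae: "AE x in ?M. rep G x = q x / ?p x"
    unfolding G_def using iq by (intro rep_ae_class) auto
  have "\<nu> E = complex_integral B m (\<lambda>x. indicator E x * rep G x)" if E: "E \<in> sets B" for E
  proof -
    have "complex_integral B m (\<lambda>x. indicator E x * rep G x) = (\<integral>x. indicator E x * q x \<partial>?M)"
      unfolding complex_integral_def
    proof (rule integral_cong_AE)
      show "AE x in ?M. indicator E x * rep G x * ?p x = indicator E x * q x"
        using ae AE_space
      proof eventually_elim
        case (elim x)
        then have "?p x \<noteq> 0" using polar_density(2)[OF m, of x] by auto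
        then show ?case using elim by simp
      qed
      have [measurable]: "E \<in> sets ?M" using E by simp
      note [measurable] = L1_carrier(3)[OF G] pM
      show "(\<lambda>x. indicator E x * rep G x * ?p x) \<in> borel_measurable ?M" by measurable
      have [measurable]: "q \<in> borel_measurable ?M" using i by simp
      show "(\<lambda>x. indicator E x * q x) \<in> borel_measurable ?M" by measurable
    qed
    then show ?thesis using d E by (simp add: has_density_def)
  qed
  then show ?thesis using that G by blast
qed

section \<open>The Borel \<open>\<sigma>\<close>-algebra of a topology and regularity\<close>

lemma space_borel_of [simp]: "space (borel_of X) = topspace X"
  by (simp add: borel_of_def space_measure_of_conv)

lemma sets_borel_of: "sets (borel_of X) = sigma_sets (topspace X) {U. openin X U}"
  unfolding borel_of_def by (rule sets_measure_of) (auto dest: openin_subset)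

lemma openin_borel: "openin X U \<Longrightarrow> U \<in> sets (borel_of X)"
  unfolding sets_borel_of by auto

lemma closedin_borel:
  assumes "closedin X K" shows "K \<in> sets (borel_of X)"
proof -
  have "space (borel_of X) - (topspace X - K) \<in> sets (borel_of X)"
    using assms by (intro sets.Diff sets.top openin_borel) (auto simp: closedin_def)
  then show ?thesis using closedin_subset[OF assms] by (simp add: double_diff)
qed

lemma continuous_map_borel_measurable:
  assumes "continuous_map X euclidean f" "sets M = sets (borel_of X)"
  shows "f \<in> borel_measurable M"
proof (rule borel_measurableI)
  fix S :: "'b set" assume "open S"
  have "space M = topspace X" using sets_eq_imp_space_eq[OF assms(2)] by simp
  moreover have "openin X {x \<in> topspace X. f x \<in> S}"
    using openin_continuous_map_preimage[OF assms(1), of S] \<open>open S\<close> by simp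
  moreover have "f -` S \<inter> topspace X = {x \<in> topspace X. f x \<in> S}" by auto
  ultimately show "f -` S \<inter> space M \<in> sets M" using openin_borel assms(2) by simp
qed

text \<open>Two-sided approximation in one condition: unlike the definition of regularity by an infimum
  and a supremum, it is inherited by sums.\<close>

definition squeezable :: "'a topology \<Rightarrow> 'a measure \<Rightarrow> bool" where
  "squeezable X \<nu> \<longleftrightarrow> (\<forall>E\<in>sets (borel_of X). \<forall>e>0. \<exists>K U. closedin X K \<and> openin X U \<and>
     K \<subseteq> E \<and> E \<subseteq> U \<and> measure \<nu> (U - K) < e)"

text \<open>The closed set inside \<open>E\<close> is the complement of an open set \<open>V\<close>
  around the complement of \<open>E\<close>; then \<open>U - K\<close> is covered by
  \<open>U - E\<close> and the excess of \<open>V\<close>.\<close>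

lemma squeezableI_outer:
  assumes "finite_measure \<nu>" and s: "sets \<nu> = sets (borel_of X)"
    and outer: "\<And>E e. E \<in> sets (borel_of X) \<Longrightarrow> 0 < e \<Longrightarrow>
      \<exists>U. openin X U \<and> E \<subseteq> U \<and> measure \<nu> (U - E) < (e::real)"
  shows "squeezable X \<nu>"
  unfolding squeezable_def
proof (intro ballI allI impI)
  interpret finite_measure \<nu> by fact
  fix E e assume E: "E \<in> sets (borel_of X)" and "0 < (e::real)"
  have E': "topspace X - E \<in> sets (borel_of X)"
    using sets.compl_sets[OF E] by simp
  have Es: "E \<subseteq> topspace X" using sets.sets_into_space[OF E] by simp
  obtain U where U: "openin X U" "E \<subseteq> U" "measure \<nu> (U - E) < e / 2"
    using outer[OF E, of "e / 2"] \<open>0 < e\<close> by auto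
  obtain V where V: "openin X V" "topspace X - E \<subseteq> V" "measure \<nu> (V - (topspace X - E)) < e / 2"
    using outer[OF E', of "e / 2"] \<open>0 < e\<close> by auto
  have K: "closedin X (topspace X - V)" using V(1) by auto
  have "measure \<nu> (U - (topspace X - V)) \<le> measure \<nu> ((U - E) \<union> (V - (topspace X - E)))"
    using U V E E' Es s openin_borel[OF U(1)] openin_borel[OF V(1)] openin_subset[OF U(1)]
    by (intro finite_measure_mono) auto
  also have "\<dots> \<le> measure \<nu> (U - E) + measure \<nu> (V - (topspace X - E))"
    unfolding s[symmetric] using U V E E' s openin_borel
    by (intro measure_Un_le) (auto intro!: sets.Diff simp del: Diff_iff)
  also have "\<dots> < e" using U V by simp
  finally show "\<exists>K U. closedin X K \<and> openin X U \<and> K \<subseteq> E \<and> E \<subseteq> U \<and> measure \<nu> (U - K) < e"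
    using K U V Es by (intro exI[of _ "topspace X - V"] exI[of _ U]) auto
qed

section \<open>Riesz representation of positive functionals\<close>

definition nonneg_on :: "'a topology \<Rightarrow> ('a \<Rightarrow> real) \<Rightarrow> bool" where
  "nonneg_on X f \<longleftrightarrow> continuous_map X euclideanreal f \<and> (\<forall>x\<in>topspace X. 0 \<le> f x)"

lemma compact_space_nonneg_bounded:
  assumes "compact_space X" "continuous_map X euclideanreal f"
  obtains M where "0 < M" "\<And>x. x \<in> topspace X \<Longrightarrow> \<bar>f x\<bar> \<le> M"
proof -
  have "compactin euclideanreal (f ` topspace X)"
    using assms by (intro image_compactin) (auto simp: compact_space_def)
  then have "bounded (f ` topspace X)" by (simp add: compact_imp_bounded)
  then show ?thesis using that by (auto simp: bounded_pos)
qed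

lemma Urysohn_indicator:
  assumes "compact_space X" "Hausdorff_space X" "closedin X K" "openin X U" "K \<subseteq> U"
  obtains g where "nonneg_on X g" "\<And>x. x \<in> topspace X \<Longrightarrow> g x \<le> indicator U x" "\<And>x. x \<in> K \<Longrightarrow> g x = 1"
proof -
  have "normal_space X"
    using assms(1,2) compact_Hausdorff_or_regular_imp_normal_space by blast
  moreover have "closedin X (topspace X - U)" "disjnt (topspace X - U) K"
    using assms(3-5) by (auto simp: disjnt_def)
  ultimately obtain g :: "'a \<Rightarrow> real" where g: "continuous_map X (top_of_set {0..1}) g"
      "g ` (topspace X - U) \<subseteq> {0}" "g ` K \<subseteq> {1}"
    using Urysohn_lemma[of X "topspace X - U" K 0 1] assms(3) zero_le_one by metis
  then have c: "continuous_map X euclideanreal g" "\<And>x. x \<in> topspace X \<Longrightarrow> 0 \<le> g x \<and> g x \<le> 1"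
    by (auto simp: continuous_map_in_subtopology)
  show ?thesis
  proof (rule that)
    show "nonneg_on X g" using c by (simp add: nonneg_on_def)
    show "g x \<le> indicator U x" if "x \<in> topspace X" for x
      using c g(2) that by (auto simp: indicator_def)
    show "g x = 1" if "x \<in> K" for x using g(3) that by blast
  qed
qed

text \<open>Linearity is asked on the cone of nonnegative functions only. The intended instance is
  the positive part of a bounded functional, which is a supremum over minorants and has its meaning
  there.\<close>

locale cone_functional =
  fixes X :: "'a topology" and L :: "('a \<Rightarrow> real) \<Rightarrow> real"
  assumes compact: "compact_space X" and Hausdorff: "Hausdorff_space X"
    and nonneg: "nonneg_on X f \<Longrightarrow> 0 \<le> L f"
    and add: "nonneg_on X f \<Longrightarrow> nonneg_on X g \<Longrightarrow> L (\<lambda>x. f x + g x) = L f + L g"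
    and scale: "nonneg_on X f \<Longrightarrow> 0 \<le> c \<Longrightarrow> L (\<lambda>x. c * f x) = c * L f"
begin

lemma nonneg_on_const: "0 \<le> c \<Longrightarrow> nonneg_on X (\<lambda>x. c)"
  by (simp add: nonneg_on_def)

lemma nonneg_on_add: "nonneg_on X f \<Longrightarrow> nonneg_on X g \<Longrightarrow> nonneg_on X (\<lambda>x. f x + g x)"
  by (auto simp: nonneg_on_def intro!: continuous_intros)

lemma nonneg_on_mult: "nonneg_on X f \<Longrightarrow> nonneg_on X g \<Longrightarrow> nonneg_on X (\<lambda>x. f x * g x)"
  by (auto simp: nonneg_on_def intro!: continuous_intros)

lemma mono:
  assumes "nonneg_on X f" "nonneg_on X g" "\<And>x. x \<in> topspace X \<Longrightarrow> f x \<le> g x"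
  shows "L f \<le> L g"
proof -
  have n: "nonneg_on X (\<lambda>x. g x - f x)"
    using assms by (auto simp: nonneg_on_def intro!: continuous_intros)
  have "L (\<lambda>x. f x + (g x - f x)) = L f + L (\<lambda>x. g x - f x)"
    by (rule add[OF assms(1) n])
  then show ?thesis using nonneg[OF n] by simp
qed

lemma L_zero: "L (\<lambda>x. 0) = 0"
  using scale[OF nonneg_on_const[of 0], of 0] by simp

lemma L_sum:
  assumes "finite I" "\<And>i. i \<in> I \<Longrightarrow> nonneg_on X (f i)"
  shows "nonneg_on X (\<lambda>x. \<Sum>i\<in>I. f i x) \<and> L (\<lambda>x. \<Sum>i\<in>I. f i x) = (\<Sum>i\<in>I. L (f i))"
  using assms
proof (induction I rule: finite_induct)
  case empty
  then show ?case by (simp add: L_zero nonneg_on_const)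
next
  case (insert i I)
  then show ?case using nonneg_on_add[of "f i"] add[of "f i" "\<lambda>x. \<Sum>i\<in>I. f i x"] by simp
qed

section \<open>The content of open sets\<close>

text \<open>No support condition: such an \<open>f\<close> vanishes off \<open>U\<close>, but its
  support may reach the boundary. \<open>content_add_le\<close> provides closed sets inside
  \<open>U\<close> where compactness or separation calls for them.\<close>

definition below :: "'a set \<Rightarrow> ('a \<Rightarrow> real) set" where
  "below U = {f. nonneg_on X f \<and> (\<forall>x\<in>topspace X. f x \<le> indicator U x)}"

definition content :: "'a set \<Rightarrow> ennreal" where
  "content U = (SUP f\<in>below U. ennreal (L f))"

lemma zero_below: "(\<lambda>x. 0) \<in> below U"
  by (simp add: below_def nonneg_on_const)

lemma content_upper: "f \<in> below U \<Longrightarrow> ennreal (L f) \<le> content U"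
  unfolding content_def by (rule SUP_upper)

lemma content_mono:
  assumes "U \<subseteq> V" shows "content U \<le> content V"
proof -
  have "indicat_real U x \<le> indicator V x" for x
    using assms by (auto simp: indicator_def)
  then have "below U \<subseteq> below V"
    unfolding below_def using order_trans by blast
  then show ?thesis
    unfolding content_def by (rule SUP_subset_mono) simp
qed

lemma content_finite: "content U \<le> ennreal (L (\<lambda>x. 1))"
  unfolding content_def
proof (intro SUP_least ennreal_leI)
  fix f assume "f \<in> below U"
  then show "L f \<le> L (\<lambda>x. 1)"
    using indicator_le_1 order_trans by (intro mono nonneg_on_const) (fastforce simp: below_def)+
qed

lemma content_empty: "content {} = 0"
proof -
  have "L f = 0" if "f \<in> below {}" for f
    using mono[of f "\<lambda>x. 0"] nonneg[of f] that by (auto simp: below_def nonneg_on_const L_zero)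
  then show ?thesis unfolding content_def by (intro antisym SUP_least) auto
qed

text \<open>Cutting \<open>f\<close> down to \<open>max 0 (f - \<epsilon>)\<close> changes \<open>L f\<close> by at most \<open>\<epsilon> L 1\<close>, so only functions with
  closed support inside \<open>U\<close> matter.\<close>

lemma content_add_le:
  assumes le: "\<And>f K. f \<in> below U \<Longrightarrow> closedin X K \<Longrightarrow> K \<subseteq> U \<Longrightarrow>
    (\<And>x. x \<in> topspace X \<Longrightarrow> x \<notin> K \<Longrightarrow> f x = 0) \<Longrightarrow> ennreal (L f) + d \<le> c"
  shows "content U + d \<le> c"
proof -
  have "ennreal (L f) + d \<le> c" if f: "f \<in> below U" for f
  proof (rule ennreal_le_epsilon)
    fix e :: real assume "0 < e"
    have fn: "nonneg_on X f" using f by (simp add: below_def)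
    have L1: "0 \<le> L (\<lambda>x. 1)" by (intro nonneg nonneg_on_const) simp
    define r where "r = e / (L (\<lambda>x. 1) + 1)"
    have r: "0 < r" "r * L (\<lambda>x. 1) \<le> e"
      using \<open>0 < e\<close> L1 by (auto simp: r_def field_simps)
    define g where "g x = max 0 (f x - r)" for x
    define K where "K = {x \<in> topspace X. f x \<in> {r..}}"
    have g: "nonneg_on X g"
      using fn unfolding nonneg_on_def g_def by (auto intro!: continuous_intros)
    have gU: "g \<in> below U"
      using f r g by (auto simp: below_def g_def)
    have "closedin X K"
      unfolding K_def using fn by (intro closedin_continuous_map_preimage) (auto simp: nonneg_on_def)
    moreover have "K \<subseteq> U"
    proof
      fix x assume x: "x \<in> K"
      then have "0 < indicat_real U x" using f r by (fastforce simp: K_def below_def)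
      then show "x \<in> U" by (simp add: indicator_def split: if_splits)
    qed
    moreover have "g x = 0" if "x \<in> topspace X" "x \<notin> K" for x
      using that by (auto simp: K_def g_def)
    ultimately have "ennreal (L g) + d \<le> c" using le gU by blast
    have "L f \<le> L (\<lambda>x. g x + r)"
      using r by (intro mono fn nonneg_on_add g nonneg_on_const) (auto simp: g_def)
    also have "\<dots> = L g + r * L (\<lambda>x. 1)"
      using add[OF g nonneg_on_const[of r]] scale[OF nonneg_on_const[of 1], of r] r by simp
    also have "\<dots> \<le> L g + e" using r by simp
    finally have "ennreal (L f) \<le> ennreal (L g) + ennreal e"
      using nonneg[OF g] \<open>0 < e\<close> by (simp add: ennreal_plus[symmetric] ennreal_leI del: ennreal_plus)
    then have "ennreal (L f) + d \<le> (ennreal (L g) + ennreal e) + d" by (rule add_right_mono)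
    also have "\<dots> = (ennreal (L g) + d) + ennreal e" by (simp add: ac_simps)
    also have "\<dots> \<le> c + ennreal e" using \<open>ennreal (L g) + d \<le> c\<close> by (rule add_right_mono)
    finally show "ennreal (L f) + d \<le> c + ennreal e" .
  qed
  moreover have "content U + d = (SUP f\<in>below U. ennreal (L f) + d)"
    unfolding content_def using zero_below by (intro ennreal_SUP_add_left[symmetric]) auto
  ultimately show ?thesis by (auto intro!: SUP_least)
qed

text \<open>\<open>K - V\<close> is closed and contained in \<open>U\<close>, so a Urysohn function
  \<open>g\<close> below \<open>U\<close> equals 1 on it. In f = f g + f (1 - g) the first term
  lives in \<open>U\<close>; the second vanishes off \<open>V\<close>, since off \<open>V\<close>
  either f = 0 or g = 1.\<close>

lemma content_Un:
  assumes U: "openin X U" and V: "openin X V"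
  shows "content (U \<union> V) \<le> content U + content V"
proof -
  have "content (U \<union> V) + 0 \<le> content U + content V"
  proof (rule content_add_le)
    fix f K assume f: "f \<in> below (U \<union> V)" and K: "closedin X K" "K \<subseteq> U \<union> V"
      and f0: "\<And>x. x \<in> topspace X \<Longrightarrow> x \<notin> K \<Longrightarrow> f x = 0"
    have "closedin X (K - V)" using K(1) V by (rule closedin_diff)
    then obtain g where g: "g \<in> below U" "\<And>x. x \<in> K - V \<Longrightarrow> g x = 1"
    proof (rule Urysohn_indicator[OF compact Hausdorff _ U])
      show "K - V \<subseteq> U" using K(2) by blast
    qed (auto simp: below_def)
    have gn: "nonneg_on X g" and g1: "\<And>x. x \<in> topspace X \<Longrightarrow> g x \<le> indicator U x"
      using g by (auto simp: below_def)
    have fn: "nonneg_on X f" and f1: "\<And>x. x \<in> topspace X \<Longrightarrow> f x \<le> 1"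
      using f by (auto simp: below_def) (meson indicator_le_1 order_trans)
    have g1': "g x \<le> 1" if "x \<in> topspace X" for x
      using g1[OF that] indicator_le_1 order_trans by metis
    have g': "nonneg_on X (\<lambda>x. 1 - g x)"
      using gn g1' by (auto simp: nonneg_on_def intro!: continuous_intros)
    have "(\<lambda>x. f x * g x) \<in> below U"
      unfolding below_def mem_Collect_eq
    proof (intro conjI ballI nonneg_on_mult fn gn)
      fix x assume x: "x \<in> topspace X"
      have "f x * g x \<le> 1 * g x"
        using f1[OF x] gn x by (intro mult_right_mono) (auto simp: nonneg_on_def)
      then show "f x * g x \<le> indicator U x" using g1[OF x] by simp
    qed
    moreover have "(\<lambda>x. f x * (1 - g x)) \<in> below V"
      unfolding below_def mem_Collect_eq
    proof (intro conjI ballI nonneg_on_mult fn g')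
      fix x assume x: "x \<in> topspace X"
      show "f x * (1 - g x) \<le> indicator V x"
      proof (cases "x \<in> V")
        case True
        have "f x * (1 - g x) \<le> 1 * 1"
          using f1[OF x] gn g' fn x by (intro mult_mono) (auto simp: nonneg_on_def)
        then show ?thesis using True by simp
      next
        case False
        then show ?thesis using f0[OF x] g(2)[of x] by (cases "x \<in> K") auto
      qed
    qed
    moreover have "L f = L (\<lambda>x. f x * g x) + L (\<lambda>x. f x * (1 - g x))"
      using add[OF nonneg_on_mult[OF fn gn] nonneg_on_mult[OF fn g']] by (simp add: algebra_simps)
    ultimately show "ennreal (L f) + 0 \<le> content U + content V"
      using content_upper nonneg[OF nonneg_on_mult[OF fn gn]] nonneg[OF nonneg_on_mult[OF fn g']]
      by (auto simp: ennreal_plus intro!: add_mono)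
  qed
  then show ?thesis by simp
qed

lemma content_UN_finite:
  assumes "\<And>i::nat. openin X (U i)"
  shows "content (\<Union>i<n. U i) \<le> (\<Sum>i<n. content (U i))"
proof (induction n)
  case (Suc n)
  have "(\<Union>i<Suc n. U i) = (\<Union>i<n. U i) \<union> U n" by (auto simp: less_Suc_eq)
  then have "content (\<Union>i<Suc n. U i) \<le> content (\<Union>i<n. U i) + content (U n)"
    using content_Un[of "\<Union>i<n. U i" "U n"] assms by (auto intro!: openin_Union)
  also have "\<dots> \<le> (\<Sum>i<Suc n. content (U i))" using Suc by (simp add: add_right_mono)
  finally show ?case .
qed (simp add: content_empty)

text \<open>\<open>f\<close> vanishes off a compact \<open>K\<close>, which finitely many
  \<open>U i\<close> cover, so \<open>f\<close> already lies below a finite union.\<close>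

lemma content_UN:
  assumes U: "\<And>i::nat. openin X (U i)"
  shows "content (\<Union>i. U i) \<le> (\<Sum>i. content (U i))"
proof -
  have "content (\<Union>i. U i) + 0 \<le> (\<Sum>i. content (U i))"
  proof (rule content_add_le)
    fix f K assume f: "f \<in> below (\<Union>i. U i)" and K: "closedin X K" "K \<subseteq> (\<Union>i. U i)"
      and f0: "\<And>x. x \<in> topspace X \<Longrightarrow> x \<notin> K \<Longrightarrow> f x = 0"
    obtain F where F: "finite F" "F \<subseteq> range U" "K \<subseteq> \<Union>F"
      using compactinD[OF closedin_compact_space[OF compact K(1)], of "range U"] U K(2) by auto
    then obtain I where I: "finite I" "F = U ` I" by (meson finite_subset_image)
    then obtain n where "I \<subseteq> {..<n}" using finite_nat_bounded by blast
    then have Kn: "K \<subseteq> (\<Union>i<n. U i)" using F I by blast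
    have "f \<in> below (\<Union>i<n. U i)"
      unfolding below_def mem_Collect_eq
    proof (intro conjI ballI)
      show "nonneg_on X f" using f by (simp add: below_def)
      fix x assume x: "x \<in> topspace X"
      show "f x \<le> indicator (\<Union>i<n. U i) x"
      proof (cases "x \<in> K")
        case True
        then have "x \<in> (\<Union>i<n. U i)" using Kn by blast
        moreover have "f x \<le> 1" using f x by (auto simp: below_def) (meson indicator_le_1 order_trans)
        ultimately show ?thesis by simp
      next
        case False
        then show ?thesis using f0[OF x] by simp
      qed
    qed
    then have "ennreal (L f) \<le> content (\<Union>i<n. U i)" by (rule content_upper)
    also have "\<dots> \<le> (\<Sum>i<n. content (U i))" by (rule content_UN_finite[OF U])
    also have "\<dots> \<le> (\<Sum>i. content (U i))" by (intro sum_le_suminf) auto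
    finally show "ennreal (L f) + 0 \<le> (\<Sum>i. content (U i))" by simp
  qed
  then show ?thesis by simp
qed

section \<open>The outer measure and its restriction to Borel sets\<close>

text \<open>For \<open>E\<close> not inside \<open>topspace X\<close> no open superset exists and
  the infimum is the top element, so the outer measure axioms are stated on
  \<open>Pow (topspace X)\<close>.\<close>

definition outer :: "'a set \<Rightarrow> ennreal" where
  "outer E = (INF U\<in>{U. openin X U \<and> E \<subseteq> U}. content U)"

lemma outer_open: "openin X U \<Longrightarrow> outer U = content U"
  unfolding outer_def by (intro antisym INF_lower INF_greatest content_mono) auto

lemma outer_le: "openin X U \<Longrightarrow> E \<subseteq> U \<Longrightarrow> outer E \<le> content U"
  unfolding outer_def by (intro INF_lower) auto

lemma outer_mono: "E \<subseteq> F \<Longrightarrow> outer E \<le> outer F"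
  unfolding outer_def by (intro INF_superset_mono) auto

lemma outer_approx:
  assumes "E \<subseteq> topspace X" "0 < (e::real)"
  obtains U where "openin X U" "E \<subseteq> U" "content U \<le> outer E + ennreal e"
proof -
  have "outer E \<le> content (topspace X)" using assms(1) by (intro outer_le) auto
  also have "\<dots> \<le> ennreal (L (\<lambda>x. 1))" by (rule content_finite)
  also have "\<dots> < top" by simp
  finally have "outer E < top" .
  then have "outer E < outer E + ennreal e"
    using assms(2) by auto
  then obtain U where "openin X U" "E \<subseteq> U" "content U < outer E + ennreal e"
    unfolding outer_def by (auto simp: INF_less_iff)
  then show ?thesis using that by auto
qed

lemma outer_countably_subadditive: "countably_subadditive (Pow (topspace X)) outer"
  unfolding countably_subadditive_def
proof (intro allI impI)
  fix A :: "nat \<Rightarrow> 'a set"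
  assume A: "range A \<subseteq> Pow (topspace X)"
  show "outer (\<Union>i. A i) \<le> (\<Sum>i. outer (A i))"
  proof (rule ennreal_le_epsilon)
    fix e :: real assume "0 < e"
    have "\<exists>U. openin X U \<and> A i \<subseteq> U \<and> content U \<le> outer (A i) + ennreal (e * (1/2) ^ Suc i)" for i
    proof -
      have "A i \<subseteq> topspace X" "0 < e * (1/2) ^ Suc i" using A \<open>0 < e\<close> by auto
      then show ?thesis using outer_approx by metis
    qed
    then obtain U where U: "\<And>i. openin X (U i)" "\<And>i. A i \<subseteq> U i"
        "\<And>i. content (U i) \<le> outer (A i) + ennreal (e * (1/2) ^ Suc i)" by metis
    have "outer (\<Union>i. A i) \<le> content (\<Union>i. U i)"
      using U by (intro outer_le openin_Union) auto
    also have "\<dots> \<le> (\<Sum>i. content (U i))" by (rule content_UN[OF U(1)])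
    also have "\<dots> \<le> (\<Sum>i. outer (A i) + ennreal e * ennreal ((1/2) ^ Suc i))"
      using U(3) \<open>0 < e\<close> by (intro suminf_le) (auto simp: ennreal_mult[symmetric])
    also have "\<dots> = (\<Sum>i. outer (A i)) + (\<Sum>i. ennreal e * ennreal ((1/2) ^ Suc i))"
      by (subst suminf_add[symmetric]) auto
    also have "(\<Sum>i. ennreal e * ennreal ((1/2) ^ Suc i)) = ennreal e"
      unfolding ennreal_suminf_cmult
      by (subst suminf_ennreal_eq[OF zero_le_power power_half_series]) auto
    finally show "outer (\<Union>i. A i) \<le> (\<Sum>i. outer (A i)) + ennreal e" .
  qed
qed

lemma outer_measure_space_outer: "outer_measure_space (Pow (topspace X)) outer"
  unfolding outer_measure_space_def
  using outer_countably_subadditive outer_mono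
  by (auto simp: positive_def increasing_def outer_open content_empty)

text \<open>Given open \<open>U\<close> around \<open>E\<close>, take \<open>f\<close> below
  \<open>V \<inter> U\<close> vanishing off a closed \<open>K\<close> inside it, and
  \<open>g\<close> below \<open>U - K\<close>. At each point one of them is 0, so f + g is below
  \<open>U\<close>, while \<open>U - K\<close> is an open set containing \<open>U - V\<close>.
  Taking suprema and then the infimum over \<open>U\<close> gives the nontrivial inequality.\<close>

lemma open_in_lambda_system:
  assumes V: "openin X V"
  shows "V \<in> lambda_system (topspace X) (Pow (topspace X)) outer"
  unfolding lambda_system_def
proof (intro CollectI conjI ballI)
  show "V \<in> Pow (topspace X)" using openin_subset[OF V] by simp
  fix E assume E: "E \<in> Pow (topspace X)"
  have le: "outer (V \<inter> E) + outer ((topspace X - V) \<inter> E) \<le> content U" if U: "openin X U" "E \<subseteq> U" for U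
  proof -
    have "content (V \<inter> U) + outer ((topspace X - V) \<inter> U) \<le> content U"
    proof (rule content_add_le)
      fix f K assume f: "f \<in> below (V \<inter> U)" and K: "closedin X K" "K \<subseteq> V \<inter> U"
        and f0: "\<And>x. x \<in> topspace X \<Longrightarrow> x \<notin> K \<Longrightarrow> f x = 0"
      have "openin X (U - K)" using U(1) K(1) by (rule openin_diff)
      then have "ennreal (L f) + outer ((topspace X - V) \<inter> U) \<le> ennreal (L f) + content (U - K)"
        using K by (intro add_left_mono outer_le) auto
      also have "\<dots> = (SUP g\<in>below (U - K). ennreal (L f) + ennreal (L g))"
        unfolding content_def using zero_below by (intro ennreal_SUP_add_right) auto
      also have "\<dots> \<le> content U"
      proof (rule SUP_least)
        fix g assume g: "g \<in> below (U - K)"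
        have fg: "nonneg_on X f" "nonneg_on X g" using f g by (auto simp: below_def)
        have "(\<lambda>x. f x + g x) \<in> below U"
          unfolding below_def mem_Collect_eq
        proof (intro conjI ballI nonneg_on_add fg)
          fix x assume x: "x \<in> topspace X"
          have b: "f x \<le> indicator (V \<inter> U) x" "g x \<le> indicator (U - K) x"
            using f g x by (auto simp: below_def)
          show "f x + g x \<le> indicator U x"
          proof (cases "x \<in> K")
            case True
            then show ?thesis using b K by (auto simp: indicator_def split: if_splits)
          next
            case False
            then show ?thesis using b f0[OF x] by (auto simp: indicator_def split: if_splits)
          qed
        qed
        then have "ennreal (L (\<lambda>x. f x + g x)) \<le> content U" by (rule content_upper)
        then show "ennreal (L f) + ennreal (L g) \<le> content U"
          using add[OF fg] nonneg fg by (simp add: ennreal_plus)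
      qed
      finally show "ennreal (L f) + outer ((topspace X - V) \<inter> U) \<le> content U" .
    qed
    moreover have "outer (V \<inter> E) \<le> content (V \<inter> U)"
      using U V by (intro outer_le openin_Int) auto
    moreover have "outer ((topspace X - V) \<inter> E) \<le> outer ((topspace X - V) \<inter> U)"
      using U by (intro outer_mono) auto
    ultimately show ?thesis by (meson add_mono order_trans)
  qed
  show "outer (V \<inter> E) + outer ((topspace X - V) \<inter> E) = outer E"
  proof (rule antisym)
    show "outer (V \<inter> E) + outer ((topspace X - V) \<inter> E) \<le> outer E"
      unfolding outer_def[of E] using le by (intro INF_greatest) auto
    interpret sigma_algebra "topspace X" "Pow (topspace X)" by (rule sigma_algebra_Pow)
    have "subadditive (Pow (topspace X)) outer"
      using outer_measure_space_outer
      by (intro countably_subadditive_subadditive) (auto simp: outer_measure_space_def)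
    then have "outer ((V \<inter> E) \<union> ((topspace X - V) \<inter> E)) \<le> outer (V \<inter> E) + outer ((topspace X - V) \<inter> E)"
      using E by (intro subadditiveD) auto
    moreover have "(V \<inter> E) \<union> ((topspace X - V) \<inter> E) = E" using E by auto
    ultimately show "outer E \<le> outer (V \<inter> E) + outer ((topspace X - V) \<inter> E)" by simp
  qed
qed

definition riesz :: "'a measure" where
  "riesz = measure_of (topspace X) (sets (borel_of X)) outer"

lemma sets_riesz [simp]: "sets riesz = sets (borel_of X)"
  and space_riesz [simp]: "space riesz = topspace X"
  using sets.sigma_sets_eq[of "borel_of X"] sets.space_closed[of "borel_of X"]
  by (simp_all add: riesz_def)

text \<open>The sets that split \<open>outer\<close> additively form a \<sigma>-algebra on which it
  is a measure; open sets belong to it, hence all Borel sets.\<close>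

lemma emeasure_riesz:
  assumes "E \<in> sets (borel_of X)" shows "emeasure riesz E = outer E"
proof -
  interpret P: sigma_algebra "topspace X" "Pow (topspace X)" by (rule sigma_algebra_Pow)
  let ?S = "lambda_system (topspace X) (Pow (topspace X)) outer"
  have ms: "measure_space (topspace X) ?S outer"
    by (rule P.caratheodory_lemma[OF outer_measure_space_outer])
  then interpret S: sigma_algebra "topspace X" ?S by (simp add: measure_space_def)
  have sub: "sets (borel_of X) \<subseteq> ?S"
    unfolding sets_borel_of by (rule S.sigma_sets_subset) (auto intro: open_in_lambda_system)
  have "sigma_algebra (topspace X) (sets (borel_of X))"
    using sets.sigma_algebra_axioms[of "borel_of X"] by simp
  then have "measure_space (topspace X) (sets (borel_of X)) outer"
    using measure_down[OF ms] sub by blast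
  then show ?thesis
    using assms sets.space_closed[of "borel_of X"]
    by (intro emeasure_measure_of[OF riesz_def]) (auto simp: measure_space_def)
qed

lemma finite_measure_riesz: "finite_measure riesz"
proof
  have "emeasure riesz (topspace X) \<le> ennreal (L (\<lambda>x. 1))"
    by (simp add: emeasure_riesz openin_borel outer_open content_finite)
  then show "emeasure riesz (space riesz) \<noteq> \<infinity>" by (auto simp: top_unique)
qed

lemma measure_riesz_space: "measure riesz (topspace X) \<le> L (\<lambda>x. 1)"
proof -
  have "emeasure riesz (topspace X) \<le> ennreal (L (\<lambda>x. 1))"
    by (simp add: emeasure_riesz openin_borel outer_open content_finite)
  then show ?thesis
    using nonneg[OF nonneg_on_const[of 1]] finite_measure.emeasure_eq_measure[OF finite_measure_riesz]
    by simp
qed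

lemma squeezable_riesz: "squeezable X riesz"
proof (rule squeezableI_outer[OF finite_measure_riesz])
  interpret finite_measure riesz by (rule finite_measure_riesz)
  fix E e assume E: "E \<in> sets (borel_of X)" and "0 < (e::real)"
  have "E \<subseteq> topspace X" using sets.sets_into_space[OF E] by simp
  then obtain U where U: "openin X U" "E \<subseteq> U" "content U \<le> outer E + ennreal (e / 2)"
    using outer_approx[of E "e / 2"] \<open>0 < e\<close> by auto
  have "emeasure riesz U \<le> emeasure riesz E + ennreal (e / 2)"
    using U E by (simp add: emeasure_riesz openin_borel outer_open)
  then have "measure riesz U \<le> measure riesz E + e / 2"
    using \<open>0 < e\<close> by (simp add: emeasure_eq_measure ennreal_plus[symmetric] del: ennreal_plus)
  moreover have "measure riesz (U - E) = measure riesz U - measure riesz E"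
    using U E openin_borel[OF U(1)] by (intro finite_measure_Diff) auto
  ultimately show "\<exists>U. openin X U \<and> E \<subseteq> U \<and> measure riesz (U - E) < e"
    using U \<open>0 < e\<close> by (intro exI[of _ U]) auto
qed simp

section \<open>The representation formula by layer cakes\<close>

lemma sum_clamp:
  "0 \<le> (y::real) \<Longrightarrow> (\<Sum>k<n. min 1 (max 0 (y - real k))) = min y (real n)"
  by (induction n) (auto simp: min_def max_def)

text \<open>Layer cake: \<open>n f\<close> is the sum of the functions \<open>min 1 (max 0 (n f - k))\<close>, each of which lies
  between the indicators of \<open>{n f > k + 1}\<close> and \<open>{n f > k}\<close>. Both \<open>L\<close> and the integral are
  therefore determined up to \<open>\<nu>(X) / n\<close>.\<close>

lemma layer_estimate:
  assumes J: "cone_functional X J"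
    and up: "\<And>U f. openin X U \<Longrightarrow> f \<in> below U \<Longrightarrow> J f \<le> measure riesz U"
    and low: "\<And>U f. openin X U \<Longrightarrow> nonneg_on X f \<Longrightarrow> (\<And>x. x \<in> topspace X \<Longrightarrow> indicator U x \<le> f x) \<Longrightarrow>
      measure riesz U \<le> J f"
    and f: "nonneg_on X f" "\<And>x. x \<in> topspace X \<Longrightarrow> f x \<le> 1" and "0 < n"
  shows "\<bar>real n * J f - (\<Sum>k<n. measure riesz {x \<in> topspace X. real k < real n * f x})\<bar>
    \<le> measure riesz (topspace X)"
proof -
  interpret J: cone_functional X J by fact
  interpret finite_measure riesz by (rule finite_measure_riesz)
  define a where "a k = measure riesz {x \<in> topspace X. real k < real n * f x}" for k
  define g where "g k x = min 1 (max 0 (real n * f x - real k))" for k x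
  have c: "continuous_map X euclideanreal (\<lambda>x. real n * f x)"
    using f by (auto simp: nonneg_on_def intro!: continuous_intros)
  have g: "nonneg_on X (g k)" for k
    using c unfolding nonneg_on_def g_def by (auto intro!: continuous_intros)
  have o: "openin X {x \<in> topspace X. real k < real n * f x}" for k
    using openin_continuous_map_preimage[OF c, of "{real k<..}"] by simp
  have upper: "J (g k) \<le> a k" for k
    unfolding a_def using g by (intro up o) (auto simp: below_def g_def indicator_def)
  have lower: "a (Suc k) \<le> J (g k)" for k
    unfolding a_def using g by (intro low o) (auto simp: g_def indicator_def)
  have gn: "nonneg_on X (\<lambda>x. \<Sum>k<n. g k x)" and Jg: "J (\<lambda>x. \<Sum>k<n. g k x) = (\<Sum>k<n. J (g k))"
    using J.L_sum[of "{..<n}" g] g by auto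
  have eq: "(\<Sum>k<n. g k x) = real n * f x" if x: "x \<in> topspace X" for x
  proof -
    have "(\<Sum>k<n. g k x) = min (real n * f x) (real n)"
      unfolding g_def using f x by (intro sum_clamp) (auto simp: nonneg_on_def)
    moreover have "real n * f x \<le> real n" using f(2)[OF x] by (simp add: mult_left_le)
    ultimately show ?thesis by simp
  qed
  have nf: "nonneg_on X (\<lambda>x. real n * f x)" using f c by (auto simp: nonneg_on_def)
  have "J (\<lambda>x. \<Sum>k<n. g k x) = J (\<lambda>x. real n * f x)"
    using gn nf eq by (intro antisym J.mono) auto
  then have J_eq: "real n * J f = (\<Sum>k<n. J (g k))"
    using J.scale[OF f(1), of "real n"] Jg by simp
  \<comment> \<open>The upper and lower layer sums are shifts of each other, so their gap telescopes
    to two end terms and does not grow with \<open>n\<close>.\<close>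
  have tele: "(\<Sum>k<n. a k) - (\<Sum>k<n. a (Suc k)) = a 0 - a n"
    by (simp add: sum_subtractf[symmetric] sum_lessThan_telescope')
  have "(\<Sum>k<n. a (Suc k)) \<le> real n * J f" "real n * J f \<le> (\<Sum>k<n. a k)"
    unfolding J_eq using upper lower by (auto intro: sum_mono)
  moreover have "a 0 \<le> measure riesz (topspace X)"
    unfolding a_def using o openin_borel by (intro finite_measure_mono) auto
  moreover have "0 \<le> a n" by (simp add: a_def)
  ultimately show ?thesis unfolding a_def[symmetric] using tele by linarith
qed

lemma integrable_riesz:
  assumes "nonneg_on X f" shows "integrable riesz f"
proof -
  interpret finite_measure riesz by (rule finite_measure_riesz)
  obtain M where "\<And>x. x \<in> topspace X \<Longrightarrow> \<bar>f x\<bar> \<le> M"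
    using compact_space_nonneg_bounded[OF compact] assms unfolding nonneg_on_def by metis
  then show ?thesis
    using assms by (intro integrable_const_bound[of _ M])
      (auto simp: nonneg_on_def intro!: continuous_map_borel_measurable AE_I2)
qed

text \<open>Allows \<open>layer_estimate\<close> to be applied to the integral as well as to
  \<open>L\<close>.\<close>

lemma cone_functional_integral: "cone_functional X (\<lambda>f. \<integral>x. f x \<partial>riesz)"
  using compact Hausdorff integrable_riesz
  by unfold_locales (auto simp: nonneg_on_def intro!: Bochner_Integration.integral_nonneg)

theorem riesz_representation:
  assumes f: "nonneg_on X f"
  shows "L f = (\<integral>x. f x \<partial>riesz)"
proof -
  interpret finite_measure riesz by (rule finite_measure_riesz)
  let ?I = "\<lambda>f. \<integral>x. f x \<partial>riesz"
  have bound1: "L f = ?I f" if f: "nonneg_on X f" and f1: "\<And>x. x \<in> topspace X \<Longrightarrow> f x \<le> 1" for f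
  proof -
    have openm: "ennreal (measure riesz U) = content U" if "openin X U" for U
      using that by (simp add: emeasure_eq_measure[symmetric] emeasure_riesz openin_borel outer_open)
    have L: "\<bar>real n * L f - (\<Sum>k<n. measure riesz {x \<in> topspace X. real k < real n * f x})\<bar>
        \<le> measure riesz (topspace X)" if "0 < n" for n
    proof (rule layer_estimate[OF cone_functional_axioms _ _ f f1 that])
      fix U g assume U: "openin X U" and g: "g \<in> below U"
      then show "L g \<le> measure riesz U"
        using content_upper[OF g] openm[OF U] by (metis ennreal_le_iff measure_nonneg)
    next
      fix U g assume U: "openin X U" and g: "nonneg_on X g" "\<And>x. x \<in> topspace X \<Longrightarrow> indicator U x \<le> g x"
      have "content U \<le> ennreal (L g)"
        unfolding content_def using g
        by (intro SUP_least ennreal_leI mono) (auto simp: below_def intro: order_trans)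
      then show "measure riesz U \<le> L g"
        using openm[OF U] nonneg[OF g(1)] by (metis ennreal_le_iff)
    qed
    have I: "\<bar>real n * ?I f - (\<Sum>k<n. measure riesz {x \<in> topspace X. real k < real n * f x})\<bar>
        \<le> measure riesz (topspace X)" if "0 < n" for n
    proof (rule layer_estimate[OF cone_functional_integral _ _ f f1 that])
      fix U g assume U: "openin X U" and g: "g \<in> below U"
      have "?I g \<le> (\<integral>x. indicator U x \<partial>riesz)"
        using g openin_borel[OF U] by (intro integral_mono) (auto simp: below_def less_top[symmetric] intro: integrable_riesz)
      then show "?I g \<le> measure riesz U" using openin_borel[OF U] openin_subset[OF U] by (simp add: Int_absorb2)
    next
      fix U g assume U: "openin X U" and g: "nonneg_on X g" "\<And>x. x \<in> topspace X \<Longrightarrow> indicator U x \<le> g x"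
      have "(\<integral>x. indicator U x \<partial>riesz) \<le> ?I g"
        using g openin_borel[OF U] by (intro integral_mono) (auto simp: less_top[symmetric] intro: integrable_riesz)
      then show "measure riesz U \<le> ?I g" using openin_borel[OF U] openin_subset[OF U] by (simp add: Int_absorb2)
    qed
    \<comment> \<open>Both sides of the claim are within the total mass of the same layer sum; as
      the bound is independent of \<open>n\<close>, the difference is 0.\<close>
    have "real n * \<bar>L f - ?I f\<bar> \<le> 2 * measure riesz (topspace X)" for n
    proof (cases "n = 0")
      case False
      then have "\<bar>real n * L f - real n * ?I f\<bar> \<le> 2 * measure riesz (topspace X)"
        using L[of n] I[of n] by linarith
      then show ?thesis by (simp add: right_diff_distrib[symmetric] abs_mult)
    qed simp
    then have "\<bar>L f - ?I f\<bar> \<le> 0"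
      by (meson not_le reals_Archimedean3)
    then show ?thesis by simp
  qed
  obtain M where M: "0 < M" "\<And>x. x \<in> topspace X \<Longrightarrow> \<bar>f x\<bar> \<le> M"
    using compact_space_nonneg_bounded[OF compact] f unfolding nonneg_on_def by metis
  \<comment> \<open>The layers need f \<le> 1; the general case follows by rescaling.\<close>
  have n: "nonneg_on X (\<lambda>x. (1 / M) * f x)"
    using M by (intro nonneg_on_mult nonneg_on_const f) auto
  have "L (\<lambda>x. (1 / M) * f x) = ?I (\<lambda>x. (1 / M) * f x)"
    using M by (intro bound1 n) (auto simp: abs_le_iff)
  moreover have "L (\<lambda>x. (1 / M) * f x) = (1 / M) * L f" using M by (intro scale f) auto
  ultimately show ?thesis using M by simp
qed

end

section \<open>Riesz representation of complex functionals\<close>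

lemma squeezableE:
  assumes "squeezable X \<nu>" "E \<in> sets (borel_of X)" "0 < e"
  obtains K U where "closedin X K" "openin X U" "K \<subseteq> E" "E \<subseteq> U" "measure \<nu> (U - K) < e"
proof -
  have "\<exists>K U. closedin X K \<and> openin X U \<and> K \<subseteq> E \<and> E \<subseteq> U \<and> measure \<nu> (U - K) < e"
    using assms unfolding squeezable_def by blast
  then show ?thesis using that by blast
qed

text \<open>Unite the closed sets and intersect the open ones. Only an inequality links
  \<open>R\<close> to \<open>M\<close> and \<open>N\<close>, because the variation of a sum is
  merely dominated by the sum of variations.\<close>

lemma squeezable_lincomb:
  assumes M: "squeezable X M" and N: "squeezable X N"
    and fin: "finite_measure M" "finite_measure N"
    and s: "sets M = sets (borel_of X)" "sets N = sets (borel_of X)"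
    and c: "0 \<le> c" and le: "\<And>D. measure R D \<le> measure M D + c * measure N D"
  shows "squeezable X R"
  unfolding squeezable_def
proof (intro ballI allI impI)
  interpret M: finite_measure M by fact
  interpret N: finite_measure N by fact
  fix E e assume E: "E \<in> sets (borel_of X)" and "0 < (e::real)"
  define r where "r = e / (c + 1)"
  have r: "0 < r" "r + c * r = e"
  proof -
    show "0 < r" using c \<open>0 < e\<close> by (simp add: r_def)
    have "r + c * r = r * (c + 1)" by (simp add: algebra_simps)
    then show "r + c * r = e" using c by (simp add: r_def)
  qed
  obtain K1 U1 where 1: "closedin X K1" "openin X U1" "K1 \<subseteq> E" "E \<subseteq> U1" "measure M (U1 - K1) < r"
    using squeezableE[OF M E r(1)] .
  obtain K2 U2 where 2: "closedin X K2" "openin X U2" "K2 \<subseteq> E" "E \<subseteq> U2" "measure N (U2 - K2) < r"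
    using squeezableE[OF N E r(1)] .
  have b: "U1 - K1 \<in> sets M" "U2 - K2 \<in> sets N"
    unfolding s using sets.Diff[OF openin_borel[OF 1(2)] closedin_borel[OF 1(1)]]
      sets.Diff[OF openin_borel[OF 2(2)] closedin_borel[OF 2(1)]] by this
  have "measure R (U1 \<inter> U2 - (K1 \<union> K2)) \<le> measure M (U1 \<inter> U2 - (K1 \<union> K2)) + c * measure N (U1 \<inter> U2 - (K1 \<union> K2))"
    by (rule le)
  also have "\<dots> \<le> measure M (U1 - K1) + c * measure N (U2 - K2)"
    using b c by (intro add_mono mult_left_mono M.finite_measure_mono N.finite_measure_mono) auto
  also have "\<dots> < r + c * r"
    using 1 2 c by (intro add_less_le_mono mult_left_mono) auto
  finally show "\<exists>K U. closedin X K \<and> openin X U \<and> K \<subseteq> E \<and> E \<subseteq> U \<and> measure R (U - K) < e"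
    using 1 2 r by (intro exI[of _ "K1 \<union> K2"] exI[of _ "U1 \<inter> U2"]) auto
qed

text \<open>Open sets shrinking to \<open>E\<close> in \<open>M\<close>-measure leave an
  \<open>M\<close>-null, hence \<open>N\<close>-null, remainder in the limit; continuity from above
  for the finite \<open>N\<close> then makes the remainder small at a finite stage.\<close>

lemma squeezable_absolutely_continuous:
  assumes M: "squeezable X M" and fin: "finite_measure M" "finite_measure N"
    and s: "sets M = sets (borel_of X)" "sets N = sets (borel_of X)"
    and ac: "absolutely_continuous M N"
  shows "squeezable X N"
proof (rule squeezableI_outer[OF fin(2) s(2)])
  interpret M: finite_measure M by fact
  interpret N: finite_measure N by fact
  fix E e assume E: "E \<in> sets (borel_of X)" and "0 < (e::real)"
  have "\<exists>U. openin X U \<and> E \<subseteq> U \<and> measure M (U - E) < inverse (real (Suc n))" for n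
  proof -
    have "0 < inverse (real (Suc n))" by simp
    then obtain K U where KU: "closedin X K" "openin X U" "K \<subseteq> E" "E \<subseteq> U" "measure M (U - K) < inverse (real (Suc n))"
      using squeezableE[OF M E] by blast
    moreover have "measure M (U - E) \<le> measure M (U - K)"
      using KU sets.Diff[OF openin_borel[OF KU(2)] closedin_borel[OF KU(1)]] s by (intro M.finite_measure_mono) auto
    ultimately show ?thesis by force
  qed
  then obtain U where U: "\<And>n. openin X (U n)" "\<And>n. E \<subseteq> U n"
      "\<And>n. measure M (U n - E) < inverse (real (Suc n))" by metis
  \<comment> \<open>Intersecting makes the open sets decrease, as continuity from above requires;
    finite intersections stay open.\<close>
  define V where "V n = (\<Inter>i\<le>n. U i)" for n
  have Vo: "openin X (V n)" for n unfolding V_def using U(1) by (intro openin_Inter) auto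
  have VB: "V n \<in> sets (borel_of X)" for n using Vo openin_borel by blast
  have EV: "E \<subseteq> V n" for n using U(2) by (auto simp: V_def)
  define D where "D = (\<Inter>n. V n - E)"
  have DB: "D \<in> sets (borel_of X)" unfolding D_def using VB E by auto
  have "measure M D \<le> inverse (real (Suc n))" for n
  proof -
    have "measure M D \<le> measure M (U n - E)"
      using sets.Diff[OF openin_borel[OF U(1)] E, of n] s by (intro M.finite_measure_mono) (auto simp: D_def V_def)
    then show ?thesis using U(3)[of n] by linarith
  qed
  then have "measure M D \<le> 0"
    by (intro LIMSEQ_le_const[OF LIMSEQ_inverse_real_of_nat]) auto
  then have "D \<in> null_sets M"
    using DB s by (auto simp: null_sets_def M.emeasure_eq_measure measure_le_0_iff)
  then have "D \<in> null_sets N" using ac by (auto simp: absolutely_continuous_def)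
  then have "measure N D = 0" by (simp add: null_sets_def measure_def)
  moreover have "(\<lambda>n. measure N (V n - E)) \<longlonglongrightarrow> measure N D"
    unfolding D_def using VB E s
    by (intro N.finite_Lim_measure_decseq) (auto simp: decseq_def V_def)
  ultimately have "eventually (\<lambda>n. measure N (V n - E) < e) sequentially"
    using \<open>0 < e\<close> by (intro order_tendstoD(2)[where y=0]) auto
  then obtain n where "measure N (V n - E) < e" by (auto dest: eventually_happens)
  then show "\<exists>U. openin X U \<and> E \<subseteq> U \<and> measure N (U - E) < e" using Vo EV by blast
qed

text \<open>Since the variation is finite, approximation of measures and smallness of differences
  are the same. One direction gets its closed sets as complements of open ones, the other uses that
  closed sets are compact here.\<close>

lemma regular_iff_squeezable:
  assumes X: "compact_space X"
  shows "regular_complex_borel_measure X \<mu> \<longleftrightarrow>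
    complex_measure (borel_of X) \<mu> \<and> squeezable X (var_measure X \<mu>)"
proof (intro iffI conjI)
  let ?T = "var_measure X \<mu>"
  assume r: "regular_complex_borel_measure X \<mu>"
  then show \<mu>: "complex_measure (borel_of X) \<mu>" by (simp add: regular_complex_borel_measure_def)
  then interpret finite_measure ?T by (rule finite_measure_total_variation)
  show "squeezable X ?T"
  proof (rule squeezableI_outer[OF finite_measure_axioms])
    fix E e assume E: "E \<in> sets (borel_of X)" and "0 < (e::real)"
    have "(INF U\<in>{U. openin X U \<and> E \<subseteq> U}. emeasure ?T U) = emeasure ?T E"
      using r E by (simp add: regular_complex_borel_measure_def)
    also have "\<dots> < emeasure ?T E + ennreal e"
      using \<open>0 < e\<close> emeasure_finite[of E] by (auto simp: less_top)
    finally obtain U where U: "openin X U" "E \<subseteq> U" "emeasure ?T U < emeasure ?T E + ennreal e"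
      by (auto simp: INF_less_iff)
    have "measure ?T (U - E) = measure ?T U - measure ?T E"
      using U E openin_borel[OF U(1)] by (intro finite_measure_Diff) auto
    moreover have "measure ?T U < measure ?T E + e"
      using U(3) \<open>0 < e\<close>
      by (simp add: emeasure_eq_measure ennreal_plus[symmetric] ennreal_less_iff del: ennreal_plus)
    ultimately show "\<exists>U. openin X U \<and> E \<subseteq> U \<and> measure ?T (U - E) < e"
      using U by (intro exI[of _ U]) auto
  qed simp
next
  let ?T = "var_measure X \<mu>"
  assume "complex_measure (borel_of X) \<mu> \<and> squeezable X ?T"
  then have \<mu>: "complex_measure (borel_of X) \<mu>" and sq: "squeezable X ?T" by auto
  interpret finite_measure ?T by (rule finite_measure_total_variation[OF \<mu>])
  show "regular_complex_borel_measure X \<mu>"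
    unfolding regular_complex_borel_measure_def
  proof (intro conjI ballI \<mu>)
    fix E assume E: "E \<in> sets (borel_of X)"
    have approx: "\<exists>K U. closedin X K \<and> openin X U \<and> K \<subseteq> E \<and> E \<subseteq> U \<and>
        emeasure ?T U \<le> emeasure ?T E + ennreal e \<and> emeasure ?T E \<le> emeasure ?T K + ennreal e"
      if e: "0 < e" for e
    proof -
      obtain K U where KU: "closedin X K" "openin X U" "K \<subseteq> E" "E \<subseteq> U" "measure ?T (U - K) < e"
        using squeezableE[OF sq E e] .
      have B: "K \<in> sets ?T" "U \<in> sets ?T" "E \<in> sets ?T"
        using KU E openin_borel closedin_borel by auto
      have "measure ?T (U - K) = measure ?T U - measure ?T K"
        using KU B by (intro finite_measure_Diff) auto
      moreover have "measure ?T K \<le> measure ?T E" "measure ?T E \<le> measure ?T U"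
        using KU B by (auto intro: finite_measure_mono)
      ultimately have "measure ?T U \<le> measure ?T E + e" "measure ?T E \<le> measure ?T K + e"
        using KU(5) by linarith+
      then show ?thesis using KU e
        by (intro exI[of _ K] exI[of _ U])
          (simp add: emeasure_eq_measure ennreal_plus[symmetric] del: ennreal_plus)
    qed
    show "emeasure ?T E = (INF U\<in>{U. openin X U \<and> E \<subseteq> U}. emeasure ?T U)"
    proof (rule antisym)
      show "emeasure ?T E \<le> (INF U\<in>{U. openin X U \<and> E \<subseteq> U}. emeasure ?T U)"
        using openin_borel by (intro INF_greatest emeasure_mono) auto
      show "(INF U\<in>{U. openin X U \<and> E \<subseteq> U}. emeasure ?T U) \<le> emeasure ?T E"
      proof (rule ennreal_le_epsilon)
        fix e :: real assume "0 < e"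
        then obtain U where "openin X U" "E \<subseteq> U" "emeasure ?T U \<le> emeasure ?T E + ennreal e"
          using approx by blast
        then show "(INF U\<in>{U. openin X U \<and> E \<subseteq> U}. emeasure ?T U) \<le> emeasure ?T E + ennreal e"
          by (intro INF_lower2[of U]) auto
      qed
    qed
    show "emeasure ?T E = (SUP K\<in>{K. compactin X K \<and> K \<subseteq> E}. emeasure ?T K)"
    proof (rule antisym)
      show "(SUP K\<in>{K. compactin X K \<and> K \<subseteq> E}. emeasure ?T K) \<le> emeasure ?T E"
        using E by (intro SUP_least emeasure_mono) auto
      show "emeasure ?T E \<le> (SUP K\<in>{K. compactin X K \<and> K \<subseteq> E}. emeasure ?T K)"
      proof (rule ennreal_le_epsilon)
        fix e :: real assume "0 < e"
        then obtain K where K: "closedin X K" "K \<subseteq> E" "emeasure ?T E \<le> emeasure ?T K + ennreal e"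
          using approx by blast
        have "emeasure ?T K \<le> (SUP K\<in>{K. compactin X K \<and> K \<subseteq> E}. emeasure ?T K)"
          using K closedin_compact_space[OF X] by (intro SUP_upper) auto
        then show "emeasure ?T E \<le> (SUP K\<in>{K. compactin X K \<and> K \<subseteq> E}. emeasure ?T K) + ennreal e"
          using K(3) by (meson add_right_mono order_trans)
      qed
    qed
  qed
qed

lemma regular_lincomb:
  assumes X: "compact_space X"
    and r: "regular_complex_borel_measure X \<mu>" "regular_complex_borel_measure X \<nu>"
  shows "regular_complex_borel_measure X (\<lambda>E. \<mu> E + c * \<nu> E)"
proof -
  have \<mu>: "complex_measure (borel_of X) \<mu>" "squeezable X (var_measure X \<mu>)"
    and \<nu>: "complex_measure (borel_of X) \<nu>" "squeezable X (var_measure X \<nu>)"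
    using r by (auto simp: regular_iff_squeezable[OF X])
  have "squeezable X (var_measure X (\<lambda>E. \<mu> E + c * \<nu> E))"
    by (rule squeezable_lincomb[OF \<mu>(2) \<nu>(2) finite_measure_total_variation[OF \<mu>(1)]
          finite_measure_total_variation[OF \<nu>(1)] _ _ norm_ge_zero total_variation_lincomb_le[OF \<mu>(1) \<nu>(1)]])
      simp_all
  then show ?thesis
    using complex_measure_lincomb[OF \<mu>(1) \<nu>(1)] by (simp add: regular_iff_squeezable[OF X])
qed

section \<open>Integrals of continuous functions and uniqueness of the representing measure\<close>

lemma continuous_map_compact_bounded:
  fixes f :: "'a \<Rightarrow> complex"
  assumes "compact_space X" "continuous_map X euclidean f"
  obtains M where "0 < M" "\<And>x. x \<in> topspace X \<Longrightarrow> cmod (f x) \<le> M"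
  using compact_space_nonneg_bounded[OF assms(1) continuous_map_norm[OF assms(2)]] by auto

lemma integrable_continuous_times:
  assumes "compact_space X" "continuous_map X euclidean f" "integrable R g" "sets R = sets (borel_of X)"
  shows "integrable R (\<lambda>x. f x * g x :: complex)"
proof -
  obtain M where "\<And>x. x \<in> topspace X \<Longrightarrow> cmod (f x) \<le> M"
    using continuous_map_compact_bounded[OF assms(1,2)] by metis
  then show ?thesis
    using sets_eq_imp_space_eq[OF assms(4)]
    by (intro integrable_bounded_times[OF assms(3) continuous_map_borel_measurable[OF assms(2,4)]]) auto
qed

lemma complex_integral_fun_lincomb:
  assumes X: "compact_space X" and \<mu>: "complex_measure (borel_of X) \<mu>"
    and f: "continuous_map X euclidean f" and g: "continuous_map X euclidean g"
  shows "complex_integral (borel_of X) \<mu> (\<lambda>x. f x + c * g x) =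
    complex_integral (borel_of X) \<mu> f + c * complex_integral (borel_of X) \<mu> g"
proof -
  let ?T = "var_measure X \<mu>" and ?p = "polar_density (borel_of X) \<mu>"
  have p: "integrable ?T ?p" using polar_density(3)[OF \<mu>] by (simp add: has_density_def)
  note i = integrable_continuous_times[OF X f p] integrable_continuous_times[OF X g p]
  have "complex_integral (borel_of X) \<mu> (\<lambda>x. f x + c * g x) = (\<integral>x. f x * ?p x + c * (g x * ?p x) \<partial>?T)"
    unfolding complex_integral_def by (simp add: algebra_simps)
  then show ?thesis using i by (simp add: complex_integral_def)
qed

lemma complex_integral_lincomb_continuous:
  assumes X: "compact_space X" and \<mu>: "complex_measure (borel_of X) \<mu>" "complex_measure (borel_of X) \<nu>"
    and f: "continuous_map X euclidean f"
  shows "complex_integral (borel_of X) (\<lambda>E. \<mu> E + c * \<nu> E) f =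
    complex_integral (borel_of X) \<mu> f + c * complex_integral (borel_of X) \<nu> f"
proof -
  obtain M where "\<And>x. x \<in> topspace X \<Longrightarrow> cmod (f x) \<le> M"
    using continuous_map_compact_bounded[OF X f] by metis
  then show ?thesis
    by (intro complex_integral_lincomb[OF \<mu> continuous_map_borel_measurable[OF f]]) auto
qed

lemma continuous_map_of_real:
  "continuous_map X euclideanreal f \<Longrightarrow> continuous_map X euclidean (\<lambda>x. complex_of_real (f x))"
  using continuous_map_compose[of X euclideanreal f euclidean complex_of_real]
  by (simp add: o_def continuous_on_of_real)

text \<open>The difference \<delta> annihilates continuous functions. A Urysohn function and the
  indicator of \<open>E\<close> both lie between the indicators of \<open>K\<close> and
  \<open>U\<close>, so they differ only on \<open>U - K\<close>, and \<open>\<delta> E\<close> is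
  bounded by the variation of this small set.\<close>

lemma regular_measure_unique:
  assumes X: "compact_space X" "Hausdorff_space X"
    and r: "regular_complex_borel_measure X \<mu>" "regular_complex_borel_measure X \<nu>"
    and eq: "\<And>f. continuous_map X euclidean f \<Longrightarrow>
      complex_integral (borel_of X) \<mu> f = complex_integral (borel_of X) \<nu> f"
  shows "\<mu> = \<nu>"
proof
  define \<delta> where "\<delta> = (\<lambda>E. \<mu> E + (-1) * \<nu> E)"
  have c: "complex_measure (borel_of X) \<mu>" "complex_measure (borel_of X) \<nu>"
    using r by (auto simp: regular_complex_borel_measure_def)
  have \<delta>: "complex_measure (borel_of X) \<delta>" and sq: "squeezable X (var_measure X \<delta>)"
    using regular_lincomb[OF X(1) r, of "-1"] by (auto simp: regular_iff_squeezable[OF X(1)] \<delta>_def)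
  have zero: "complex_integral (borel_of X) \<delta> f = 0" if "continuous_map X euclidean f" for f
    unfolding \<delta>_def by (subst complex_integral_lincomb_continuous[OF X(1) c that]) (simp add: eq[OF that])
  let ?T = "var_measure X \<delta>" and ?p = "polar_density (borel_of X) \<delta>"
  interpret finite_measure ?T by (rule finite_measure_total_variation[OF \<delta>])
  have p: "integrable ?T ?p" "\<And>E. E \<in> sets (borel_of X) \<Longrightarrow> \<delta> E = (\<integral>x. indicator E x * ?p x \<partial>?T)"
    using polar_density(3)[OF \<delta>] by (auto simp: has_density_def)
  fix E
  show "\<mu> E = \<nu> E"
  proof (cases "E \<in> sets (borel_of X)")
    case E: True
    have "cmod (\<delta> E) \<le> 0 + e" if e: "0 < e" for e
    proof -
      obtain K U where KU: "closedin X K" "openin X U" "K \<subseteq> E" "E \<subseteq> U" "measure ?T (U - K) < e"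
        using squeezableE[OF sq E e] .
      obtain g where g: "nonneg_on X g" "\<And>x. x \<in> topspace X \<Longrightarrow> g x \<le> indicator U x" "\<And>x. x \<in> K \<Longrightarrow> g x = 1"
        using Urysohn_indicator[OF X KU(1,2)] KU by blast
      have gc: "continuous_map X euclidean (\<lambda>x. complex_of_real (g x))"
        using g(1) by (intro continuous_map_of_real) (simp add: nonneg_on_def)
      have UK: "U - K \<in> sets ?T"
        using sets.Diff[OF openin_borel[OF KU(2)] closedin_borel[OF KU(1)]] by simp
      have i1: "integrable ?T (\<lambda>x. indicator E x * ?p x)" using p E by (intro integrable_indicator_times) auto
      have i2: "integrable ?T (\<lambda>x. of_real (g x) * ?p x)"
        by (rule integrable_continuous_times[OF X(1) gc p(1)]) simp
      have "\<delta> E = (\<integral>x. indicator E x * ?p x \<partial>?T) - complex_integral (borel_of X) \<delta> (\<lambda>x. of_real (g x))"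
        using p(2)[OF E] zero[OF gc] by simp
      also have "\<dots> = (\<integral>x. indicator E x * ?p x - of_real (g x) * ?p x \<partial>?T)"
        unfolding complex_integral_def using i1 i2 by simp
      finally have "cmod (\<delta> E) \<le> (\<integral>x. cmod (indicator E x * ?p x - of_real (g x) * ?p x) \<partial>?T)"
        by (metis integral_norm_bound)
      also have "\<dots> \<le> (\<integral>x. indicator (U - K) x \<partial>?T)"
      proof (rule integral_mono)
        show "integrable ?T (\<lambda>x. cmod (indicator E x * ?p x - of_real (g x) * ?p x))" using i1 i2 by simp
        show "integrable ?T (indicator (U - K) :: 'a \<Rightarrow> real)" using UK by (simp add: less_top[symmetric])
        fix x assume "x \<in> space ?T"
        then have x: "x \<in> topspace X" by simp
        have "cmod (indicator E x * ?p x - of_real (g x) * ?p x) = cmod (of_real (indicator E x - g x) * ?p x)"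
          by (simp add: algebra_simps of_real_indicator)
        also have "\<dots> = \<bar>indicator E x - g x\<bar>"
          using polar_density(2)[OF \<delta>, of x] x by (simp only: norm_mult norm_of_real) simp
        also have "\<dots> \<le> indicator (U - K) x"
          using g(1) g(2)[OF x] g(3)[of x] x KU(3,4) unfolding nonneg_on_def
          by (auto simp: indicator_def split: if_splits)
        finally show "cmod (indicator E x * ?p x - of_real (g x) * ?p x) \<le> indicator (U - K) x" .
      qed
      also have "\<dots> = measure ?T (U - K)" using UK sets.sets_into_space[OF UK] by (simp add: Int_absorb2)
      finally show ?thesis using KU(5) by simp
    qed
    then have "cmod (\<delta> E) \<le> 0" by (rule field_le_epsilon)
    then show ?thesis by (simp add: \<delta>_def)
  qed (use c in \<open>simp add: complex_measure_outside\<close>)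
qed

section \<open>Positive and negative parts of a bounded real functional\<close>

locale real_functional =
  fixes X :: "'a topology" and \<sigma> :: "('a \<Rightarrow> real) \<Rightarrow> real" and C :: real
  assumes compact: "compact_space X" and Hausdorff: "Hausdorff_space X"
    and add: "continuous_map X euclideanreal f \<Longrightarrow> continuous_map X euclideanreal g \<Longrightarrow>
      \<sigma> (\<lambda>x. f x + g x) = \<sigma> f + \<sigma> g"
    and scale: "continuous_map X euclideanreal f \<Longrightarrow> \<sigma> (\<lambda>x. c * f x) = c * \<sigma> f"
    and bound: "continuous_map X euclideanreal f \<Longrightarrow> (\<And>x. x \<in> topspace X \<Longrightarrow> \<bar>f x\<bar> \<le> 1) \<Longrightarrow> \<bar>\<sigma> f\<bar> \<le> C"
begin

definition minorants :: "('a \<Rightarrow> real) \<Rightarrow> ('a \<Rightarrow> real) set" where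
  "minorants f = {h. nonneg_on X h \<and> (\<forall>x\<in>topspace X. h x \<le> f x)}"

text \<open>The Riesz-Kantorovich formula for the positive part of \<sigma>. If \<open>f\<close> is
  negative somewhere in \<open>topspace X\<close>, there are no minorants and the value carries no
  information.\<close>

definition pos :: "('a \<Rightarrow> real) \<Rightarrow> real" where
  "pos f = (SUP h\<in>minorants f. \<sigma> h)"

lemma uminus: "real_functional X (\<lambda>f. - \<sigma> f) C"
  using compact Hausdorff by unfold_locales (simp_all add: add scale bound)

lemma diff:
  assumes "continuous_map X euclideanreal f" "continuous_map X euclideanreal g"
  shows "\<sigma> (\<lambda>x. f x - g x) = \<sigma> f - \<sigma> g"
proof -
  have "continuous_map X euclideanreal (\<lambda>x. f x - g x)"
    using assms by (intro continuous_intros)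
  from add[OF this assms(2)] show ?thesis by simp
qed

lemma zero: "\<sigma> (\<lambda>x. 0) = 0"
  using scale[of "\<lambda>x. 0" 0] by simp

lemma zero_minorant: "nonneg_on X f \<Longrightarrow> (\<lambda>x. 0) \<in> minorants f"
  by (simp add: minorants_def nonneg_on_def)

lemma minorants_bounded:
  assumes "nonneg_on X f" shows "bdd_above (\<sigma> ` minorants f)"
proof -
  obtain M where M: "0 < M" "\<And>x. x \<in> topspace X \<Longrightarrow> \<bar>f x\<bar> \<le> M"
    using compact_space_nonneg_bounded[OF compact] assms unfolding nonneg_on_def by metis
  have "\<sigma> h \<le> M * C" if h: "h \<in> minorants f" for h
  proof -
    have hc: "continuous_map X euclideanreal h" using h by (simp add: minorants_def nonneg_on_def)
    have "\<bar>\<sigma> (\<lambda>x. (1 / M) * h x)\<bar> \<le> C"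
    proof (rule bound)
      show "continuous_map X euclideanreal (\<lambda>x. (1 / M) * h x)" using hc by (intro continuous_intros; simp)
      fix x assume x: "x \<in> topspace X"
      then have "0 \<le> h x" "h x \<le> M" using h M(2)[OF x] by (auto simp: minorants_def nonneg_on_def abs_le_iff)
      then show "\<bar>(1 / M) * h x\<bar> \<le> 1" using M(1) by simp
    qed
    then have "\<bar>\<sigma> h / M\<bar> \<le> C" using scale[OF hc, of "1 / M"] by simp
    then show ?thesis using M(1) by (simp add: abs_le_iff field_simps)
  qed
  then show ?thesis by (rule bdd_aboveI2)
qed

lemma pos_upper: "nonneg_on X f \<Longrightarrow> h \<in> minorants f \<Longrightarrow> \<sigma> h \<le> pos f"
  unfolding pos_def by (intro cSUP_upper minorants_bounded)

lemma pos_least: "nonneg_on X f \<Longrightarrow> (\<And>h. h \<in> minorants f \<Longrightarrow> \<sigma> h \<le> c) \<Longrightarrow> pos f \<le> c"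
  unfolding pos_def using zero_minorant by (intro cSUP_least) auto

lemma pos_nonneg: "nonneg_on X f \<Longrightarrow> 0 \<le> pos f"
  using pos_upper[of f "\<lambda>x. 0"] zero_minorant zero by simp

text \<open>The nontrivial inequality is the Riesz decomposition property: a minorant
  \<open>h\<close> of f + g splits as min h f, a minorant of \<open>f\<close>, plus the rest, a
  minorant of \<open>g\<close>.\<close>

lemma pos_add:
  assumes f: "nonneg_on X f" and g: "nonneg_on X g"
  shows "pos (\<lambda>x. f x + g x) = pos f + pos g"
proof (rule antisym)
  have fg: "nonneg_on X (\<lambda>x. f x + g x)"
    using f g by (auto simp: nonneg_on_def intro!: continuous_intros)
  have fc: "continuous_map X euclideanreal f" using f by (simp add: nonneg_on_def)
  show "pos (\<lambda>x. f x + g x) \<le> pos f + pos g"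
  proof (rule pos_least[OF fg])
    fix h assume h: "h \<in> minorants (\<lambda>x. f x + g x)"
    then have hc: "continuous_map X euclideanreal h" by (simp add: minorants_def nonneg_on_def)
    have mc: "continuous_map X euclideanreal (\<lambda>x. min (h x) (f x))" using hc fc by (intro continuous_intros)
    have dc: "continuous_map X euclideanreal (\<lambda>x. h x - min (h x) (f x))" using hc fc by (intro continuous_intros)
    have "(\<lambda>x. min (h x) (f x)) \<in> minorants f"
      using h f mc by (auto simp: minorants_def nonneg_on_def)
    moreover have "(\<lambda>x. h x - min (h x) (f x)) \<in> minorants g"
      using h g dc by (fastforce simp: minorants_def nonneg_on_def min_def)
    ultimately have "\<sigma> (\<lambda>x. min (h x) (f x)) + \<sigma> (\<lambda>x. h x - min (h x) (f x)) \<le> pos f + pos g"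
      using f g by (intro add_mono pos_upper)
    then show "\<sigma> h \<le> pos f + pos g" using add[OF mc dc] by simp
  qed
  have sum: "\<sigma> h + \<sigma> k \<le> pos (\<lambda>x. f x + g x)" if "h \<in> minorants f" "k \<in> minorants g" for h k
  proof -
    have c: "continuous_map X euclideanreal h" "continuous_map X euclideanreal k"
      using that by (auto simp: minorants_def nonneg_on_def)
    have "(\<lambda>x. h x + k x) \<in> minorants (\<lambda>x. f x + g x)"
      using that by (auto simp: minorants_def nonneg_on_def intro!: continuous_intros add_mono)
    then show ?thesis using pos_upper[OF fg] add[OF c] by metis
  qed
  have "pos f \<le> pos (\<lambda>x. f x + g x) - pos g"
  proof (rule pos_least[OF f])
    fix h assume h: "h \<in> minorants f"
    have "pos g \<le> pos (\<lambda>x. f x + g x) - \<sigma> h"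
      using sum[OF h] by (intro pos_least[OF g]) (simp add: le_diff_eq add.commute)
    then show "\<sigma> h \<le> pos (\<lambda>x. f x + g x) - pos g" by simp
  qed
  then show "pos f + pos g \<le> pos (\<lambda>x. f x + g x)" by simp
qed

text \<open>Used for \<open>c\<close> and for \<open>1 / c\<close>, which together give
  equality.\<close>

lemma pos_scale_le:
  assumes f: "nonneg_on X f" and c: "0 < c"
  shows "c * pos f \<le> pos (\<lambda>x. c * f x)"
proof -
  have cf: "nonneg_on X (\<lambda>x. c * f x)"
    using f c by (auto simp: nonneg_on_def intro!: continuous_intros)
  have "pos f \<le> pos (\<lambda>x. c * f x) / c"
  proof (rule pos_least[OF f])
    fix h assume h: "h \<in> minorants f"
    then have hc: "continuous_map X euclideanreal h" by (simp add: minorants_def nonneg_on_def)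
    have "(\<lambda>x. c * h x) \<in> minorants (\<lambda>x. c * f x)"
      using h c by (auto simp: minorants_def nonneg_on_def intro!: continuous_intros)
    then have "c * \<sigma> h \<le> pos (\<lambda>x. c * f x)" using pos_upper[OF cf] scale[OF hc] by metis
    then show "\<sigma> h \<le> pos (\<lambda>x. c * f x) / c" using c by (simp add: field_simps)
  qed
  then show ?thesis using c by (simp add: field_simps)
qed

lemma cone_functional_pos: "cone_functional X pos"
proof
  fix f :: "'a \<Rightarrow> real" and c :: real assume f: "nonneg_on X f" and "0 \<le> c"
  show "pos (\<lambda>x. c * f x) = c * pos f"
  proof (cases "c = 0")
    case True
    \<comment> \<open>Additivity at the zero function says that its value equals its double.\<close>
    have "nonneg_on X (\<lambda>x. 0)" by (simp add: nonneg_on_def)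
    from pos_add[OF this this] True show ?thesis by simp
  next
    case False
    then have c: "0 < c" using \<open>0 \<le> c\<close> by simp
    have cf: "nonneg_on X (\<lambda>x. c * f x)"
      using f c by (auto simp: nonneg_on_def intro!: continuous_intros)
    have "(1 / c) * pos (\<lambda>x. c * f x) \<le> pos (\<lambda>x. (1 / c) * (c * f x))"
      using c by (intro pos_scale_le cf) simp
    moreover have "(\<lambda>x. (1 / c) * (c * f x)) = f" using c by simp
    ultimately show ?thesis using pos_scale_le[OF f c] c by (simp add: field_simps)
  qed
qed (simp_all add: compact Hausdorff pos_nonneg pos_add)

text \<open>The value at 1 bounds the total mass of the representing measure; each of the four
  pieces of a complex functional costs one such \<open>C\<close>.\<close>

lemma pos_one_le: "pos (\<lambda>x. 1) \<le> C"
proof (rule pos_least)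
  fix h assume "h \<in> minorants (\<lambda>x. 1)"
  then have "\<bar>\<sigma> h\<bar> \<le> C" by (intro bound) (auto simp: minorants_def nonneg_on_def)
  then show "\<sigma> h \<le> C" by simp
qed (simp add: nonneg_on_def)

end

text \<open>The functional counterpart of the Jordan decomposition: \<open>h\<close> to
  \<open>f - h\<close> permutes the minorants of \<open>f\<close> and sends \<sigma> h to \<sigma> f
  - \<sigma> h.\<close>

lemma (in real_functional) eq_diff_pos:
  assumes f: "nonneg_on X f"
  shows "\<sigma> f = pos f - real_functional.pos X (\<lambda>f. - \<sigma> f) f"
proof -
  interpret N: real_functional X "\<lambda>f. - \<sigma> f" C by (rule uminus)
  have fc: "continuous_map X euclideanreal f" using f by (simp add: nonneg_on_def)
  have *: "(\<lambda>x. f x - h x) \<in> minorants f" "\<sigma> (\<lambda>x. f x - h x) = \<sigma> f - \<sigma> h" if h: "h \<in> minorants f" for h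
  proof -
    have hc: "continuous_map X euclideanreal h" using h by (simp add: minorants_def nonneg_on_def)
    show "(\<lambda>x. f x - h x) \<in> minorants f" using h fc hc
      by (auto simp: minorants_def nonneg_on_def intro!: continuous_intros)
    show "\<sigma> (\<lambda>x. f x - h x) = \<sigma> f - \<sigma> h" by (rule diff[OF fc hc])
  qed
  have "pos f \<le> \<sigma> f + N.pos f"
  proof (rule pos_least[OF f])
    fix h assume h: "h \<in> minorants f"
    then have "- \<sigma> (\<lambda>x. f x - h x) \<le> N.pos f" using *(1) by (intro N.pos_upper[OF f])
    then show "\<sigma> h \<le> \<sigma> f + N.pos f" using *(2)[OF h] by simp
  qed
  moreover have "N.pos f \<le> pos f - \<sigma> f"
  proof (rule N.pos_least[OF f])
    fix h assume h: "h \<in> minorants f"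
    then have "\<sigma> (\<lambda>x. f x - h x) \<le> pos f" using *(1) by (intro pos_upper[OF f])
    then show "- \<sigma> h \<le> pos f - \<sigma> f" using *(2)[OF h] by simp
  qed
  ultimately show ?thesis by linarith
qed

section \<open>From positive to complex functionals\<close>

lemma positive_measure_complex_integral:
  assumes \<nu>: "finite_measure \<nu>" "sets \<nu> = sets (borel_of X)" and f: "continuous_map X euclideanreal f"
  shows "complex_integral (borel_of X) (\<lambda>E. of_real (measure \<nu> E)) (\<lambda>x. of_real (f x)) = of_real (\<integral>x. f x \<partial>\<nu>)"
  using complex_integral_eq[OF complex_measure_of_positive[OF \<nu>] has_density_positive[OF \<nu>]
      continuous_map_borel_measurable[OF continuous_map_of_real[OF f] refl]]
  by simp

text \<open>A positive measure read as a complex one is its own variation, so squeezability and the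
  mass bound carry over unchanged.\<close>

lemma (in cone_functional) riesz_complex_measure:
  defines "\<mu> \<equiv> \<lambda>E. complex_of_real (measure riesz E)"
  shows "regular_complex_borel_measure X \<mu>"
    and "nonneg_on X f \<Longrightarrow> complex_integral (borel_of X) \<mu> (\<lambda>x. of_real (f x)) = of_real (L f)"
    and "measure (var_measure X \<mu>) (topspace X) \<le> L (\<lambda>x. 1)"
proof -
  have tv: "var_measure X \<mu> = riesz"
    unfolding \<mu>_def by (rule total_variation_positive[OF finite_measure_riesz sets_riesz])
  show "regular_complex_borel_measure X \<mu>"
    unfolding regular_iff_squeezable[OF compact] tv
    using squeezable_riesz complex_measure_of_positive[OF finite_measure_riesz sets_riesz] by (simp add: \<mu>_def)
  show "measure (var_measure X \<mu>) (topspace X) \<le> L (\<lambda>x. 1)"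
    unfolding tv by (rule measure_riesz_space)
  show "complex_integral (borel_of X) \<mu> (\<lambda>x. of_real (f x)) = of_real (L f)" if "nonneg_on X f"
    unfolding \<mu>_def riesz_representation[OF that] using that
    by (intro positive_measure_complex_integral finite_measure_riesz) (auto simp: nonneg_on_def)
qed

lemma (in real_functional) riesz_real:
  obtains \<mu> where "regular_complex_borel_measure X \<mu>"
    "\<And>f. nonneg_on X f \<Longrightarrow> complex_integral (borel_of X) \<mu> (\<lambda>x. of_real (f x)) = of_real (\<sigma> f)"
    "measure (var_measure X \<mu>) (topspace X) \<le> 2 * C"
proof -
  interpret N: real_functional X "\<lambda>f. - \<sigma> f" C by (rule uminus)
  interpret P: cone_functional X pos by (rule cone_functional_pos)
  interpret Q: cone_functional X N.pos by (rule N.cone_functional_pos)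
  let ?P = "\<lambda>E. complex_of_real (measure P.riesz E)" and ?Q = "\<lambda>E. complex_of_real (measure Q.riesz E)"
  note P = P.riesz_complex_measure and Q = Q.riesz_complex_measure
  have c: "complex_measure (borel_of X) ?P" "complex_measure (borel_of X) ?Q"
    using P(1) Q(1) by (auto simp: regular_complex_borel_measure_def)
  show ?thesis
  proof (rule that)
    show "regular_complex_borel_measure X (\<lambda>E. ?P E + (-1) * ?Q E)"
      by (rule regular_lincomb[OF compact P(1) Q(1)])
    show "complex_integral (borel_of X) (\<lambda>E. ?P E + (-1) * ?Q E) (\<lambda>x. of_real (f x)) = of_real (\<sigma> f)"
      if f: "nonneg_on X f" for f
    proof -
      have "continuous_map X euclidean (\<lambda>x. complex_of_real (f x))"
        using f by (intro continuous_map_of_real) (simp add: nonneg_on_def)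
      from complex_integral_lincomb_continuous[OF compact c this, of "-1"]
      show ?thesis using P(2)[OF f] Q(2)[OF f] eq_diff_pos[OF f] by simp
    qed
    have "measure (var_measure X (\<lambda>E. ?P E + (-1) * ?Q E)) (topspace X)
      \<le> measure (var_measure X ?P) (topspace X) + cmod (-1) * measure (var_measure X ?Q) (topspace X)"
      by (rule total_variation_lincomb_le[OF c])
    then show "measure (var_measure X (\<lambda>E. ?P E + (-1) * ?Q E)) (topspace X) \<le> 2 * C"
      using P(3) Q(3) pos_one_le N.pos_one_le by simp
  qed
qed

text \<open>On real functions the real and imaginary parts of \<psi> are bounded real functionals,
  each represented at cost \<open>2 * C\<close>. Agreement spreads by linearity from nonnegative
  functions to real ones through their positive and negative parts, then to complex ones.\<close>

theorem riesz_complex: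
  fixes \<psi> :: "('a \<Rightarrow> complex) \<Rightarrow> complex"
  assumes X: "compact_space X" "Hausdorff_space X"
    and lin: "\<And>f g c. continuous_map X euclidean f \<Longrightarrow> continuous_map X euclidean g \<Longrightarrow>
      \<psi> (\<lambda>x. f x + c * g x) = \<psi> f + c * \<psi> g"
    and bound: "\<And>f. continuous_map X euclidean f \<Longrightarrow> (\<And>x. x \<in> topspace X \<Longrightarrow> cmod (f x) \<le> 1) \<Longrightarrow> cmod (\<psi> f) \<le> C"
  obtains \<mu> where "regular_complex_borel_measure X \<mu>"
    "\<And>f. continuous_map X euclidean f \<Longrightarrow> \<psi> f = complex_integral (borel_of X) \<mu> f"
    "measure (var_measure X \<mu>) (topspace X) \<le> 4 * C"
proof -
  let ?r = "\<lambda>f x. complex_of_real (f x)"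
  have zero: "\<psi> (\<lambda>x. 0) = 0" using lin[of "\<lambda>x. 0" "\<lambda>x. 0" 1] by simp
  have add: "\<psi> (\<lambda>x. f x + g x) = \<psi> f + \<psi> g"
    if "continuous_map X euclidean f" "continuous_map X euclidean g" for f g
    using lin[OF that, of 1] by simp
  have scale: "\<psi> (\<lambda>x. c * f x) = c * \<psi> f" if "continuous_map X euclidean f" for f c
    using lin[of "\<lambda>x. 0" f c] that zero by simp
  have "real_functional X (\<lambda>f. Re (\<psi> (?r f))) C"
    using X by unfold_locales
      (auto simp: continuous_map_of_real add scale intro!: order_trans[OF abs_Re_le_cmod] bound)
  then obtain \<mu>1 where 1: "regular_complex_borel_measure X \<mu>1"
    "\<And>f. nonneg_on X f \<Longrightarrow> complex_integral (borel_of X) \<mu>1 (?r f) = of_real (Re (\<psi> (?r f)))"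
    "measure (var_measure X \<mu>1) (topspace X) \<le> 2 * C"
    using real_functional.riesz_real by metis
  have "real_functional X (\<lambda>f. Im (\<psi> (?r f))) C"
    using X by unfold_locales
      (auto simp: continuous_map_of_real add scale intro!: order_trans[OF abs_Im_le_cmod] bound)
  then obtain \<mu>2 where 2: "regular_complex_borel_measure X \<mu>2"
    "\<And>f. nonneg_on X f \<Longrightarrow> complex_integral (borel_of X) \<mu>2 (?r f) = of_real (Im (\<psi> (?r f)))"
    "measure (var_measure X \<mu>2) (topspace X) \<le> 2 * C"
    using real_functional.riesz_real by metis
  define \<mu> where "\<mu> = (\<lambda>E. \<mu>1 E + \<i> * \<mu>2 E)"
  have c: "complex_measure (borel_of X) \<mu>1" "complex_measure (borel_of X) \<mu>2"
    using 1 2 by (auto simp: regular_complex_borel_measure_def)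
  have r: "regular_complex_borel_measure X \<mu>"
    unfolding \<mu>_def by (rule regular_lincomb[OF X(1) 1(1) 2(1)])
  then have \<mu>: "complex_measure (borel_of X) \<mu>" by (simp add: regular_complex_borel_measure_def)
  let ?I = "complex_integral (borel_of X) \<mu>"
  have nn: "\<psi> (?r f) = ?I (?r f)" if f: "nonneg_on X f" for f
  proof -
    have "continuous_map X euclidean (?r f)"
      using f by (intro continuous_map_of_real) (simp add: nonneg_on_def)
    from complex_integral_lincomb_continuous[OF X(1) c this, of \<i>]
    have "?I (?r f) = of_real (Re (\<psi> (?r f))) + \<i> * of_real (Im (\<psi> (?r f)))"
      unfolding \<mu>_def using 1(2)[OF f] 2(2)[OF f] by simp
    then show ?thesis by (simp add: complex_eq_iff)
  qed
  have real: "\<psi> (?r f) = ?I (?r f)" if f: "continuous_map X euclideanreal f" for f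
  proof -
    let ?p = "\<lambda>x. max 0 (f x)" and ?m = "\<lambda>x. max 0 (- f x)"
    have n: "nonneg_on X ?p" "nonneg_on X ?m"
      using f by (auto simp: nonneg_on_def intro!: continuous_intros)
    then have pc: "continuous_map X euclidean (?r ?p)" "continuous_map X euclidean (?r ?m)"
      by (auto simp: nonneg_on_def intro!: continuous_map_of_real)
    have eq: "?r f = (\<lambda>x. ?r ?p x + (-1) * ?r ?m x)" by (auto simp: max_def)
    show ?thesis
      unfolding eq lin[OF pc, of "-1"] complex_integral_fun_lincomb[OF X(1) \<mu> pc, of "-1"] nn[OF n(1)] nn[OF n(2)] ..
  qed
  have "\<psi> f = ?I f" if f: "continuous_map X euclidean f" for f
  proof -
    have "continuous_map X euclidean (Re \<circ> f)" "continuous_map X euclidean (Im \<circ> f)"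
      by (rule continuous_map_compose[OF f], simp add: continuous_on_Re continuous_on_Im)+
    then have n: "continuous_map X euclideanreal (\<lambda>x. Re (f x))" "continuous_map X euclideanreal (\<lambda>x. Im (f x))"
      by (simp_all add: o_def)
    note pc = n[THEN continuous_map_of_real]
    have eq: "f = (\<lambda>x. ?r (\<lambda>x. Re (f x)) x + \<i> * ?r (\<lambda>x. Im (f x)) x)" by (auto simp: complex_eq_iff)
    show ?thesis
      using lin[OF pc, of \<i>] complex_integral_fun_lincomb[OF X(1) \<mu> pc, of \<i>] real[OF n(1)] real[OF n(2)]
      by (simp flip: eq)
  qed
  moreover have "measure (var_measure X \<mu>) (topspace X) \<le> 4 * C"
    using total_variation_lincomb_le[OF c, of \<i> "topspace X"] 1(3) 2(3) by (simp add: \<mu>_def)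
  ultimately show ?thesis using that r by blast
qed

lemma riesz_measure_eqI:
  assumes "compact_space X" "Hausdorff_space X" "regular_complex_borel_measure X \<mu>"
    "\<And>f. continuous_map X euclidean f \<Longrightarrow> \<psi> f = complex_integral (borel_of X) \<mu> f"
  shows "riesz_measure X \<psi> = \<mu>"
  unfolding riesz_measure_def
proof (rule the_equality)
  fix \<nu> assume "regular_complex_borel_measure X \<nu> \<and>
    (\<forall>f. continuous_map X euclidean f \<longrightarrow> \<psi> f = complex_integral (borel_of X) \<nu> f)"
  then show "\<nu> = \<mu>" using regular_measure_unique[OF assms(1,2)] assms(3,4) by metis
qed (use assms in auto)

section \<open>Splittings of surjections on a dual space\<close>

text \<open>The laws that the dual and the splitting draw on. Identities between functionals are
  checked pointwise in the complex numbers through \<open>dual_eqI\<close>, which also provides the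
  triangle inequality for the dual norm with its source.\<close>

locale seminormed_space =
  fixes V :: "'v cspace"
  assumes zero_closed: "vzero V \<in> vcarrier V"
    and add_closed: "x \<in> vcarrier V \<Longrightarrow> y \<in> vcarrier V \<Longrightarrow> vadd V x y \<in> vcarrier V"
    and scale_closed: "x \<in> vcarrier V \<Longrightarrow> vscale V c x \<in> vcarrier V"
    and add_zero: "x \<in> vcarrier V \<Longrightarrow> vadd V x (vzero V) = x"
    and add_neg: "x \<in> vcarrier V \<Longrightarrow> vadd V x (vscale V (-1) x) = vzero V"
    and scale_zero: "vscale V c (vzero V) = vzero V"
    and norm_nonneg: "x \<in> vcarrier V \<Longrightarrow> 0 \<le> vnorm V x"
    and norm_zero: "vnorm V (vzero V) = 0"
begin

lemma in_dual_iff: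
  "l \<in> vcarrier (dual V) \<longleftrightarrow> l \<in> extensional (vcarrier V) \<and>
    (\<forall>x\<in>vcarrier V. \<forall>y\<in>vcarrier V. l (vadd V x y) = l x + l y) \<and>
    (\<forall>c. \<forall>x\<in>vcarrier V. l (vscale V c x) = c * l x) \<and>
    (\<exists>K. \<forall>x\<in>vcarrier V. cmod (l x) \<le> K * vnorm V x)"
  by (simp add: dual_def bounded_linear_map_def complex_field_space_def)

lemma dual_eqI:
  assumes "l \<in> vcarrier (dual V)" "k \<in> vcarrier (dual V)" "\<And>x. x \<in> vcarrier V \<Longrightarrow> l x = k x"
  shows "l = k"
  using assms extensionalityI[of l "vcarrier V" k] by (auto simp: in_dual_iff)

lemma dual_add_apply: "x \<in> vcarrier V \<Longrightarrow> vadd (dual V) l k x = l x + k x"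
  and dual_scale_apply: "x \<in> vcarrier V \<Longrightarrow> vscale (dual V) c l x = c * l x"
  by (simp_all add: dual_def)

lemma dual_bounded:
  assumes "l \<in> vcarrier (dual V)"
  obtains K where "0 \<le> K" "\<And>x. x \<in> vcarrier V \<Longrightarrow> cmod (l x) \<le> K * vnorm V x"
proof -
  obtain K where K: "\<And>x. x \<in> vcarrier V \<Longrightarrow> cmod (l x) \<le> K * vnorm V x"
    using assms unfolding in_dual_iff by blast
  have "cmod (l x) \<le> max K 0 * vnorm V x" if "x \<in> vcarrier V" for x
    using K[OF that] mult_right_mono[of K "max K 0" "vnorm V x"] norm_nonneg[OF that] by auto
  then show ?thesis using that[of "max K 0"] by auto
qed

lemma dual_add_closed:
  assumes l: "l \<in> vcarrier (dual V)" and k: "k \<in> vcarrier (dual V)"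
  shows "vadd (dual V) l k \<in> vcarrier (dual V)"
proof -
  obtain K1 where K1: "\<And>x. x \<in> vcarrier V \<Longrightarrow> cmod (l x) \<le> K1 * vnorm V x"
    using dual_bounded[OF l] by metis
  obtain K2 where K2: "\<And>x. x \<in> vcarrier V \<Longrightarrow> cmod (k x) \<le> K2 * vnorm V x"
    using dual_bounded[OF k] by metis
  have "cmod (l x + k x) \<le> (K1 + K2) * vnorm V x" if "x \<in> vcarrier V" for x
    using norm_triangle_ineq[of "l x" "k x"] K1[OF that] K2[OF that] by (simp add: distrib_right)
  then have "\<exists>K. \<forall>x\<in>vcarrier V. cmod (l x + k x) \<le> K * vnorm V x" by blast
  moreover have "vadd (dual V) l k \<in> extensional (vcarrier V)" by (simp add: dual_def)
  ultimately show ?thesis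
    unfolding in_dual_iff using l k
    by (simp add: dual_add_apply add_closed scale_closed in_dual_iff algebra_simps)
qed

lemma dual_scale_closed:
  assumes l: "l \<in> vcarrier (dual V)"
  shows "vscale (dual V) c l \<in> vcarrier (dual V)"
proof -
  obtain K where K: "\<And>x. x \<in> vcarrier V \<Longrightarrow> cmod (l x) \<le> K * vnorm V x"
    using dual_bounded[OF l] by metis
  have "cmod (c * l x) \<le> (cmod c * K) * vnorm V x" if "x \<in> vcarrier V" for x
    using mult_left_mono[OF K[OF that] norm_ge_zero[of c]] by (simp add: norm_mult mult.assoc)
  then have "\<exists>K. \<forall>x\<in>vcarrier V. cmod (c * l x) \<le> K * vnorm V x" by blast
  moreover have "vscale (dual V) c l \<in> extensional (vcarrier V)" by (simp add: dual_def)
  ultimately show ?thesis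
    unfolding in_dual_iff using l
    by (simp add: dual_scale_apply add_closed scale_closed in_dual_iff algebra_simps)
qed

lemma dual_norm_upper:
  assumes l: "l \<in> vcarrier (dual V)" and x: "x \<in> vcarrier V" "vnorm V x \<le> 1"
  shows "cmod (l x) \<le> vnorm (dual V) l"
proof -
  obtain K where K: "0 \<le> K" "\<And>x. x \<in> vcarrier V \<Longrightarrow> cmod (l x) \<le> K * vnorm V x"
    using dual_bounded[OF l] by metis
  have "cmod (l y) \<le> K" if "y \<in> vcarrier V" "vnorm V y \<le> 1" for y
    using K(2)[OF that(1)] mult_left_mono[OF that(2) K(1)] by simp
  then have "bdd_above {cmod (l x) | x. x \<in> vcarrier V \<and> vnorm V x \<le> 1}" by (auto intro!: bdd_aboveI[of _ K])
  then show ?thesis using x by (auto simp: dual_def intro!: cSup_upper)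
qed

lemma dual_norm_least:
  assumes "\<And>x. x \<in> vcarrier V \<Longrightarrow> vnorm V x \<le> 1 \<Longrightarrow> cmod (l x) \<le> c"
  shows "vnorm (dual V) l \<le> c"
proof -
  have "{cmod (l x) | x. x \<in> vcarrier V \<and> vnorm V x \<le> 1} \<noteq> {}"
    using zero_closed norm_zero by fastforce
  then show ?thesis using assms by (auto simp: dual_def intro!: cSup_least)
qed

lemma dual_norm_nonneg: "l \<in> vcarrier (dual V) \<Longrightarrow> 0 \<le> vnorm (dual V) l"
  using dual_norm_upper[OF _ zero_closed, of l] norm_zero order_trans[OF norm_ge_zero[of "l (vzero V)"]]
  by simp

lemma dual_norm_add:
  assumes "l \<in> vcarrier (dual V)" "k \<in> vcarrier (dual V)"
  shows "vnorm (dual V) (vadd (dual V) l k) \<le> vnorm (dual V) l + vnorm (dual V) k"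
proof (rule dual_norm_least)
  fix x assume x: "x \<in> vcarrier V" "vnorm V x \<le> 1"
  show "cmod (vadd (dual V) l k x) \<le> vnorm (dual V) l + vnorm (dual V) k"
    using dual_norm_upper[OF assms(1) x] dual_norm_upper[OF assms(2) x] norm_triangle_ineq[of "l x" "k x"]
    by (simp add: dual_add_apply x)
qed

lemma dual_norm_scale:
  assumes "l \<in> vcarrier (dual V)"
  shows "vnorm (dual V) (vscale (dual V) c l) \<le> cmod c * vnorm (dual V) l"
proof (rule dual_norm_least)
  fix x assume x: "x \<in> vcarrier V" "vnorm V x \<le> 1"
  show "cmod (vscale (dual V) c l x) \<le> cmod c * vnorm (dual V) l"
    using mult_left_mono[OF dual_norm_upper[OF assms x] norm_ge_zero[of c]]
    by (simp add: dual_scale_apply x norm_mult)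
qed

end

lemma bounded_linear_map_bound:
  assumes "bounded_linear_map V W f" "\<And>x. x \<in> vcarrier V \<Longrightarrow> 0 \<le> vnorm V x"
  obtains K where "0 \<le> K" "\<And>x. x \<in> vcarrier V \<Longrightarrow> vnorm W (f x) \<le> K * vnorm V x"
proof -
  obtain K where K: "\<And>x. x \<in> vcarrier V \<Longrightarrow> vnorm W (f x) \<le> K * vnorm V x"
    using assms(1) unfolding bounded_linear_map_def by blast
  have "vnorm W (f x) \<le> max K 0 * vnorm V x" if "x \<in> vcarrier V" for x
    using K[OF that] mult_right_mono[of K "max K 0" "vnorm V x"] assms(2)[OF that] by auto
  then show ?thesis using that[of "max K 0"] by auto
qed

text \<open>The isomorphism is \<open>l \<mapsto> (p l, l - s (p l))\<close> with inverse \<open>(y, k) \<mapsto> s y + k\<close>.\<close>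

lemma split_imp_direct_sum:
  fixes U :: "'v cspace" and W :: "'w cspace"
  assumes "seminormed_space U" "seminormed_space W"
    and p: "bounded_linear_map (dual U) W p" and s: "bounded_linear_map W (dual U) s"
    and ps: "\<And>y. y \<in> vcarrier W \<Longrightarrow> p (s y) = y"
  shows "banach_isomorphic (dual U) (direct_sum W (kernel_space (dual U) W p))"
proof -
  interpret U: seminormed_space U by fact
  interpret W: seminormed_space W by fact
  let ?D = "dual U"
  define S where "S = direct_sum W (kernel_space ?D W p)"
  have Sc: "vcarrier S = vcarrier W \<times> {k \<in> vcarrier ?D. p k = vzero W}"
    and Sa: "\<And>y k y' k'. vadd S (y, k) (y', k') = (vadd W y y', vadd ?D k k')"
    and Ss: "\<And>c y k. vscale S c (y, k) = (vscale W c y, vscale ?D c k)"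
    and Sn: "\<And>y k. vnorm S (y, k) = vnorm W y + vnorm ?D k"
    by (simp_all add: S_def direct_sum_def kernel_space_def)
  have pc: "p l \<in> vcarrier W" if "l \<in> vcarrier ?D" for l
    using p that by (auto simp: bounded_linear_map_def)
  have sc: "s y \<in> vcarrier ?D" if "y \<in> vcarrier W" for y
    using s that by (auto simp: bounded_linear_map_def)
  have pa: "p (vadd ?D l k) = vadd W (p l) (p k)" if "l \<in> vcarrier ?D" "k \<in> vcarrier ?D" for l k
    using p that by (simp add: bounded_linear_map_def)
  have psc: "p (vscale ?D c l) = vscale W c (p l)" if "l \<in> vcarrier ?D" for c l
    using p that by (simp add: bounded_linear_map_def)
  have sa: "s (vadd W y z) = vadd ?D (s y) (s z)" if "y \<in> vcarrier W" "z \<in> vcarrier W" for y z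
    using s that by (simp add: bounded_linear_map_def)
  have ss: "s (vscale W c y) = vscale ?D c (s y)" if "y \<in> vcarrier W" for c y
    using s that by (simp add: bounded_linear_map_def)
  note cl = U.dual_add_closed U.dual_scale_closed pc sc W.add_closed W.scale_closed
  define q where "q l = vadd ?D l (vscale ?D (-1) (s (p l)))" for l
  define f where "f l = (p l, q l)" for l
  define g where "g = (\<lambda>(y, k). vadd ?D (s y) k)"
  have qc: "q l \<in> vcarrier ?D" if "l \<in> vcarrier ?D" for l
    unfolding q_def using that by (intro cl)
  have qx: "q l x = l x - s (p l) x" if "x \<in> vcarrier U" for l x
    using that by (simp add: q_def U.dual_add_apply U.dual_scale_apply)
  have pq: "p (q l) = vzero W" if l: "l \<in> vcarrier ?D" for l
  proof -
    have "p (q l) = vadd W (p l) (p (vscale ?D (-1) (s (p l))))"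
      unfolding q_def using l by (intro pa cl)
    also have "\<dots> = vadd W (p l) (vscale W (-1) (p l))"
      by (simp add: psc[OF sc[OF pc[OF l]]] ps[OF pc[OF l]])
    finally show ?thesis using W.add_neg pc l by simp
  qed
  have gf: "g (f l) = l" if l: "l \<in> vcarrier ?D" for l
  proof (rule U.dual_eqI)
    show "g (f l) \<in> vcarrier ?D" using l by (auto simp: g_def f_def intro!: cl qc)
    show "g (f l) x = l x" if "x \<in> vcarrier U" for x
      using that by (simp add: g_def f_def U.dual_add_apply qx)
  qed fact
  have fg: "f (g z) = z" if z: "z \<in> vcarrier S" for z
  proof -
    obtain y k where z': "z = (y, k)" "y \<in> vcarrier W" "k \<in> vcarrier ?D" "p k = vzero W"
      using z Sc by auto
    have py: "p (vadd ?D (s y) k) = y"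
      using z' pa[of "s y" k] by (simp add: sc ps W.add_zero)
    have "q (vadd ?D (s y) k) = k"
    proof (rule U.dual_eqI)
      show "q (vadd ?D (s y) k) \<in> vcarrier ?D" using z' by (intro qc cl)
      show "q (vadd ?D (s y) k) x = k x" if "x \<in> vcarrier U" for x
        using that by (simp add: qx py U.dual_add_apply)
    qed fact
    then show ?thesis using z' py by (simp add: f_def g_def)
  qed
  have fS: "f ` vcarrier ?D \<subseteq> vcarrier S"
    by (auto simp: f_def Sc pc qc pq)
  have gD: "g ` vcarrier S \<subseteq> vcarrier ?D"
    by (auto simp: g_def Sc intro!: cl)
  have bij: "bij_betw f (vcarrier ?D) (vcarrier S)"
    using gf fg fS gD by (intro bij_betw_byWitness[where f'=g]) auto
  obtain Kp where Kp: "0 \<le> Kp" "\<And>l. l \<in> vcarrier ?D \<Longrightarrow> vnorm W (p l) \<le> Kp * vnorm ?D l"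
    using bounded_linear_map_bound[OF p U.dual_norm_nonneg] by metis
  obtain Ks where Ks: "0 \<le> Ks" "\<And>y. y \<in> vcarrier W \<Longrightarrow> vnorm ?D (s y) \<le> Ks * vnorm W y"
    using bounded_linear_map_bound[OF s W.norm_nonneg] by metis
  have "bounded_linear_map ?D S f"
    unfolding bounded_linear_map_def
  proof (intro conjI ballI allI exI)
    show "f \<in> vcarrier ?D \<rightarrow> vcarrier S" using fS by auto
    fix l assume l: "l \<in> vcarrier ?D"
    show "f (vadd ?D l k) = vadd S (f l) (f k)" if k: "k \<in> vcarrier ?D" for k
    proof -
      have "q (vadd ?D l k) = vadd ?D (q l) (q k)"
      proof (rule U.dual_eqI)
        show "q (vadd ?D l k) \<in> vcarrier ?D" "vadd ?D (q l) (q k) \<in> vcarrier ?D"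
          using l k by (auto intro!: qc cl)
        show "q (vadd ?D l k) x = vadd ?D (q l) (q k) x" if "x \<in> vcarrier U" for x
          using that l k by (simp add: qx U.dual_add_apply pa sa pc)
      qed
      then show ?thesis using l k by (simp add: f_def Sa pa)
    qed
    show "f (vscale ?D c l) = vscale S c (f l)" for c
    proof -
      have "q (vscale ?D c l) = vscale ?D c (q l)"
      proof (rule U.dual_eqI)
        show "q (vscale ?D c l) \<in> vcarrier ?D" "vscale ?D c (q l) \<in> vcarrier ?D"
          using l by (auto intro!: qc cl)
        show "q (vscale ?D c l) x = vscale ?D c (q l) x" if "x \<in> vcarrier U" for x
          using that l by (simp add: qx U.dual_scale_apply psc ss pc algebra_simps)
      qed
      then show ?thesis using l by (simp add: f_def Ss psc)
    qed
    have "vnorm ?D (q l) \<le> vnorm ?D l + vnorm ?D (vscale ?D (-1) (s (p l)))"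
      unfolding q_def using l by (intro U.dual_norm_add cl)
    also have "\<dots> \<le> vnorm ?D l + vnorm ?D (s (p l))"
      using U.dual_norm_scale[OF sc[OF pc[OF l]], of "-1"] by simp
    also have "\<dots> \<le> vnorm ?D l + Ks * vnorm W (p l)"
      using Ks(2)[OF pc[OF l]] by simp
    finally have "vnorm S (f l) \<le> vnorm W (p l) + vnorm ?D l + Ks * vnorm W (p l)"
      by (simp add: f_def Sn)
    moreover have "Ks * vnorm W (p l) \<le> Ks * (Kp * vnorm ?D l)"
      using Kp(2)[OF l] Ks(1) by (rule mult_left_mono)
    ultimately show "vnorm S (f l) \<le> (Kp + 1 + Ks * Kp) * vnorm ?D l"
      using Kp(2)[OF l] by (simp add: algebra_simps)
  qed
  moreover have "bounded_linear_map S ?D (inv_into (vcarrier ?D) f)"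
    unfolding bounded_linear_map_def
  proof (intro conjI ballI allI exI)
    have inv: "inv_into (vcarrier ?D) f z = g z" if "z \<in> vcarrier S" for z
    proof -
      have "g z \<in> vcarrier ?D" using gD that by auto
      then show ?thesis
        using inv_into_f_f[OF bij_betw_imp_inj_on[OF bij], of "g z"] fg[OF that] by simp
    qed
    show "inv_into (vcarrier ?D) f \<in> vcarrier S \<rightarrow> vcarrier ?D" using inv gD by auto
    fix z assume z: "z \<in> vcarrier S"
    then obtain y k where yk: "z = (y, k)" "y \<in> vcarrier W" "k \<in> vcarrier ?D" "p k = vzero W"
      using Sc by auto
    show "inv_into (vcarrier ?D) f (vadd S z z') =
        vadd ?D (inv_into (vcarrier ?D) f z) (inv_into (vcarrier ?D) f z')" if z': "z' \<in> vcarrier S" for z'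
    proof -
      obtain y' k' where yk': "z' = (y', k')" "y' \<in> vcarrier W" "k' \<in> vcarrier ?D" "p k' = vzero W"
        using z' Sc by auto
      have sum: "vadd S z z' \<in> vcarrier S"
        using yk yk' by (simp add: Sa Sc cl pa W.zero_closed W.add_zero)
      have "g (vadd S z z') = vadd ?D (g z) (g z')"
      proof (rule U.dual_eqI)
        show "g (vadd S z z') \<in> vcarrier ?D" "vadd ?D (g z) (g z') \<in> vcarrier ?D"
          using gD sum z z' by (auto intro!: cl)
        show "g (vadd S z z') x = vadd ?D (g z) (g z') x" if "x \<in> vcarrier U" for x
          using that yk yk' by (simp add: g_def Sa U.dual_add_apply sa)
      qed
      then show ?thesis using inv z z' sum by simp
    qed
    show "inv_into (vcarrier ?D) f (vscale S c z) = vscale ?D c (inv_into (vcarrier ?D) f z)" for c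
    proof -
      have sum: "vscale S c z \<in> vcarrier S"
        using yk by (simp add: Ss Sc cl psc W.scale_zero)
      have "g (vscale S c z) = vscale ?D c (g z)"
      proof (rule U.dual_eqI)
        show "g (vscale S c z) \<in> vcarrier ?D" "vscale ?D c (g z) \<in> vcarrier ?D"
          using gD sum z by (auto intro!: cl)
        show "g (vscale S c z) x = vscale ?D c (g z) x" if "x \<in> vcarrier U" for x
          using that yk by (simp add: g_def Ss U.dual_add_apply U.dual_scale_apply ss algebra_simps)
      qed
      then show ?thesis using inv z sum by simp
    qed
    have "vnorm ?D (g z) \<le> vnorm ?D (s y) + vnorm ?D k"
      unfolding yk(1) g_def using yk by (auto intro!: U.dual_norm_add cl)
    also have "\<dots> \<le> Ks * vnorm W y + vnorm ?D k" using Ks(2)[OF yk(2)] by simp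
    \<comment> \<open>A common factor for both summands produces the norm of the direct sum.\<close>
    also have "\<dots> \<le> (Ks + 1) * vnorm W y + (Ks + 1) * vnorm ?D k"
      using Ks(1) W.norm_nonneg[OF yk(2)] U.dual_norm_nonneg[OF yk(3)]
      by (simp add: algebra_simps add_increasing)
    finally show "vnorm ?D (inv_into (vcarrier ?D) f z) \<le> (Ks + 1) * vnorm S z"
      using inv[OF z] by (simp add: yk(1) Sn algebra_simps)
  qed
  ultimately show ?thesis
    unfolding banach_isomorphic_def using bij by (auto simp: S_def)
qed

section \<open>The spaces \<open>L\<^sup>1\<close> and \<open>L\<^sup>\<infinity>\<close>\<close>

lemma ae_class_add:
  assumes "f \<in> borel_measurable M" "g \<in> borel_measurable M"
  shows "ae_class M (\<lambda>x. rep (ae_class M f) x + rep (ae_class M g) x) = ae_class M (\<lambda>x. f x + g x)"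
proof (rule ae_class_eqI)
  show "AE x in M. rep (ae_class M f) x + rep (ae_class M g) x = f x + g x"
    using rep_ae_class(2)[OF assms(1)] rep_ae_class(2)[OF assms(2)] by eventually_elim simp
qed

lemma ae_class_scale:
  assumes "f \<in> borel_measurable M"
  shows "ae_class M (\<lambda>x. c * rep (ae_class M f) x) = ae_class M (\<lambda>x. c * f x)"
proof (rule ae_class_eqI)
  show "AE x in M. c * rep (ae_class M f) x = c * f x"
    using rep_ae_class(2)[OF assms] by eventually_elim simp
qed

lemma L1_norm:
  assumes "f \<in> borel_measurable M"
  shows "vnorm (L1_space M) (ae_class M f) = (\<integral>x. cmod (f x) \<partial>M)"
  unfolding L1_space_def using rep_ae_class[OF assms] assms
  by simp (intro integral_cong_AE; auto)

lemma seminormed_space_L1: "seminormed_space (L1_space M)"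
proof
  let ?L = "L1_space M"
  have [simp]: "vzero ?L = ae_class M (\<lambda>x. 0)" "\<And>F G. vadd ?L F G = ae_class M (\<lambda>x. rep F x + rep G x)"
    "\<And>c F. vscale ?L c F = ae_class M (\<lambda>x. c * rep F x)" by (simp_all add: L1_space_def)
  fix x y c
  show "vzero ?L \<in> vcarrier ?L" by (simp add: L1_carrierI)
  show "vscale ?L c (vzero ?L) = vzero ?L" using ae_class_scale[of "\<lambda>x. 0" M c] by simp
  show "vnorm ?L (vzero ?L) = 0" by (simp add: L1_norm)
  assume x: "x \<in> vcarrier ?L"
  note x' = L1_carrier[OF x]
  show "vadd ?L x y \<in> vcarrier ?L" if "y \<in> vcarrier ?L"
    using x' L1_carrier[OF that] by (simp add: L1_carrierI)
  show "vscale ?L c x \<in> vcarrier ?L" using x' by (simp add: L1_carrierI)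
  show "vadd ?L x (vzero ?L) = x"
    using ae_class_add[OF x'(3), of "\<lambda>x. 0"] x'(2) by simp
  show "vadd ?L x (vscale ?L (-1) x) = vzero ?L"
    using ae_class_add[OF x'(3), of "\<lambda>t. -1 * rep x t"] x'(2,3) by simp
  show "0 \<le> vnorm ?L x" by (simp add: L1_space_def)
qed

lemma Linf_norm_nonneg: "0 \<le> vnorm (Linf_space M) F"
  by (simp add: Linf_space_def)

text \<open>\<open>enn2real\<close> would turn an infinite essential supremum into 0. Finiteness is
  first transferred to the chosen representative along a.e. equality; only then is the norm a
  genuine a.e. bound.\<close>

lemma Linf_carrier:
  assumes "F \<in> vcarrier (Linf_space M)"
  shows "rep F \<in> borel_measurable M" "ae_class M (rep F) = F"
    "AE x in M. cmod (rep F x) \<le> vnorm (Linf_space M) F"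
proof -
  obtain f where f: "f \<in> borel_measurable M" "esssup M (\<lambda>x. ennreal (cmod (f x))) < \<infinity>" "F = ae_class M f"
    using assms by (auto simp: Linf_space_def)
  note r = rep_ae_class[OF f(1), folded f(3)]
  show "rep F \<in> borel_measurable M" by (rule r)
  show "ae_class M (rep F) = F" using ae_class_rep[OF f(1)] f(3) by simp
  have "AE x in M. ennreal (cmod (rep F x)) \<le> esssup M (\<lambda>x. ennreal (cmod (f x)))"
    using r(2) esssup_AE[where M=M and f="\<lambda>x. ennreal (cmod (f x))"] by eventually_elim simp
  then have "esssup M (\<lambda>x. ennreal (cmod (rep F x))) \<le> esssup M (\<lambda>x. ennreal (cmod (f x)))"
    using r(1) by (intro esssup_I) auto
  then have "esssup M (\<lambda>x. ennreal (cmod (rep F x))) < top" using f(2) by (simp add: le_less_trans)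
  then have eq: "esssup M (\<lambda>x. ennreal (cmod (rep F x))) = ennreal (vnorm (Linf_space M) F)"
    by (simp add: Linf_space_def)
  have "AE x in M. ennreal (cmod (rep F x)) \<le> ennreal (vnorm (Linf_space M) F)"
    unfolding eq[symmetric] by (rule esssup_AE)
  then show "AE x in M. cmod (rep F x) \<le> vnorm (Linf_space M) F"
    by (simp add: Linf_norm_nonneg)
qed

lemma Linf_carrierI:
  assumes f: "f \<in> borel_measurable M" and c: "AE x in M. cmod (f x) \<le> c" "0 \<le> c"
  shows "ae_class M f \<in> vcarrier (Linf_space M)" "vnorm (Linf_space M) (ae_class M f) \<le> c"
proof -
  have "esssup M (\<lambda>x. ennreal (cmod (f x))) \<le> ennreal c"
    using f c by (intro esssup_I) (auto simp: ennreal_leI)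
  then have "esssup M (\<lambda>x. ennreal (cmod (f x))) < \<infinity>"
    by (simp add: le_less_trans)
  then show "ae_class M f \<in> vcarrier (Linf_space M)" using f by (auto simp: Linf_space_def)
  have "AE x in M. ennreal (cmod (rep (ae_class M f) x)) \<le> ennreal c"
    using rep_ae_class(2)[OF f] c(1) by eventually_elim (simp add: ennreal_leI)
  then have "esssup M (\<lambda>x. ennreal (cmod (rep (ae_class M f) x))) \<le> ennreal c"
    using rep_ae_class(1)[OF f] by (intro esssup_I) auto
  then show "vnorm (Linf_space M) (ae_class M f) \<le> c"
    using c(2) by (simp add: Linf_space_def enn2real_leI)
qed

lemma Linf_ops [simp]:
  "vzero (Linf_space M) = ae_class M (\<lambda>x. 0)"
  "vadd (Linf_space M) F G = ae_class M (\<lambda>x. rep F x + rep G x)"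
  "vscale (Linf_space M) c F = ae_class M (\<lambda>x. c * rep F x)"
  by (simp_all add: Linf_space_def)

lemma seminormed_space_Linf: "seminormed_space (Linf_space M)"
proof
  let ?L = "Linf_space M"
  fix x y c
  have z: "vzero ?L \<in> vcarrier ?L" "vnorm ?L (vzero ?L) \<le> 0"
    using Linf_carrierI[of "\<lambda>x. 0" M 0] by auto
  show "vzero ?L \<in> vcarrier ?L" by (rule z)
  show "vscale ?L c (vzero ?L) = vzero ?L" using ae_class_scale[of "\<lambda>x. 0" M c] by simp
  show "vnorm ?L (vzero ?L) = 0" using z(2) Linf_norm_nonneg[of M "vzero ?L"] by linarith
  assume x: "x \<in> vcarrier ?L"
  note x' = Linf_carrier[OF x]
  show "vadd ?L x y \<in> vcarrier ?L" if y: "y \<in> vcarrier ?L"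
  proof -
    note y' = Linf_carrier[OF y]
    have "AE t in M. cmod (rep x t + rep y t) \<le> vnorm ?L x + vnorm ?L y"
      using x'(3) y'(3) by eventually_elim (metis add_mono norm_triangle_le)
    then have "ae_class M (\<lambda>t. rep x t + rep y t) \<in> vcarrier ?L"
      using x'(1) y'(1) by (intro Linf_carrierI(1)[of _ M "vnorm ?L x + vnorm ?L y"]) (auto simp: Linf_norm_nonneg)
    then show ?thesis by simp
  qed
  show "vscale ?L c x \<in> vcarrier ?L"
  proof -
    have "AE t in M. cmod (c * rep x t) \<le> cmod c * vnorm ?L x"
      using x'(3) by eventually_elim (simp add: norm_mult mult_left_mono)
    then have "ae_class M (\<lambda>t. c * rep x t) \<in> vcarrier ?L"
      using x'(1) by (intro Linf_carrierI(1)[of _ M "cmod c * vnorm ?L x"]) (auto simp: Linf_norm_nonneg)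
    then show ?thesis by simp
  qed
  show "vadd ?L x (vzero ?L) = x"
    using ae_class_add[OF x'(1), of "\<lambda>x. 0"] x'(2) by simp
  show "vadd ?L x (vscale ?L (-1) x) = vzero ?L"
    using ae_class_add[OF x'(1), of "\<lambda>t. -1 * rep x t"] x'(1,2) by simp
  show "0 \<le> vnorm ?L x" by (rule Linf_norm_nonneg)
qed

section \<open>The map \<open>\<phi>\<close> and its right inverse\<close>

text \<open>The measure \<open>G dm\<close>, with the \<open>if\<close> enforcing the normalisation
  in \<open>complex_measure\<close>.\<close>

definition class_measure :: "'a measure \<Rightarrow> ('a set \<Rightarrow> complex) \<Rightarrow> ('a \<Rightarrow> complex) set \<Rightarrow> 'a set \<Rightarrow> complex" where
  "class_measure B m G E =
     (if E \<in> sets B then complex_integral B m (\<lambda>x. indicator E x * rep G x) else 0)"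

lemma has_density_class_measure:
  assumes "complex_measure B m" "G \<in> vcarrier (L1_space (total_variation B m))"
  shows "has_density B (class_measure B m G) (total_variation B m) (\<lambda>x. rep G x * polar_density B m x)"
  using assms by (rule has_density_L1) (simp add: class_measure_def)

lemma complex_measure_class_measure:
  assumes "complex_measure B m" "G \<in> vcarrier (L1_space (total_variation B m))"
  shows "complex_measure B (class_measure B m G)"
  by (rule complex_measure_if_has_density[OF has_density_class_measure[OF assms]])
    (simp add: class_measure_def)

lemma abs_cont_class_measure:
  assumes "complex_measure B m"
  shows "abs_cont_wrt B m (class_measure B m G)"
  unfolding abs_cont_wrt_def
proof
  fix E assume E: "E \<in> null_sets (total_variation B m)"
  have "AE x in total_variation B m. indicator E x * rep G x * polar_density B m x = 0"
    using AE_not_in[OF E] by eventually_elim simp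
  then show "class_measure B m G E = 0"
    by (simp add: class_measure_def complex_integral_def integral_eq_zero_AE)
qed

lemma class_measure_lincomb:
  fixes c :: complex
  assumes m: "complex_measure B m"
    and G: "G \<in> vcarrier (L1_space (total_variation B m))" and H: "H \<in> vcarrier (L1_space (total_variation B m))"
  defines "N \<equiv> ae_class (total_variation B m) (\<lambda>x. rep G x + c * rep H x)"
  shows "N \<in> vcarrier (L1_space (total_variation B m))"
    and "class_measure B m N = (\<lambda>E. class_measure B m G E + c * class_measure B m H E)"
proof -
  let ?M = "total_variation B m" and ?p = "polar_density B m"
  note G' = L1_carrier[OF G] and H' = L1_carrier[OF H]
  show N: "N \<in> vcarrier (L1_space ?M)"
    unfolding N_def using G' H' by (intro L1_carrierI) simp
  have ae: "AE x in ?M. rep N x = rep G x + c * rep H x"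
    unfolding N_def using G' H' by (intro rep_ae_class) simp
  note dN = has_density_class_measure[OF m N]
  note dGH = has_density_lincomb[OF has_density_class_measure[OF m G] has_density_class_measure[OF m H], of c]
  show "class_measure B m N = (\<lambda>E. class_measure B m G E + c * class_measure B m H E)"
  proof
    fix E
    show "class_measure B m N E = class_measure B m G E + c * class_measure B m H E"
    proof (cases "E \<in> sets B")
      case E: True
      have "class_measure B m N E = (\<integral>x. indicator E x * (rep N x * ?p x) \<partial>?M)"
        using dN E by (simp add: has_density_def)
      also have "\<dots> = (\<integral>x. indicator E x * (rep G x * ?p x + c * (rep H x * ?p x)) \<partial>?M)"
      proof (rule integral_cong_AE)
        show "AE x in ?M. indicator E x * (rep N x * ?p x) =
            indicator E x * (rep G x * ?p x + c * (rep H x * ?p x))"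
          using ae by eventually_elim (simp add: algebra_simps)
        show "(\<lambda>x. indicator E x * (rep N x * ?p x)) \<in> borel_measurable ?M"
          "(\<lambda>x. indicator E x * (rep G x * ?p x + c * (rep H x * ?p x))) \<in> borel_measurable ?M"
          using dN dGH E integrable_indicator_times[of ?M _ E]
          by (auto simp: has_density_def intro!: borel_measurable_integrable)
      qed
      also have "\<dots> = class_measure B m G E + c * class_measure B m H E"
        using dGH E unfolding has_density_def by (metis (no_types, lifting))
      finally show ?thesis .
    qed (simp add: class_measure_def)
  qed
qed

section \<open>The map \<open>phi\<close>: evaluation, linearity, boundedness\<close>

locale regular_measure_space =
  fixes X :: "'a topology" and m :: "'a set \<Rightarrow> complex"
  assumes compact: "compact_space X" and Hausdorff: "Hausdorff_space X"
    and regular: "regular_complex_borel_measure X m"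
begin

abbreviation "B \<equiv> borel_of X"
abbreviation "M \<equiv> var_measure X m"
abbreviation "p \<equiv> polar_density B m"
abbreviation "Linf \<equiv> Linf_space M"

lemma m: "complex_measure B m"
  using regular by (simp add: regular_complex_borel_measure_def)

sublocale finite_measure M
  by (rule finite_measure_total_variation[OF m])

sublocale Linf: seminormed_space Linf
  by (rule seminormed_space_Linf)

sublocale L1: seminormed_space "L1 X m"
  by (rule seminormed_space_L1)

lemma canonical_map_Linf:
  assumes f: "continuous_map X euclidean f" and c: "\<And>x. x \<in> topspace X \<Longrightarrow> cmod (f x) \<le> c" "0 \<le> c"
  shows "canonical_map X m f \<in> vcarrier Linf" "vnorm Linf (canonical_map X m f) \<le> c"
proof -
  have f': "f \<in> borel_measurable M" by (rule continuous_map_borel_measurable[OF f]) simp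
  have ae: "AE x in M. cmod (f x) \<le> c" using c by (intro AE_I2) simp
  show "canonical_map X m f \<in> vcarrier Linf" "vnorm Linf (canonical_map X m f) \<le> c"
    unfolding canonical_map_def using Linf_carrierI[OF f' ae c(2)] by auto
qed

lemma canonical_map_carrier:
  assumes f: "continuous_map X euclidean f" shows "canonical_map X m f \<in> vcarrier Linf"
  using continuous_map_compact_bounded[OF compact f] canonical_map_Linf(1)[OF f] by (metis less_imp_le)

lemma canonical_map_lincomb:
  assumes f: "continuous_map X euclidean f" and g: "continuous_map X euclidean g"
  shows "canonical_map X m (\<lambda>x. f x + c * g x) =
    vadd Linf (canonical_map X m f) (vscale Linf c (canonical_map X m g))"
proof -
  have [measurable]: "f \<in> borel_measurable M" "g \<in> borel_measurable M"
    using f g by (auto intro!: continuous_map_borel_measurable)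
  show ?thesis
    unfolding canonical_map_def Linf_ops by (subst ae_class_scale) (simp_all add: ae_class_add)
qed

text \<open>Resolves the three descriptions inside \<open>phi\<close> at once by their uniqueness
  lemmas. Linearity and the right inverse property reduce to naming \<mu> and its singular
  part.\<close>

lemma phi_eqI:
  assumes \<mu>: "regular_complex_borel_measure X \<mu>"
      "\<And>f. continuous_map X euclidean f \<Longrightarrow> l (canonical_map X m f) = complex_integral B \<mu> f"
    and G: "G \<in> vcarrier (L1 X m)" and s: "complex_measure B \<mu>s" "singular_wrt B m \<mu>s"
    and eq: "\<mu> = (\<lambda>E. class_measure B m G E + \<mu>s E)"
  shows "phi X m l = G"
proof -
  have "riesz_measure X (l \<circ> canonical_map X m) = \<mu>"
    using \<mu> by (intro riesz_measure_eqI compact Hausdorff) auto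
  moreover have "lebesgue_ac_part B m \<mu> = class_measure B m G"
    by (rule lebesgue_ac_part_eqI[OF complex_measure_class_measure[OF m G] abs_cont_class_measure[OF m] s eq])
  moreover have "radon_nikodym_class B m (class_measure B m G) = G"
    by (rule radon_nikodym_class_eqI[OF m G]) (simp add: class_measure_def)
  ultimately show ?thesis by (simp add: phi_def)
qed

text \<open>The canonical map does not increase norms, so \<open>riesz_complex\<close> applies with
  the dual norm of \<open>l\<close> as \<open>C\<close>. Passing to the absolutely continuous part
  does not increase the variation, which for \<open>G dm\<close> is the L1 norm of
  \<open>G\<close>.\<close>

lemma phi_decomposition:
  assumes l: "l \<in> vcarrier (Linf_dual X m)"
  obtains \<mu> \<mu>s where "regular_complex_borel_measure X \<mu>"
      "\<And>f. continuous_map X euclidean f \<Longrightarrow> l (canonical_map X m f) = complex_integral B \<mu> f"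
      "phi X m l \<in> vcarrier (L1 X m)" "complex_measure B \<mu>s" "singular_wrt B m \<mu>s"
      "\<mu> = (\<lambda>E. class_measure B m (phi X m l) E + \<mu>s E)"
      "vnorm (L1 X m) (phi X m l) \<le> 4 * vnorm (Linf_dual X m) l"
proof -
  let ?\<psi> = "\<lambda>f. l (canonical_map X m f)"
  have lin: "?\<psi> (\<lambda>x. f x + c * g x) = ?\<psi> f + c * ?\<psi> g"
    if f: "continuous_map X euclidean f" and g: "continuous_map X euclidean g" for f g c
    using l canonical_map_carrier[OF f] canonical_map_carrier[OF g]
    unfolding canonical_map_lincomb[OF f g] Linf.in_dual_iff by (simp add: Linf.scale_closed del: Linf_ops)
  have bound: "cmod (?\<psi> f) \<le> vnorm (Linf_dual X m) l"
    if f: "continuous_map X euclidean f" and "\<And>x. x \<in> topspace X \<Longrightarrow> cmod (f x) \<le> 1" for f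
    using canonical_map_Linf[OF f, of 1] that(2) by (intro Linf.dual_norm_upper l) auto
  obtain \<mu> where \<mu>: "regular_complex_borel_measure X \<mu>"
      "\<And>f. continuous_map X euclidean f \<Longrightarrow> ?\<psi> f = complex_integral B \<mu> f"
      "measure (var_measure X \<mu>) (topspace X) \<le> 4 * vnorm (Linf_dual X m) l"
    using riesz_complex[of X ?\<psi>, OF compact Hausdorff lin bound] by metis
  have \<mu>c: "complex_measure B \<mu>" using \<mu>(1) by (simp add: regular_complex_borel_measure_def)
  obtain \<mu>a \<mu>s where d: "complex_measure B \<mu>a" "abs_cont_wrt B m \<mu>a"
    "complex_measure B \<mu>s" "singular_wrt B m \<mu>s" "\<mu> = (\<lambda>E. \<mu>a E + \<mu>s E)"
    "emeasure (total_variation B \<mu>a) (space B) \<le> emeasure (total_variation B \<mu>) (space B)"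
    using Lebesgue_decomposition_complex[OF m \<mu>c] .
  obtain G where G: "G \<in> vcarrier (L1 X m)"
      "\<And>E. E \<in> sets B \<Longrightarrow> \<mu>a E = complex_integral B m (\<lambda>x. indicator E x * rep G x)"
    using radon_nikodym_complex[OF m d(1,2)] by blast
  have \<mu>a: "\<mu>a = class_measure B m G"
    using G(2) complex_measure_outside[OF d(1)] by (auto simp: class_measure_def)
  have phi: "phi X m l = G"
    by (rule phi_eqI[OF \<mu>(1,2) G(1) d(3,4)]) (simp_all add: d(5) \<mu>a)
  interpret T: finite_measure "var_measure X \<mu>" by (rule finite_measure_total_variation[OF \<mu>c])
  have "ennreal (vnorm (L1 X m) G) = emeasure (total_variation B \<mu>a) (space B)"
    using emeasure_total_variation_L1[OF m G(1)] G(2) by metis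
  also have "\<dots> \<le> ennreal (measure (var_measure X \<mu>) (topspace X))"
    using d(6) by (simp add: T.emeasure_eq_measure)
  finally have "vnorm (L1 X m) G \<le> measure (var_measure X \<mu>) (topspace X)" by simp
  then have "vnorm (L1 X m) G \<le> 4 * vnorm (Linf_dual X m) l" using \<mu>(3) by linarith
  then show ?thesis using that[OF \<mu>(1,2)] G(1) d phi \<mu>a by blast
qed

text \<open>If \<mu> and \<nu> represent \<open>l\<close> and \<open>k\<close>, then \<mu> + c \<nu>
  represents \<open>n\<close>, and the absolutely continuous and singular parts combine
  alike.\<close>

lemma phi_lincomb:
  assumes l: "l \<in> vcarrier (Linf_dual X m)" and k: "k \<in> vcarrier (Linf_dual X m)"
    and n: "\<And>F. F \<in> vcarrier Linf \<Longrightarrow> n F = l F + c * k F"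
  shows "phi X m n = ae_class M (\<lambda>x. rep (phi X m l) x + c * rep (phi X m k) x)"
proof -
  obtain \<mu> \<mu>s where \<mu>: "regular_complex_borel_measure X \<mu>"
      "\<And>f. continuous_map X euclidean f \<Longrightarrow> l (canonical_map X m f) = complex_integral B \<mu> f"
      "phi X m l \<in> vcarrier (L1 X m)" "complex_measure B \<mu>s" "singular_wrt B m \<mu>s"
      "\<mu> = (\<lambda>E. class_measure B m (phi X m l) E + \<mu>s E)"
    using phi_decomposition[OF l] by metis
  obtain \<nu> \<nu>s where \<nu>: "regular_complex_borel_measure X \<nu>"
      "\<And>f. continuous_map X euclidean f \<Longrightarrow> k (canonical_map X m f) = complex_integral B \<nu> f"
      "phi X m k \<in> vcarrier (L1 X m)" "complex_measure B \<nu>s" "singular_wrt B m \<nu>s"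
      "\<nu> = (\<lambda>E. class_measure B m (phi X m k) E + \<nu>s E)"
    using phi_decomposition[OF k] by metis
  note cl = class_measure_lincomb[OF m \<mu>(3) \<nu>(3), of c]
  show ?thesis
  proof (rule phi_eqI)
    show "regular_complex_borel_measure X (\<lambda>E. \<mu> E + c * \<nu> E)"
      by (rule regular_lincomb[OF compact \<mu>(1) \<nu>(1)])
    show "n (canonical_map X m f) = complex_integral B (\<lambda>E. \<mu> E + c * \<nu> E) f"
      if f: "continuous_map X euclidean f" for f
      using \<mu>(1) \<nu>(1) n[OF canonical_map_carrier[OF f]] \<mu>(2)[OF f] \<nu>(2)[OF f]
        complex_integral_lincomb_continuous[OF compact _ _ f, of \<mu> \<nu> c]
      by (simp add: regular_complex_borel_measure_def)
    show "complex_measure B (\<lambda>E. \<mu>s E + c * \<nu>s E)" by (rule complex_measure_lincomb[OF \<mu>(4) \<nu>(4)])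
    show "singular_wrt B m (\<lambda>E. \<mu>s E + c * \<nu>s E)" by (rule singular_wrt_lincomb[OF \<mu>(5) \<nu>(5)])
    show "(\<lambda>E. \<mu> E + c * \<nu> E) = (\<lambda>E. class_measure B m (ae_class M (\<lambda>x. rep (phi X m l) x
        + c * rep (phi X m k) x)) E + (\<mu>s E + c * \<nu>s E))"
    proof
      fix E
      have "\<mu> E = class_measure B m (phi X m l) E + \<mu>s E" "\<nu> E = class_measure B m (phi X m k) E + \<nu>s E"
        using \<mu>(6) \<nu>(6) by metis+
      then show "\<mu> E + c * \<nu> E = class_measure B m (ae_class M (\<lambda>x. rep (phi X m l) x
          + c * rep (phi X m k) x)) E + (\<mu>s E + c * \<nu>s E)"
        unfolding cl(2) by (simp add: algebra_simps)
    qed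
  qed (rule cl(1))
qed

lemma bounded_linear_phi: "bounded_linear_map (Linf_dual X m) (L1 X m) (phi X m)"
  unfolding bounded_linear_map_def
proof (intro conjI ballI allI)
  show "phi X m \<in> vcarrier (Linf_dual X m) \<rightarrow> vcarrier (L1 X m)"
    using phi_decomposition by blast
  fix l assume l: "l \<in> vcarrier (Linf_dual X m)"
  show "phi X m (vadd (Linf_dual X m) l k) = vadd (L1 X m) (phi X m l) (phi X m k)"
    if k: "k \<in> vcarrier (Linf_dual X m)" for k
    using phi_lincomb[OF l k, of "vadd (Linf_dual X m) l k" 1]
    by (simp add: Linf.dual_add_apply L1_space_def)
  \<comment> \<open>Scaling is the linear combination c l = l + (c - 1) l.\<close>
  show "phi X m (vscale (Linf_dual X m) c l) = vscale (L1 X m) c (phi X m l)" for c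
    using phi_lincomb[OF l l, of "vscale (Linf_dual X m) c l" "c - 1"]
    by (simp add: Linf.dual_scale_apply L1_space_def algebra_simps)
next
  show "\<exists>K. \<forall>l\<in>vcarrier (Linf_dual X m). vnorm (L1 X m) (phi X m l) \<le> K * vnorm (Linf_dual X m) l"
    using phi_decomposition by (intro exI[of _ 4] ballI) blast
qed

section \<open>The right inverse of \<open>phi\<close>\<close>

text \<open>The factor \<open>p\<close> converts integration against |m| into integration against
  \<open>m\<close>; the restriction to the carrier matches the extensional functions in
  \<open>dual\<close>.\<close>

definition section_map :: "('a \<Rightarrow> complex) set \<Rightarrow> ('a \<Rightarrow> complex) set \<Rightarrow> complex" where
  "section_map G = (\<lambda>F\<in>vcarrier Linf. \<integral>x. rep F x * (rep G x * p x) \<partial>M)"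

lemma measurable_p [measurable]: "p \<in> borel_measurable M"
  using polar_density(1)[OF m] by (simp cong: measurable_cong_sets)

lemma integrable_section:
  assumes F: "F \<in> vcarrier Linf" and G: "G \<in> vcarrier (L1 X m)"
  shows "integrable M (\<lambda>x. rep F x * (rep G x * p x))"
proof (rule Bochner_Integration.integrable_bound)
  have [measurable]: "rep F \<in> borel_measurable M" "rep G \<in> borel_measurable M"
    using Linf_carrier[OF F] L1_carrier[OF G] by auto
  show "integrable M (\<lambda>x. vnorm Linf F * cmod (rep G x))" using L1_carrier[OF G] by simp
  show "(\<lambda>x. rep F x * (rep G x * p x)) \<in> borel_measurable M" by measurable
  show "AE x in M. cmod (rep F x * (rep G x * p x)) \<le> norm (vnorm Linf F * cmod (rep G x))"
    using Linf_carrier(3)[OF F] AE_space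
    by eventually_elim (simp add: norm_mult polar_density(2)[OF m] abs_mult Linf_norm_nonneg mult_right_mono)
qed

lemma section_map_bound:
  assumes F: "F \<in> vcarrier Linf" and G: "G \<in> vcarrier (L1 X m)"
  shows "cmod (section_map G F) \<le> vnorm (L1 X m) G * vnorm Linf F"
proof -
  have "cmod (section_map G F) \<le> (\<integral>x. cmod (rep F x * (rep G x * p x)) \<partial>M)"
    using F by (simp add: section_map_def integral_norm_bound)
  also have "\<dots> \<le> (\<integral>x. vnorm Linf F * cmod (rep G x) \<partial>M)"
  proof (rule integral_mono_AE)
    show "integrable M (\<lambda>x. cmod (rep F x * (rep G x * p x)))" using integrable_section[OF F G] by simp
    show "integrable M (\<lambda>x. vnorm Linf F * cmod (rep G x))" using L1_carrier[OF G] by simp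
    show "AE x in M. cmod (rep F x * (rep G x * p x)) \<le> vnorm Linf F * cmod (rep G x)"
      using Linf_carrier(3)[OF F] AE_space
      by eventually_elim (simp add: norm_mult polar_density(2)[OF m] mult_right_mono)
  qed
  also have "\<dots> = vnorm (L1 X m) G * vnorm Linf F" by (simp add: L1_space_def)
  finally show ?thesis .
qed

text \<open>Representatives are chosen, so \<open>rep\<close> respects sums and multiples only a.e.;
  this passes such identities to the integral.\<close>

lemma section_map_cong:
  assumes F: "F \<in> vcarrier Linf" and G: "G \<in> vcarrier (L1 X m)"
    and f: "integrable M f" and ae: "AE x in M. rep F x * (rep G x * p x) = f x"
  shows "section_map G F = (\<integral>x. f x \<partial>M)"
  using F integrable_section[OF F G] f ae by (auto simp: section_map_def intro!: integral_cong_AE)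

lemma section_map_dual:
  assumes G: "G \<in> vcarrier (L1 X m)"
  shows "section_map G \<in> vcarrier (Linf_dual X m)"
  unfolding Linf.in_dual_iff
proof (intro conjI ballI allI)
  show "section_map G \<in> extensional (vcarrier Linf)" by (simp add: section_map_def)
  show "\<exists>K. \<forall>F\<in>vcarrier Linf. cmod (section_map G F) \<le> K * vnorm Linf F"
    using section_map_bound[OF _ G] by blast
  fix F assume F: "F \<in> vcarrier Linf"
  show "section_map G (vadd Linf F H) = section_map G F + section_map G H" if H: "H \<in> vcarrier Linf" for H
  proof -
    have ae: "AE x in M. rep (vadd Linf F H) x = rep F x + rep H x"
      using Linf_carrier(1)[OF F] Linf_carrier(1)[OF H] by (simp add: rep_ae_class(2))
    have "section_map G (vadd Linf F H) = (\<integral>x. rep F x * (rep G x * p x) + rep H x * (rep G x * p x) \<partial>M)"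
      using integrable_section[OF F G] integrable_section[OF H G]
    proof (intro section_map_cong Linf.add_closed F H G)
      show "AE x in M. rep (vadd Linf F H) x * (rep G x * p x)
          = rep F x * (rep G x * p x) + rep H x * (rep G x * p x)"
        using ae by eventually_elim (simp add: algebra_simps del: Linf_ops)
    qed simp
    then show ?thesis
      using integrable_section[OF F G] integrable_section[OF H G] F H by (simp add: section_map_def)
  qed
  show "section_map G (vscale Linf c F) = c * section_map G F" for c
  proof -
    have ae: "AE x in M. rep (vscale Linf c F) x = c * rep F x"
      using Linf_carrier(1)[OF F] by (simp only: Linf_ops) (intro rep_ae_class(2), simp)
    have "section_map G (vscale Linf c F) = (\<integral>x. c * (rep F x * (rep G x * p x)) \<partial>M)"
    proof (intro section_map_cong Linf.scale_closed F G)
      show "AE x in M. rep (vscale Linf c F) x * (rep G x * p x) = c * (rep F x * (rep G x * p x))"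
        using ae by eventually_elim (simp add: algebra_simps del: Linf_ops)
    qed (use integrable_section[OF F G] in simp)
    then show ?thesis using F by (simp add: section_map_def)
  qed
qed

lemma section_map_lincomb:
  assumes G: "G \<in> vcarrier (L1 X m)" and H: "H \<in> vcarrier (L1 X m)" and N: "N \<in> vcarrier (L1 X m)"
    and ae: "AE x in M. rep N x = rep G x + c * rep H x" and F: "F \<in> vcarrier Linf"
  shows "section_map N F = section_map G F + c * section_map H F"
proof -
  note i = integrable_section[OF F G] integrable_section[OF F H]
  have "section_map N F = (\<integral>x. rep F x * (rep G x * p x) + c * (rep F x * (rep H x * p x)) \<partial>M)"
  proof (rule section_map_cong[OF F N])
    show "AE x in M. rep F x * (rep N x * p x) = rep F x * (rep G x * p x) + c * (rep F x * (rep H x * p x))"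
      using ae by eventually_elim (simp add: algebra_simps)
  qed (use i in simp)
  then show ?thesis using F i by (simp add: section_map_def)
qed

lemma bounded_linear_section_map: "bounded_linear_map (L1 X m) (Linf_dual X m) section_map"
  unfolding bounded_linear_map_def
proof (intro conjI ballI allI exI)
  show "section_map \<in> vcarrier (L1 X m) \<rightarrow> vcarrier (Linf_dual X m)" using section_map_dual by auto
  fix G assume G: "G \<in> vcarrier (L1 X m)"
  show "section_map (vadd (L1 X m) G H) = vadd (Linf_dual X m) (section_map G) (section_map H)"
    if H: "H \<in> vcarrier (L1 X m)" for H
  proof (rule Linf.dual_eqI)
    have N: "vadd (L1 X m) G H \<in> vcarrier (L1 X m)" by (rule L1.add_closed[OF G H])
    then show "section_map (vadd (L1 X m) G H) \<in> vcarrier (Linf_dual X m)" by (rule section_map_dual)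
    show "vadd (Linf_dual X m) (section_map G) (section_map H) \<in> vcarrier (Linf_dual X m)"
      using G H by (intro Linf.dual_add_closed section_map_dual)
    have "AE x in M. rep (vadd (L1 X m) G H) x = rep G x + 1 * rep H x"
      using L1_carrier(3)[OF G] L1_carrier(3)[OF H] by (simp add: L1_space_def rep_ae_class(2))
    then show "section_map (vadd (L1 X m) G H) F = vadd (Linf_dual X m) (section_map G) (section_map H) F"
      if "F \<in> vcarrier Linf" for F
      using section_map_lincomb[OF G H N _ that, of 1] that by (simp add: Linf.dual_add_apply)
  qed
  show "section_map (vscale (L1 X m) c G) = vscale (Linf_dual X m) c (section_map G)" for c
  proof (rule Linf.dual_eqI)
    have N: "vscale (L1 X m) c G \<in> vcarrier (L1 X m)" by (rule L1.scale_closed[OF G])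
    then show "section_map (vscale (L1 X m) c G) \<in> vcarrier (Linf_dual X m)" by (rule section_map_dual)
    show "vscale (Linf_dual X m) c (section_map G) \<in> vcarrier (Linf_dual X m)"
      using G by (intro Linf.dual_scale_closed section_map_dual)
    have "AE x in M. rep (vscale (L1 X m) c G) x = c * rep G x"
      using L1_carrier(3)[OF G] by (simp add: L1_space_def rep_ae_class(2))
    \<comment> \<open>Written as G + (c - 1) G to fit \<open>section_map_lincomb\<close>.\<close>
    then have "AE x in M. rep (vscale (L1 X m) c G) x = rep G x + (c - 1) * rep G x"
      by eventually_elim (simp add: algebra_simps)
    then show "section_map (vscale (L1 X m) c G) F = vscale (Linf_dual X m) c (section_map G) F"
      if "F \<in> vcarrier Linf" for F
      using section_map_lincomb[OF G G N _ that, of "c - 1"] that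
      by (simp add: Linf.dual_scale_apply algebra_simps)
  qed
  show "vnorm (Linf_dual X m) (section_map G) \<le> 1 * vnorm (L1 X m) G"
  proof (rule Linf.dual_norm_least)
    fix F assume F: "F \<in> vcarrier Linf" "vnorm Linf F \<le> 1"
    have "cmod (section_map G F) \<le> vnorm (L1 X m) G * vnorm Linf F" by (rule section_map_bound[OF F(1) G])
    also have "\<dots> \<le> vnorm (L1 X m) G * 1" by (intro mult_left_mono F L1.norm_nonneg G)
    finally show "cmod (section_map G F) \<le> 1 * vnorm (L1 X m) G" by simp
  qed
qed

lemma regular_class_measure:
  assumes G: "G \<in> vcarrier (L1 X m)"
  shows "regular_complex_borel_measure X (class_measure B m G)"
proof -
  note c = complex_measure_class_measure[OF m G]
  have tv: "var_measure X (class_measure B m G) = density M (\<lambda>x. ennreal (cmod (rep G x)))"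
    by (rule total_variation_L1[OF m G]) (simp add: class_measure_def)
  have "absolutely_continuous M (var_measure X (class_measure B m G))"
    unfolding tv using L1_carrier(3)[OF G] by (intro absolutely_continuousI_density) simp
  moreover have "squeezable X M"
    using regular regular_iff_squeezable[OF compact] by blast
  ultimately have "squeezable X (var_measure X (class_measure B m G))"
    using squeezable_absolutely_continuous[OF _ finite_measure_axioms finite_measure_total_variation[OF c]]
    by simp
  then show ?thesis using c by (simp add: regular_iff_squeezable[OF compact])
qed

text \<open>\<open>phi_eqI\<close> is applied with \<open>G dm\<close> itself and singular part 0.
  The representative of the class of a continuous \<open>f\<close> equals \<open>f\<close> only
  a.e., which the integral does not see.\<close>

lemma phi_section_map:
  assumes G: "G \<in> vcarrier (L1 X m)"
  shows "phi X m (section_map G) = G"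
proof (rule phi_eqI[OF regular_class_measure[OF G] _ G])
  fix f :: "'a \<Rightarrow> complex" assume f: "continuous_map X euclidean f"
  have fM: "f \<in> borel_measurable M" by (rule continuous_map_borel_measurable[OF f]) simp
  have i: "integrable M (\<lambda>x. f x * (rep G x * p x))"
    using has_density_class_measure[OF m G]
    by (intro integrable_continuous_times[OF compact f]) (auto simp: has_density_def)
  have "AE x in M. rep (canonical_map X m f) x * (rep G x * p x) = f x * (rep G x * p x)"
    unfolding canonical_map_def using rep_ae_class(2)[OF fM] by eventually_elim simp
  then have "section_map G (canonical_map X m f) = (\<integral>x. f x * (rep G x * p x) \<partial>M)"
    by (rule section_map_cong[OF canonical_map_carrier[OF f] G i])
  also have "\<dots> = complex_integral B (class_measure B m G) f"
    by (rule complex_integral_eq[OF complex_measure_class_measure[OF m G]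
          has_density_class_measure[OF m G] continuous_map_borel_measurable[OF f refl], symmetric])
  finally show "section_map G (canonical_map X m f) = complex_integral B (class_measure B m G) f" .
next
  show "complex_measure B (\<lambda>E. 0)" by (simp add: complex_measure_def)
  show "singular_wrt B m (\<lambda>E. 0)" unfolding singular_wrt_def by auto
qed simp

section \<open>Exactness and the direct sum decomposition\<close>

lemma short_exact_phi: "short_exact (K_phi X m) (Linf_dual X m) (L1 X m) (\<lambda>l. l) (phi X m)"
  unfolding short_exact_def
proof (intro conjI)
  show "bounded_linear_map (K_phi X m) (Linf_dual X m) (\<lambda>l. l)"
    by (auto simp: bounded_linear_map_def kernel_space_def intro!: exI[of _ 1])
  show "phi X m ` vcarrier (Linf_dual X m) = vcarrier (L1 X m)"
  proof
    show "phi X m ` vcarrier (Linf_dual X m) \<subseteq> vcarrier (L1 X m)"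
      using bounded_linear_phi by (auto simp: bounded_linear_map_def)
    show "vcarrier (L1 X m) \<subseteq> phi X m ` vcarrier (Linf_dual X m)"
      using phi_section_map section_map_dual by (metis image_eqI subsetI)
  qed
qed (auto simp: bounded_linear_phi kernel_space_def)

end

theorem mainTheorem1:
  fixes X :: "'a topology" and m :: "'a set \<Rightarrow> complex"
  assumes "compact_space X"
    and "Hausdorff_space X"
    and "regular_complex_borel_measure X m"
  shows "short_exact (K_phi X m) (Linf_dual X m) (L1 X m) (\<lambda>l. l) (phi X m)
       \<and> split_surjection (Linf_dual X m) (L1 X m) (phi X m)
       \<and> banach_isomorphic (Linf_dual X m) (direct_sum (L1 X m) (K_phi X m))"
proof -
  interpret regular_measure_space X m
    using assms by unfold_locales
  show ?thesis
    using short_exact_phi bounded_linear_section_map phi_section_map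
      split_imp_direct_sum[OF Linf.seminormed_space_axioms L1.seminormed_space_axioms
        bounded_linear_phi bounded_linear_section_map phi_section_map]
    unfolding split_surjection_def by blast
qed

end
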